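(* There exist positive constants $c_1, c_2, c_3, c_4$ such that the following hold. (a) Let $G$ be an $n$-vertex graph with minimum degree $\delta(G) \geq \delta n$ for some $\delta := \delta(n) \geq c_1 n^{-1/3}$. If $\alpha(G) \leq c_2 \delta^2 n$ and $p := p(n) \geq \max\left\{\omega(n^{-2}), \frac{c_3 \log(1/\delta)}{\delta n^2}\right\}$, then $G \cup \mathbb{G}(n,p)$ is a.a.s. pancyclic. (b) There exists an $n$-vertex graph $H$ with minimum degree $\lfloor n/2 \rfloor - 1$ and independence number $\alpha(H) = 2$ such that if $H \cup \mathbb{G}(n,p)$ is a.a.s. Hamiltonian, then $p := p(n) = \omega(n^{-2})$. (c) For every $\delta := \delta(n)$ with $\delta = \Omega(n^{-1/3})$ and $\delta = o(1)$, there exists an $n$-vertex graph $H$ with minimum degree at least $\delta n$ satisfying $\alpha(H) = O(\delta^2 n)$ such that a.a.s. $H \cup \mathbb{G}(n,p)$ is not Hamiltonian whenever $p := p(n) \leq \frac{c_4 \log(1/\delta)}{\delta n^2}$.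
   Context: For an $n$-vertex graph $G$, $G \cup \mathbb{G}(n,p)$ denotes the union $G \cup R$ where $R$ is the binomial random graph on the vertex set $V(G)$ in which each pair of vertices is an edge independently with probability $p$. "A.a.s." (asymptotically almost surely) means with probability tending to $1$ as $n \to \infty$. $\alpha(G)$ is the independence number and $\delta(G)$ the minimum degree. A graph on $n$ vertices is Hamiltonian if it has a cycle through all vertices, and pancyclic if it contains a cycle of length $\ell$ for every $3 \leq \ell \leq n$. Asymptotic notation ($\omega$, $o$, $O$, $\Omega$) is with respect to $n \to \infty$; e.g. $p = \omega(n^{-2})$ means $p n^2 \to \infty$. *)

theory Defs
  imports Complex_Main "HOL-Library.Landau_Symbols"
begin

definition all_pairs :: "nat \<Rightarrow> nat set set" where
  "all_pairs n = {{u, v} | u v. u < n \<and> v < n \<and> u \<noteq> v}"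

definition is_graph :: "nat \<Rightarrow> nat set set \<Rightarrow> bool" where
  "is_graph n E \<longleftrightarrow> E \<subseteq> all_pairs n"

definition degree :: "nat \<Rightarrow> nat set set \<Rightarrow> nat \<Rightarrow> nat" where
  "degree n E v = card {u. u < n \<and> {u, v} \<in> E}"

definition min_degree :: "nat \<Rightarrow> nat set set \<Rightarrow> nat" where
  "min_degree n E = Min (degree n E ` {..<n})"

definition independent :: "nat \<Rightarrow> nat set set \<Rightarrow> nat set \<Rightarrow> bool" where
  "independent n E S \<longleftrightarrow> S \<subseteq> {..<n} \<and> (\<forall>u\<in>S. \<forall>v\<in>S. {u, v} \<notin> E)"

definition independence_number :: "nat \<Rightarrow> nat set set \<Rightarrow> nat" where
  "independence_number n E = Max (card ` {S. independent n E S})"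

definition has_cycle :: "nat \<Rightarrow> nat set set \<Rightarrow> nat \<Rightarrow> bool" where
  "has_cycle n E l \<longleftrightarrow> 3 \<le> l \<and> (\<exists>vs. length vs = l \<and> distinct vs \<and> set vs \<subseteq> {..<n} \<and>
      (\<forall>i<l. {vs ! i, vs ! ((i + 1) mod l)} \<in> E))"

definition hamiltonian :: "nat \<Rightarrow> nat set set \<Rightarrow> bool" where
  "hamiltonian n E \<longleftrightarrow> has_cycle n E n"

definition pancyclic :: "nat \<Rightarrow> nat set set \<Rightarrow> bool" where
  "pancyclic n E \<longleftrightarrow> (\<forall>l. 3 \<le> l \<and> l \<le> n \<longrightarrow> has_cycle n E l)"

definition prob_union :: "nat \<Rightarrow> nat set set \<Rightarrow> real \<Rightarrow> (nat set set \<Rightarrow> bool) \<Rightarrow> real" where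
  "prob_union n G p P = (\<Sum>R \<in> Pow (all_pairs n).
      (if P (G \<union> R) then p ^ card R * (1 - p) ^ (card (all_pairs n) - card R) else 0))"

end

theory Submission
  imports Defs "HOL-Library.Disjoint_Sets" "HOL-Real_Asymp.Real_Asymp"
begin

text \<open>
  Part (a). Put \<open>d = \<delta>n\<close>. Cutting repeatedly along vertex separators of size below \<open>\<kappa> \<approx> d\<^sup>2/n\<close>
  splits \<open>G\<close>, up to at most \<open>d/2\<close> vertices, into \<open>O(1/\<delta>)\<close> parts without edges between them that are
  \<open>\<kappa>\<close>-connected and have minimum degree at least \<open>d/2\<close>. Inside the parts one finds disjoint clusters
  of equal size \<open>\<approx> d\<close>, each contained in the neighbourhood of its own hub and together covering a
  constant fraction of the vertices. Joining two clusters when a random edge runs between them gives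
  a binomial random graph on \<open>O(1/\<delta>)\<close> vertices which is Hamiltonian by Posa's rotation argument.
  Passing through each cluster via its hub turns this Hamilton cycle into a cycle \<open>C\<close> of length
  \<open>O(1/\<delta>)\<close> in \<open>G \<union> R\<close> that uses an edge of every part.

  A non-spanning cycle of this kind can be enlarged as in the Chvatal-Erdos theorem: a component of
  the uncovered vertices of a part has more than \<open>\<alpha>\<close> neighbours on the cycle, so two of their
  successors are adjacent. The component has diameter \<open>O(1/\<delta>)\<close>, so only \<open>O(1/\<delta>)\<close> lengths are
  skipped in a step. These are recovered from a path of length \<open>O(1/\<delta>)\<close> kept in reserve inside the
  neighbourhood of a single vertex \<open>v\<close>: an edge from \<open>v\<close> to the end of that path can be replaced by a
  detour through any number of its vertices.

  Part (b) takes two disjoint cliques. Part (c) takes disjoint cliques of size \<open>\<delta>n\<close>, of which some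
  receive no random edge to the outside.
\<close>

section \<open>Random subsets of a finite set\<close>

text \<open>The bound on \<delta> makes n/d at most a small multiple of d^2/n. The number of parts,
  the initial cycle, the connecting paths and the reserve path all have order n/d, so they are too
  small to disconnect a part, and the reserve path exists because \<alpha> times its length stays
  below d. The obstacle in the enlargement step is a component of uncovered vertices with few
  neighbours on the cycle. Connectivity then forces it to be all of its part outside the cycle and
  the reserve, and every cycle vertex of the part sees it. It can be absorbed by opening a cycle
  edge inside the part, which is why the cycle has to carry an edge of every part throughout.
  Randomness is spent on the initial cycle only; all later insertions use edges of G. The random
  edges are first made sparse enough to form a matching, so that the two of them used at a cluster
  end at different vertices, which the hub then joins.\<close>

definition random_expectation :: "real \<Rightarrow> 'a set \<Rightarrow> ('a set \<Rightarrow> real) \<Rightarrow> real" where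
  "random_expectation p A f = (\<Sum>R\<in>Pow A. p ^ card R * (1 - p) ^ (card A - card R) * f R)"

definition random_prob :: "real \<Rightarrow> 'a set \<Rightarrow> ('a set \<Rightarrow> bool) \<Rightarrow> real" where
  "random_prob p A Q = random_expectation p A (\<lambda>R. of_bool (Q R))"

lemma prob_union_eq_random_prob:
  "prob_union n G p P = random_prob p (all_pairs n) (\<lambda>R. P (G \<union> R))"
  unfolding prob_union_def random_prob_def random_expectation_def
  by (intro sum.cong) auto

lemma random_expectation_empty [simp]: "random_expectation p {} f = f {}"
  by (simp add: random_expectation_def)

text \<open>Conditioning on one element: the subsets of \<open>insert e A\<close> split into those
  containing \<open>e\<close> and those avoiding it. Inductions over the ground set rest on this
  recursion.\<close>

lemma random_expectation_insert:
  assumes "finite A" "e \<notin> A"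
  shows "random_expectation p (insert e A) f =
    p * random_expectation p A (\<lambda>R. f (insert e R)) + (1 - p) * random_expectation p A f"
proof -
  have inj: "inj_on (insert e) (Pow A)"
    using assms(2) by (auto simp: inj_on_def)
  have cd: "card (insert e R) = Suc (card R)" "card (insert e A) - card R = Suc (card A - card R)"
    if "R \<in> Pow A" for R
  proof -
    have "finite R" "e \<notin> R" "card R \<le> card A"
      using that assms card_mono by (auto dest: finite_subset)
    then show "card (insert e R) = Suc (card R)" "card (insert e A) - card R = Suc (card A - card R)"
      using assms by auto
  qed
  have "random_expectation p (insert e A) f =
     (\<Sum>R\<in>Pow A. p ^ card R * (1 - p) ^ (card (insert e A) - card R) * f R) +
     (\<Sum>R\<in>insert e ` Pow A. p ^ card R * (1 - p) ^ (card (insert e A) - card R) * f R)"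
    unfolding random_expectation_def Pow_insert using assms
    by (intro sum.union_disjoint) auto
  also have "(\<Sum>R\<in>insert e ` Pow A. p ^ card R * (1 - p) ^ (card (insert e A) - card R) * f R)
      = p * random_expectation p A (\<lambda>R. f (insert e R))"
    unfolding random_expectation_def sum.reindex[OF inj] o_def sum_distrib_left
    using cd assms by (intro sum.cong refl) (simp add: mult_ac)
  also have "(\<Sum>R\<in>Pow A. p ^ card R * (1 - p) ^ (card (insert e A) - card R) * f R)
      = (1 - p) * random_expectation p A f"
    unfolding random_expectation_def sum_distrib_left
    using cd by (intro sum.cong refl) (simp add: mult_ac)
  finally show ?thesis by simp
qed

lemma random_expectation_const:
  assumes "finite A"
  shows "random_expectation p A (\<lambda>R. c) = c"
  using assms by induction (auto simp: random_expectation_insert algebra_simps)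

lemma random_expectation_mono:
  assumes "0 \<le> p" "p \<le> 1" "\<And>R. R \<subseteq> A \<Longrightarrow> f R \<le> g R"
  shows "random_expectation p A f \<le> random_expectation p A g"
  unfolding random_expectation_def
  using assms by (intro sum_mono mult_left_mono) auto

lemma random_expectation_cong:
  assumes "\<And>R. R \<subseteq> A \<Longrightarrow> f R = g R"
  shows "random_expectation p A f = random_expectation p A g"
  unfolding random_expectation_def using assms by (intro sum.cong) auto

text \<open>Fubini for the product measure: disjoint ground sets may be exposed one after the other.
  Independence and conditioning below are derived from it.\<close>

lemma random_expectation_union:
  assumes "finite A" "finite B" "A \<inter> B = {}"
  shows "random_expectation p (A \<union> B) f =
    random_expectation p A (\<lambda>R. random_expectation p B (\<lambda>S. f (R \<union> S)))"
  using assms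
proof (induction A arbitrary: f)
  case (insert e A)
  then show ?case
    by (simp add: random_expectation_insert)
qed simp

lemma random_expectation_mult_right:
  "random_expectation p A (\<lambda>R. f R * c) = random_expectation p A f * c"
  by (simp add: random_expectation_def sum_distrib_right mult.assoc)

text \<open>Raising the probability moves weight from the branch without \<open>e\<close> to the
  branch with \<open>e\<close>, which has the larger expectation because \<open>f\<close> is
  monotone.\<close>

lemma random_expectation_mono_p:
  assumes "finite A" "0 \<le> p" "p \<le> q" "q \<le> 1" "\<And>R S. R \<subseteq> S \<Longrightarrow> f R \<le> f S"
  shows "random_expectation p A f \<le> random_expectation q A f"
  using assms(1,5)
proof (induction A arbitrary: f)
  case (insert e A)
  define a b a' b' where "a = random_expectation p A (\<lambda>R. f (insert e R))"
    and "b = random_expectation p A f" and "a' = random_expectation q A (\<lambda>R. f (insert e R))"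
    and "b' = random_expectation q A f"
  have "a \<le> a'"
    unfolding a_def a'_def by (rule insert.IH) (auto intro!: insert.prems)
  moreover have "b \<le> b'"
    unfolding b_def b'_def by (rule insert.IH) (auto intro!: insert.prems)
  moreover have "b \<le> a"
    unfolding a_def b_def using assms by (intro random_expectation_mono insert.prems) auto
  ultimately have "p * a + (1 - p) * b \<le> q * a + (1 - q) * b"
    "q * a + (1 - q) * b \<le> q * a' + (1 - q) * b'"
  proof -
    have "(q - p) * b \<le> (q - p) * a" using assms \<open>b \<le> a\<close> by (intro mult_left_mono) auto
    then show "p * a + (1 - p) * b \<le> q * a + (1 - q) * b" by (simp add: algebra_simps)
    show "q * a + (1 - q) * b \<le> q * a' + (1 - q) * b'"
      using assms \<open>a \<le> a'\<close> \<open>b \<le> b'\<close> by (intro add_mono mult_left_mono) auto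
  qed
  then show ?case
    using insert.hyps by (simp add: random_expectation_insert a_def b_def a'_def b'_def)
qed simp

lemma random_prob_mono_p:
  assumes "finite A" "0 \<le> p" "p \<le> q" "q \<le> 1" "\<And>R S. R \<subseteq> S \<Longrightarrow> Q R \<Longrightarrow> Q S"
  shows "random_prob p A Q \<le> random_prob q A Q"
  unfolding random_prob_def
  by (rule random_expectation_mono_p[OF assms(1-4)]) (auto dest: assms(5))

lemma random_prob_mono:
  assumes "0 \<le> p" "p \<le> 1" "\<And>R. R \<subseteq> A \<Longrightarrow> P R \<Longrightarrow> Q R"
  shows "random_prob p A P \<le> random_prob p A Q"
  unfolding random_prob_def by (rule random_expectation_mono) (use assms in auto)

lemma random_prob_le_1:
  assumes "finite A" "0 \<le> p" "p \<le> 1"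
  shows "random_prob p A Q \<le> 1"
proof -
  have "random_prob p A Q \<le> random_expectation p A (\<lambda>R. 1)"
    unfolding random_prob_def by (rule random_expectation_mono) (use assms in auto)
  then show ?thesis by (simp add: random_expectation_const assms)
qed

lemma random_prob_compl:
  assumes "finite A"
  shows "random_prob p A (\<lambda>R. \<not> Q R) = 1 - random_prob p A Q"
proof -
  have "random_prob p A (\<lambda>R. \<not> Q R) + random_prob p A Q = random_expectation p A (\<lambda>R. 1)"
    unfolding random_prob_def random_expectation_def sum.distrib[symmetric]
    by (intro sum.cong) (auto simp: of_bool_def)
  then show ?thesis by (simp add: random_expectation_const assms)
qed

lemma random_prob_disj_le:
  assumes "0 \<le> p" "p \<le> 1"
  shows "random_prob p A (\<lambda>R. P R \<or> Q R) \<le> random_prob p A P + random_prob p A Q"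
proof -
  have "random_prob p A (\<lambda>R. P R \<or> Q R) \<le> random_expectation p A (\<lambda>R. of_bool (P R) + of_bool (Q R))"
    unfolding random_prob_def by (rule random_expectation_mono) (use assms in auto)
  also have "\<dots> = random_prob p A P + random_prob p A Q"
    unfolding random_prob_def random_expectation_def
    by (simp add: sum.distrib algebra_simps)
  finally show ?thesis .
qed

lemma random_prob_Bex_le:
  assumes "0 \<le> p" "p \<le> 1" "finite I"
  shows "random_prob p A (\<lambda>R. \<exists>i\<in>I. Q i R) \<le> (\<Sum>i\<in>I. random_prob p A (Q i))"
  using assms(3)
proof induction
  case empty
  then show ?case by (simp add: random_prob_def random_expectation_def)
next
  case (insert i I)
  have "random_prob p A (\<lambda>R. \<exists>j\<in>insert i I. Q j R) = random_prob p A (\<lambda>R. Q i R \<or> (\<exists>j\<in>I. Q j R))"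
    by simp
  then show ?case
    using insert random_prob_disj_le[OF assms(1,2), of A "Q i" "\<lambda>R. \<exists>j\<in>I. Q j R"] by auto
qed

text \<open>Deferred decisions: a bound valid for each outcome outside \<open>B\<close> survives
  averaging over these outcomes. It serves to expose the random edges at one cluster last.\<close>

lemma random_prob_cond_le:
  assumes "finite A" "B \<subseteq> A" "0 \<le> p" "p \<le> 1"
    and "\<And>R. R \<subseteq> A - B \<Longrightarrow> random_prob p B (\<lambda>S. Q (R \<union> S)) \<le> c"
  shows "random_prob p A Q \<le> c"
proof -
  have fB: "finite B" "finite (A - B)" "(A - B) \<inter> B = {}" "(A - B) \<union> B = A"
    using assms by (auto dest: finite_subset)
  have "random_prob p A Q = random_expectation p (A - B) (\<lambda>R. random_prob p B (\<lambda>S. Q (R \<union> S)))"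
    unfolding random_prob_def
    using random_expectation_union[OF fB(2,1,3), of p "\<lambda>R. of_bool (Q R)"] fB(4) by simp
  also have "\<dots> \<le> random_expectation p (A - B) (\<lambda>R. c)"
    by (rule random_expectation_mono) (use assms in auto)
  finally show ?thesis using fB by (simp add: random_expectation_const)
qed

lemma random_prob_indep:
  assumes "finite A" "B \<subseteq> A"
  shows "random_prob p A (\<lambda>R. P (R - B) \<and> Q (R \<inter> B)) = random_prob p (A - B) P * random_prob p B Q"
proof -
  have fB: "finite B" "finite (A - B)" "(A - B) \<inter> B = {}" "(A - B) \<union> B = A"
    using assms by (auto dest: finite_subset)
  have eq: "(R \<union> S) - B = R" "(R \<union> S) \<inter> B = S" if "R \<subseteq> A - B" "S \<subseteq> B" for R S
    using that by auto
  have "random_prob p A (\<lambda>R. P (R - B) \<and> Q (R \<inter> B)) = random_expectation p (A - B)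
      (\<lambda>R. random_expectation p B (\<lambda>S. of_bool (P ((R \<union> S) - B) \<and> Q ((R \<union> S) \<inter> B))))"
    unfolding random_prob_def
    using random_expectation_union[OF fB(2,1,3), of p "\<lambda>R. of_bool (P (R - B) \<and> Q (R \<inter> B))"] fB(4)
    by simp
  also have "\<dots> = random_expectation p (A - B)
      (\<lambda>R. random_expectation p B (\<lambda>S. of_bool (Q S) * of_bool (P R)))"
    by (intro random_expectation_cong) (auto simp: eq)
  also have "\<dots> = random_prob p (A - B) P * random_prob p B Q"
    unfolding random_prob_def random_expectation_mult_right
    by (subst mult.commute) (simp add: random_expectation_mult_right)
  finally show ?thesis .
qed

lemma random_prob_disjoint_self:
  assumes "finite T"
  shows "random_prob p T (\<lambda>R. R \<inter> T = {}) = (1 - p) ^ card T"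
proof -
  have "random_prob p T (\<lambda>R. R \<inter> T = {}) =
    (\<Sum>R\<in>{{}}. p ^ card R * (1 - p) ^ (card T - card R) * of_bool (R \<inter> T = {}))"
    unfolding random_prob_def random_expectation_def using assms
    by (intro sum.mono_neutral_right) auto
  then show ?thesis by simp
qed

lemma random_prob_disjoint:
  assumes "finite A" "T \<subseteq> A"
  shows "random_prob p A (\<lambda>R. R \<inter> T = {}) = (1 - p) ^ card T"
proof -
  have "random_prob p A (\<lambda>R. R \<inter> T = {}) = random_prob p A (\<lambda>R. True \<and> (R \<inter> T) \<inter> T = {})"
    by (simp add: Int_assoc)
  also have "\<dots> = random_prob p (A - T) (\<lambda>R. True) * random_prob p T (\<lambda>R. R \<inter> T = {})"
    using random_prob_indep[OF assms, of p "\<lambda>_. True" "\<lambda>R. R \<inter> T = {}"] .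
  also have "random_prob p (A - T) (\<lambda>R. True) = 1"
    using random_expectation_const[of "A - T" p 1] assms by (simp add: random_prob_def)
  finally show ?thesis
    using assms random_prob_disjoint_self[of T p] by (auto dest: finite_subset)
qed

lemma random_prob_mem:
  assumes "finite A" "e \<in> A"
  shows "random_prob p A (\<lambda>R. e \<in> R) = p"
  using random_prob_disjoint[of A "{e}" p] assms
    random_prob_compl[of A p "\<lambda>R. e \<in> R"] by simp

lemma random_prob_mem2:
  assumes "finite A" "e \<in> A" "f \<in> A" "e \<noteq> f"
  shows "random_prob p A (\<lambda>R. e \<in> R \<and> f \<in> R) = p\<^sup>2"
proof -
  have "random_prob p A (\<lambda>R. e \<in> R \<and> f \<in> R) = random_prob p A (\<lambda>R. f \<in> R - {e} \<and> e \<in> R \<inter> {e})"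
    using assms by (intro arg_cong[where f = "random_prob p A"]) auto
  also have "\<dots> = random_prob p (A - {e}) (\<lambda>R. f \<in> R) * random_prob p {e} (\<lambda>R. e \<in> R)"
    using assms by (intro random_prob_indep) auto
  also have "\<dots> = p\<^sup>2"
    using assms by (simp add: random_prob_mem power2_eq_square)
  finally show ?thesis .
qed

text \<open>Peeling off an index exposes \<open>T i\<close> separately from the rest. This evaluates
  the event that each of several cliques receives a random edge from outside.\<close>

lemma random_prob_hit_all:
  assumes "finite A" "finite I" "\<And>i. i \<in> I \<Longrightarrow> T i \<subseteq> A" "disjoint_family_on T I"
  shows "random_prob p A (\<lambda>R. \<forall>i\<in>I. R \<inter> T i \<noteq> {}) = (\<Prod>i\<in>I. 1 - (1 - p) ^ card (T i))"
  using assms(2,1,3,4)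
proof (induction I arbitrary: A)
  case empty
  then show ?case using random_expectation_const[of A p 1] by (simp add: random_prob_def)
next
  case (insert i I)
  have disj: "T j \<inter> T i = {}" if "j \<in> I" for j
    using insert.prems(3) insert.hyps(2) that unfolding disjoint_family_on_def by auto
  have *: "(R - T i) \<inter> T j = R \<inter> T j" if "j \<in> I" for R j
    using disj[OF that] by auto
  have "random_prob p A (\<lambda>R. \<forall>j\<in>insert i I. R \<inter> T j \<noteq> {}) =
     random_prob p A (\<lambda>R. (\<forall>j\<in>I. (R - T i) \<inter> T j \<noteq> {}) \<and> \<not> (R \<inter> T i) \<inter> T i = {})"
    by (intro arg_cong[where f = "random_prob p A"] ext) (use * in auto)
  also have "\<dots> = random_prob p (A - T i) (\<lambda>R. \<forall>j\<in>I. R \<inter> T j \<noteq> {})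
      * random_prob p (T i) (\<lambda>R. \<not> R \<inter> T i = {})"
    using insert.prems
    by (intro random_prob_indep[where Q = "\<lambda>R. \<not> R \<inter> T i = {}" and P = "\<lambda>R. \<forall>j\<in>I. R \<inter> T j \<noteq> {}"]) auto
  also have "random_prob p (A - T i) (\<lambda>R. \<forall>j\<in>I. R \<inter> T j \<noteq> {}) = (\<Prod>i\<in>I. 1 - (1 - p) ^ card (T i))"
    by (rule insert.IH)
      (use insert.prems disj in \<open>auto simp: disjoint_family_on_def\<close>)
  also have "random_prob p (T i) (\<lambda>R. \<not> R \<inter> T i = {}) = 1 - (1 - p) ^ card (T i)"
  proof -
    have "finite (T i)" using insert.prems finite_subset by blast
    then show ?thesis by (simp add: random_prob_compl random_prob_disjoint_self)
  qed
  finally show ?case using insert.hyps by simp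
qed

section \<open>Random graphs that are matchings\<close>

lemma finite_all_pairs [simp]: "finite (all_pairs n)"
proof -
  have "all_pairs n \<subseteq> Pow {..<n}" by (auto simp: all_pairs_def)
  then show ?thesis using finite_subset by blast
qed

text \<open>Guarantees that a Hamilton cycle of clusters enters and leaves each cluster at different
  vertices.\<close>

definition matching :: "'a set set \<Rightarrow> bool" where
  "matching R \<longleftrightarrow> (\<forall>e\<in>R. \<forall>f\<in>R. e \<noteq> f \<longrightarrow> e \<inter> f = {})"

text \<open>Union bound over a vertex \<open>v\<close> and two different random edges at it. With
  \<open>p\<close> at most n^(-8/5) the bound is n^(-1/5).\<close>

lemma random_prob_not_matching:
  assumes "0 \<le> p" "p \<le> 1"
  shows "random_prob p (all_pairs n) (\<lambda>R. \<not> matching R) \<le> real n ^ 3 * p\<^sup>2"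
proof -
  define T :: "(nat \<times> nat \<times> nat) set" where "T = {..<n} \<times> {..<n} \<times> {..<n}"
  define Q where "Q = (\<lambda>(v :: nat, a, b) R. {v, a} \<in> R \<and> {v, b} \<in> R \<and> {v, a} \<noteq> {v, b})"
  have "random_prob p (all_pairs n) (\<lambda>R. \<not> matching R) \<le> random_prob p (all_pairs n) (\<lambda>R. \<exists>t\<in>T. Q t R)"
  proof (rule random_prob_mono[OF assms])
    fix R assume R: "R \<subseteq> all_pairs n" "\<not> matching R"
    then obtain e f v where ef: "e \<in> R" "f \<in> R" "e \<noteq> f" "v \<in> e" "v \<in> f"
      unfolding matching_def by blast
    have *: "\<exists>a<n. e = {v, a} \<and> v < n" if e: "e \<in> R" "v \<in> e" for e
    proof -
      obtain x y where "e = {x, y}" "x < n" "y < n"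
        using R e unfolding all_pairs_def by blast
      with e(2) show ?thesis by (metis insert_commute insert_iff singletonD)
    qed
    obtain a where a: "e = {v, a}" "v < n" "a < n" using *[OF ef(1,4)] by blast
    obtain b where b: "f = {v, b}" "b < n" using *[OF ef(2,5)] by blast
    show "\<exists>t\<in>T. Q t R"
      by (rule bexI[of _ "(v, a, b)"]) (use a b ef in \<open>auto simp: Q_def T_def\<close>)
  qed
  also have "\<dots> \<le> (\<Sum>t\<in>T. random_prob p (all_pairs n) (Q t))"
    by (rule random_prob_Bex_le[OF assms]) (simp add: T_def)
  also have "\<dots> \<le> (\<Sum>t\<in>T. p\<^sup>2)"
  proof (rule sum_mono)
    fix t assume "t \<in> T"
    obtain v a b where t: "t = (v, a, b)" by (cases t) auto
    show "random_prob p (all_pairs n) (Q t) \<le> p\<^sup>2"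
    proof (cases "{v, a} \<in> all_pairs n \<and> {v, b} \<in> all_pairs n \<and> {v, a} \<noteq> {v, b}")
      case True
      have "random_prob p (all_pairs n) (Q t) \<le> random_prob p (all_pairs n) (\<lambda>R. {v, a} \<in> R \<and> {v, b} \<in> R)"
        by (rule random_prob_mono[OF assms]) (auto simp: Q_def t)
      also have "\<dots> = p\<^sup>2" by (rule random_prob_mem2) (use True in auto)
      finally show ?thesis .
    next
      case False
      have "random_prob p (all_pairs n) (Q t) \<le> random_prob p (all_pairs n) (\<lambda>R. False)"
        by (rule random_prob_mono[OF assms]) (use False in \<open>auto simp: Q_def t\<close>)
      also have "\<dots> \<le> p\<^sup>2" by (simp add: random_prob_def random_expectation_def)
      finally show ?thesis .
    qed
  qed
  also have "\<dots> = real n ^ 3 * p\<^sup>2" by (simp add: T_def power3_eq_cube mult_ac)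
  finally show ?thesis .
qed

section \<open>Longest paths and rotations\<close>

definition is_path :: "('a \<Rightarrow> 'a \<Rightarrow> bool) \<Rightarrow> 'a set \<Rightarrow> 'a list \<Rightarrow> bool" where
  "is_path adj V xs \<longleftrightarrow> xs \<noteq> [] \<and> distinct xs \<and> set xs \<subseteq> V \<and> successively adj xs"

definition longest_path :: "('a \<Rightarrow> 'a \<Rightarrow> bool) \<Rightarrow> 'a set \<Rightarrow> 'a list \<Rightarrow> bool" where
  "longest_path adj V xs \<longleftrightarrow> is_path adj V xs \<and> (\<forall>ys. is_path adj V ys \<longrightarrow> length ys \<le> length xs)"

definition path_ends :: "('a \<Rightarrow> 'a \<Rightarrow> bool) \<Rightarrow> 'a set \<Rightarrow> 'a set" where
  "path_ends adj V = {last xs | xs. longest_path adj V xs}"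

definition path_ends_from :: "('a \<Rightarrow> 'a \<Rightarrow> bool) \<Rightarrow> 'a set \<Rightarrow> 'a \<Rightarrow> 'a set" where
  "path_ends_from adj V x = {last xs | xs. longest_path adj V xs \<and> hd xs = x}"

definition neighbours :: "('a \<Rightarrow> 'a \<Rightarrow> bool) \<Rightarrow> 'a set \<Rightarrow> 'a set \<Rightarrow> 'a set" where
  "neighbours adj V S = {y \<in> V - S. \<exists>x\<in>S. adj x y}"

definition adjacent_in :: "'a list \<Rightarrow> 'a \<Rightarrow> 'a \<Rightarrow> bool" where
  "adjacent_in xs a b \<longleftrightarrow> (\<exists>A B. xs = A @ a # b # B \<or> xs = A @ b # a # B)"

lemma successively_flip:
  assumes "\<And>x y. adj x y \<Longrightarrow> adj y x"
  shows "successively (\<lambda>x y. adj y x) xs \<longleftrightarrow> successively adj xs"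
  by (rule successively_cong) (use assms in auto)

lemma is_path_rev:
  assumes "\<And>x y. adj x y \<Longrightarrow> adj y x"
  shows "is_path adj V (rev xs) \<longleftrightarrow> is_path adj V xs"
  by (simp add: is_path_def successively_flip[of adj, OF assms])

lemma ex_longest_path:
  assumes "finite V" "is_path adj V xs"
  obtains ys where "longest_path adj V ys"
proof -
  have bdd: "length ys \<le> card V" if "is_path adj V ys" for ys
    using that assms(1) unfolding is_path_def by (metis card_mono distinct_card)
  obtain ys where "is_path adj V ys" "\<forall>zs. is_path adj V zs \<longrightarrow> length zs \<le> length ys"
    using ex_has_greatest_nat[of "is_path adj V" xs length "Suc (card V)"] assms(2) bdd
    by (metis less_Suc_eq_le)
  then show thesis using that by (auto simp: longest_path_def)
qed

lemma adjacent_in_split: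
  assumes "distinct (A @ y # B)" "adjacent_in (A @ y # B) y z"
  shows "A \<noteq> [] \<and> z = last A \<or> B \<noteq> [] \<and> z = hd B"
proof -
  obtain C D where "A @ y # B = C @ y # z # D \<or> A @ y # B = C @ z # y # D"
    using assms(2) unfolding adjacent_in_def by blast
  then show ?thesis
  proof
    assume *: "A @ y # B = C @ y # z # D"
    then have "B = z # D"
      using assms(1) by (subst (asm) append_Cons_eq_iff) auto
    then show ?thesis by simp
  next
    assume *: "A @ y # B = C @ z # y # D"
    then have "A @ y # B = (C @ [z]) @ y # D" by simp
    then have "A = C @ [z]"
      using assms(1) by (subst (asm) append_Cons_eq_iff) auto
    then show ?thesis by simp
  qed
qed

lemma adjacent_in_commute: "adjacent_in xs a b \<longleftrightarrow> adjacent_in xs b a"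
  unfolding adjacent_in_def by blast

lemma adjacent_in_rev: "adjacent_in (rev xs) a b \<longleftrightarrow> adjacent_in xs a b"
proof -
  have *: "adjacent_in (rev xs) a b" if "adjacent_in xs a b" for xs :: "'a list" and a b
    using that unfolding adjacent_in_def
    by (auto simp: ) (metis append.assoc append_Cons append_Nil)+
  show ?thesis using *[of xs] *[of "rev xs"] by auto
qed

lemma adjacent_in_Nil [simp]: "\<not> adjacent_in [] a b"
  by (simp add: adjacent_in_def)

lemma adjacent_in_Cons:
  "adjacent_in (x # xs) a b \<longleftrightarrow>
     adjacent_in xs a b \<or> xs \<noteq> [] \<and> (a = x \<and> b = hd xs \<or> b = x \<and> a = hd xs)"
proof -
  have *: "(\<exists>A B. x # xs = A @ a # b # B) \<longleftrightarrow> (\<exists>A B. xs = A @ a # b # B) \<or> xs \<noteq> [] \<and> a = x \<and> b = hd xs"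
    for a b
    by (cases xs) (auto simp: Cons_eq_append_conv)
  show ?thesis unfolding adjacent_in_def ex_disj_distrib * by argo
qed

lemma adjacent_in_append:
  "adjacent_in (A @ B) a b \<longleftrightarrow> adjacent_in A a b \<or> adjacent_in B a b \<or>
     A \<noteq> [] \<and> B \<noteq> [] \<and> (a = last A \<and> b = hd B \<or> b = last A \<and> a = hd B)"
  by (induction A) (auto simp: adjacent_in_Cons hd_append)

text \<open>Posa's rotations with the first vertex fixed. The last vertex sees the pivot
  \<open>y\<close>; reversing the segment after \<open>y\<close> makes the old successor of
  \<open>y\<close> the new end.\<close>

inductive_set rotations :: "('a \<Rightarrow> 'a \<Rightarrow> bool) \<Rightarrow> 'a list \<Rightarrow> 'a list set" for adj xs where
  rotations_base: "xs \<in> rotations adj xs"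
| rotations_step: "A @ y # B \<in> rotations adj xs \<Longrightarrow> B \<noteq> [] \<Longrightarrow> adj (last B) y \<Longrightarrow>
    A @ y # rev B \<in> rotations adj xs"

text \<open>Let \<open>S\<close> be the set of ends reachable by rotations. Every neighbour of
  \<open>S\<close> outside \<open>S\<close> is next to a member of \<open>S\<close> on the original
  path \<open>xs\<close>, so \<open>S\<close> has at most \<open>2 * card S\<close> neighbours, and
  expansion makes \<open>S\<close> larger than \<open>k\<close>. By maximality all neighbours of an
  end lie on the path, so each can serve as a pivot.\<close>

lemma posa_rotation:
  fixes adj :: "'a \<Rightarrow> 'a \<Rightarrow> bool"
  assumes sym: "\<And>x y. adj x y \<Longrightarrow> adj y x" and fin: "finite V"
    and long: "longest_path adj V xs"
    and expand: "\<And>S. S \<subseteq> V \<Longrightarrow> S \<noteq> {} \<Longrightarrow> card S \<le> k \<Longrightarrow> 2 * card S < card (neighbours adj V S)"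
  shows "k < card (path_ends_from adj V (hd xs))"
proof -
  define S where "S = last ` rotations adj xs"
  have path: "is_path adj V xs" using long by (simp add: longest_path_def)
  \<comment> \<open>A rotation destroys only the adjacency of the pivot with its successor, and this
    successor becomes an end, that is, a member of \<open>S\<close>.\<close>
  have inv: "is_path adj V P \<and> hd P = hd xs \<and> set P = set xs \<and> length P = length xs \<and>
     (\<forall>a b. adjacent_in xs a b \<longrightarrow> adjacent_in P a b \<or> a \<in> S \<or> b \<in> S)"
    if "P \<in> rotations adj xs" for P
    using that
  proof induction
    case rotations_base
    then show ?case using path by auto
  next
    case (rotations_step A y B)
    have S: "hd B \<in> S"
      using rotations.rotations_step[OF rotations_step.hyps] rotations_step.hyps(2)
      unfolding S_def by (force simp: last_rev)
    have IH: "is_path adj V (A @ y # B)" using rotations_step by blast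
    have "is_path adj V (A @ y # rev B)"
      using IH rotations_step.hyps(2) sym[OF rotations_step.hyps(3)] unfolding is_path_def
      by (auto simp: successively_append_iff successively_Cons successively_flip[of adj, OF sym] hd_rev)
    moreover have "adjacent_in (A @ y # rev B) a b \<or> a \<in> S \<or> b \<in> S" if "adjacent_in xs a b" for a b
    proof -
      have "adjacent_in (A @ y # B) a b \<or> a \<in> S \<or> b \<in> S" using rotations_step.IH that by blast
      moreover have "adjacent_in ((A @ [y]) @ rev B) a b \<or> a \<in> S \<or> b \<in> S"
        if "adjacent_in ((A @ [y]) @ B) a b"
        using that S unfolding adjacent_in_append[of "A @ [y]"] adjacent_in_rev by auto
      ultimately show ?thesis by auto
    qed
    ultimately show ?case using rotations_step by (cases A) auto
  qed
  have sub: "S \<subseteq> path_ends_from adj V (hd xs)"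
    unfolding S_def path_ends_from_def longest_path_def
    using inv long by (force simp: longest_path_def)
  have SV: "S \<subseteq> V"
    unfolding S_def using inv by (force simp: is_path_def)
  have "S \<noteq> {}" unfolding S_def using rotations_base[of xs adj] by auto
  have finS: "finite S" using SV fin finite_subset by blast
  define T where "T z = {y. adjacent_in xs z y}" for z
  have T2: "finite (T z) \<and> card (T z) \<le> 2" for z
  proof (cases "z \<in> set xs")
    case True
    then obtain A B where AB: "xs = A @ z # B" by (meson split_list)
    have "T z \<subseteq> {last A, hd B}"
      using adjacent_in_split[of A z B] path AB unfolding T_def is_path_def by blast
    moreover have "card {last A, hd B} \<le> 2" by (simp add: card_insert_if)
    ultimately show ?thesis by (meson card_mono finite.emptyI finite_insert finite_subset le_trans)
  next
    case False
    then have "T z = {}" unfolding T_def adjacent_in_def by auto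
    then show ?thesis by simp
  qed
  have "neighbours adj V S \<subseteq> (\<Union>z\<in>S. T z)"
  proof
    fix y assume y: "y \<in> neighbours adj V S"
    then obtain x where x: "x \<in> S" "adj x y" "y \<notin> S" "y \<in> V"
      unfolding neighbours_def by blast
    then obtain P where P: "P \<in> rotations adj xs" "last P = x" unfolding S_def by blast
    note invP = inv[OF P(1)]
    have "y \<in> set P"
    proof (rule ccontr)
      assume "y \<notin> set P"
      then have "is_path adj V (P @ [y])"
        using invP x P unfolding is_path_def by (auto simp: successively_append_iff)
      then show False using long invP unfolding longest_path_def by fastforce
    qed
    then obtain A B where AB: "P = A @ y # B" by (meson split_list)
    have B: "B \<noteq> []" using AB P x by auto
    have zS: "hd B \<in> S"
      using rotations_step[of A y B adj xs] P AB B x unfolding S_def by (force simp: last_rev)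
    have distP: "distinct (A @ y # B)" using invP AB by (simp add: is_path_def)
    obtain C D where CD: "xs = C @ y # D" using \<open>y \<in> set P\<close> invP by (metis split_list)
    show "y \<in> (\<Union>z\<in>S. T z)"
    proof (rule ccontr)
      assume neg: "y \<notin> (\<Union>z\<in>S. T z)"
      have keep: "adjacent_in P y b \<and> b \<notin> S" if "adjacent_in xs y b" for b
        using that neg invP x(3) unfolding T_def by (auto simp: adjacent_in_commute)
      have lst: "A \<noteq> [] \<and> b = last A" if "adjacent_in xs y b" for b
        using adjacent_in_split[OF distP, of b] keep[OF that] zS AB by auto
      have distx: "distinct (C @ y # D)" using path CD by (simp add: is_path_def)
      \<comment> \<open>If \<open>y\<close> had no \<open>xs\<close>-neighbour in \<open>S\<close>,
        all its adjacencies would survive in \<open>P\<close>. As \<open>hd B\<close> is in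
        \<open>S\<close>, its only possible \<open>xs\<close>-neighbour is then
        \<open>last A\<close>, so \<open>y\<close> cannot have one on each side in
        \<open>xs\<close>.\<close>
      have "D = []"
      proof (rule ccontr)
        assume D: "D \<noteq> []"
        then have "adjacent_in xs y (hd D)" unfolding CD adjacent_in_def by (metis list.collapse)
        note d = lst[OF this]
        show False
        proof (cases C rule: rev_cases)
          case Nil
          then have "hd P = y" using invP CD by simp
          then show False using d AB distP by (cases A) auto
        next
          case (snoc C' c)
          then have "adjacent_in xs y c" unfolding CD adjacent_in_def by auto
          then have "c = hd D" using lst d by simp
          then show False using distx snoc D by auto
        qed
      qed
      then have "last xs = y" using CD by simp
      then show False using x(3) rotations_base[of xs adj] unfolding S_def by auto
    qed
  qed
  then have "card (neighbours adj V S) \<le> card (\<Union>z\<in>S. T z)"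
    using T2 finS by (intro card_mono) auto
  also have "\<dots> \<le> (\<Sum>z\<in>S. card (T z))" by (rule card_UN_le[OF finS])
  also have "\<dots> \<le> (\<Sum>z\<in>S. 2)" using T2 by (intro sum_mono) auto
  finally have "card (neighbours adj V S) \<le> 2 * card S" by simp
  then have "k < card S" using expand[OF SV \<open>S \<noteq> {}\<close>] by fastforce
  also have "card S \<le> card (path_ends_from adj V (hd xs))"
  proof (rule card_mono[OF _ sub])
    have "path_ends_from adj V (hd xs) \<subseteq> V"
      unfolding path_ends_from_def longest_path_def is_path_def by auto
    then show "finite (path_ends_from adj V (hd xs))" using fin finite_subset by blast
  qed
  finally show ?thesis .
qed

text \<open>The possible ends are determined by adjacency inside \<open>V\<close>. Hence they are
  independent of the random edges at an index outside \<open>V\<close>, which is exactly what the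
  probabilistic estimate exploits.\<close>

lemma path_ends_cong:
  assumes "\<And>x y. x \<in> V \<Longrightarrow> y \<in> V \<Longrightarrow> adj x y = adj' x y"
  shows "path_ends adj V = path_ends adj' V" "path_ends_from adj V = path_ends_from adj' V"
proof -
  have "successively adj xs = successively adj' xs" if "set xs \<subseteq> V" for xs
    by (rule successively_cong) (use assms that in auto)
  then have "is_path adj V = is_path adj' V" unfolding is_path_def by (intro ext) blast
  then have "longest_path adj V = longest_path adj' V" unfolding longest_path_def by simp
  then show "path_ends adj V = path_ends adj' V" "path_ends_from adj V = path_ends_from adj' V"
    unfolding path_ends_def path_ends_from_def by auto
qed

lemma path_ends_subset: "path_ends adj V \<subseteq> V" "path_ends_from adj V x \<subseteq> V"
  unfolding path_ends_def path_ends_from_def longest_path_def is_path_def by auto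

lemma path_endsE:
  assumes sym: "\<And>x y. adj x y \<Longrightarrow> adj y x" and "x \<in> path_ends adj V"
  obtains xs where "longest_path adj V xs" "hd xs = x"
proof -
  obtain xs where xs: "longest_path adj V xs" "last xs = x"
    using assms(2) unfolding path_ends_def by blast
  have "longest_path adj V (rev xs)"
    using xs is_path_rev[of adj V xs] sym unfolding longest_path_def by auto
  then show thesis using that[of "rev xs"] xs
    by (simp add: hd_rev longest_path_def)
qed

text \<open>Explains the factor 4 in the expansion below: Posa's argument deletes up to two
  vertices, costing at most \<open>2 \<le> 2 * card S\<close> neighbours, and rotations need factor
  2 afterwards.\<close>

lemma neighbours_remove:
  assumes "finite V" "card (V - V') \<le> 2" "4 * card S < card (neighbours adj V S)" "card S \<ge> 1"
    "V' \<subseteq> V"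
  shows "2 * card S < card (neighbours adj V' S)"
proof -
  have "finite (neighbours adj V' S)" "finite (V - V')"
    using assms finite_subset[of V' V] unfolding neighbours_def by auto
  moreover have "neighbours adj V S \<subseteq> neighbours adj V' S \<union> (V - V')"
    unfolding neighbours_def by auto
  ultimately have "card (neighbours adj V S) \<le> card (neighbours adj V' S) + card (V - V')"
    by (meson card_Un_le card_mono finite_UnI le_trans)
  then show ?thesis using assms by linarith
qed

definition is_cycle :: "('a \<Rightarrow> 'a \<Rightarrow> bool) \<Rightarrow> 'a list \<Rightarrow> bool" where
  "is_cycle adj xs \<longleftrightarrow> 3 \<le> length xs \<and> distinct xs \<and> successively adj xs \<and> adj (last xs) (hd xs)"

text \<open>Posa's argument: a longest path of \<open>V - {z}\<close> that misses \<open>v\<close> is a longest path of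
  \<open>V - {z, v}\<close>, so it can be prolonged to \<open>v\<close> as soon as \<open>v\<close> sees the set of its possible ends.\<close>

lemma expander_hamiltonian:
  fixes adj :: "'a \<Rightarrow> 'a \<Rightarrow> bool"
  assumes sym: "\<And>x y. adj x y \<Longrightarrow> adj y x" and fin: "finite V" and z: "z \<in> V" and V3: "3 \<le> card V"
    and end_avoiding: "\<And>v. v \<in> V - {z} \<Longrightarrow> \<exists>x\<in>path_ends adj (V - {z, v}). adj v x"
    and start: "\<exists>x\<in>path_ends adj (V - {z}). adj z x"
    and finish: "\<And>x. x \<in> path_ends adj (V - {z}) \<Longrightarrow> \<exists>y\<in>path_ends_from adj (V - {z}) x. adj z y"
  shows "\<exists>xs. is_cycle adj xs \<and> set xs = V"
proof -
  obtain x where x: "x \<in> path_ends adj (V - {z})" "adj z x" using start by blast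
  obtain y where y: "y \<in> path_ends_from adj (V - {z}) x" "adj z y" using finish[OF x(1)] by blast
  obtain P where P: "longest_path adj (V - {z}) P" "hd P = x" "last P = y"
    using y unfolding path_ends_from_def by blast
  have Pp: "is_path adj (V - {z}) P" using P by (simp add: longest_path_def)
  have PV: "set P = V - {z}"
  proof (rule ccontr)
    assume "set P \<noteq> V - {z}"
    then obtain v where v: "v \<in> V - {z}" "v \<notin> set P" using Pp by (auto simp: is_path_def)
    then obtain e where e: "e \<in> path_ends adj (V - {z, v})" "adj v e" using end_avoiding by blast
    then obtain Q where Q: "longest_path adj (V - {z, v}) Q" "last Q = e"
      unfolding path_ends_def by blast
    have "is_path adj (V - {z, v}) P" using Pp v by (auto simp: is_path_def)
    then have "length P \<le> length Q" using Q by (simp add: longest_path_def)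
    moreover have "is_path adj (V - {z}) (Q @ [v])"
      using Q e v sym by (auto simp: longest_path_def is_path_def successively_append_iff)
    ultimately show False using P unfolding longest_path_def by fastforce
  qed
  have len: "length P = card V - 1"
    using Pp PV z fin by (metis card_Diff_singleton distinct_card is_path_def)
  have "is_cycle adj (z # P)"
    unfolding is_cycle_def using Pp P x y V3 len sym
    by (auto simp: is_path_def successively_Cons)
  moreover have "set (z # P) = V" using PV z by auto
  ultimately show ?thesis by blast
qed

section \<open>Hamilton cycles through random clusters\<close>

definition cross :: "'a set \<Rightarrow> 'a set \<Rightarrow> 'a set set" where
  "cross A B = {{x, y} | x y. x \<in> A \<and> y \<in> B}"

lemma card_cross:
  assumes "finite A" "finite B" "A \<inter> B = {}"
  shows "card (cross A B) = card A * card B"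
proof -
  have "cross A B = (\<lambda>(x, y). {x, y}) ` (A \<times> B)" unfolding cross_def by auto
  moreover have "inj_on (\<lambda>(x, y). {x, y}) (A \<times> B)"
    using assms(3) by (auto simp: inj_on_def doubleton_eq_iff)
  ultimately show ?thesis by (simp add: card_image card_cartesian_product)
qed

lemma cross_subset_all_pairs:
  assumes "A \<subseteq> {..<n}" "B \<subseteq> {..<n}" "A \<inter> B = {}"
  shows "cross A B \<subseteq> all_pairs n"
  using assms unfolding cross_def all_pairs_def by blast

definition cluster_adj :: "('i \<Rightarrow> 'a set) \<Rightarrow> 'a set set \<Rightarrow> 'i \<Rightarrow> 'i \<Rightarrow> bool" where
  "cluster_adj N R i j \<longleftrightarrow> (\<exists>x\<in>N i. \<exists>y\<in>N j. {x, y} \<in> R)"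

lemma cluster_adj_sym: "cluster_adj N R i j \<Longrightarrow> cluster_adj N R j i"
  unfolding cluster_adj_def by (metis insert_commute)

text \<open>With equal sizes and disjointness, missing all random edges between two disjoint index
  sets has a probability that depends only on the number of index pairs, each of which contributes a
  factor \<open>(1 - p) ^ s\<^sup>2\<close>.\<close>

locale clusters =
  fixes n m s :: nat and N :: "nat \<Rightarrow> nat set"
  assumes N_sub: "\<And>i. i < m \<Longrightarrow> N i \<subseteq> {..<n}"
    and N_card: "\<And>i. i < m \<Longrightarrow> card (N i) = s"
    and N_disj: "disjoint_family_on N {..<m}"
begin

lemma N_finite: "i < m \<Longrightarrow> finite (N i)"
  using N_sub finite_subset by blast

lemma N_int: "i < m \<Longrightarrow> j < m \<Longrightarrow> i \<noteq> j \<Longrightarrow> N i \<inter> N j = {}"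
  using N_disj unfolding disjoint_family_on_def by auto

lemma cross_clusters:
  assumes "S \<subseteq> {..<m}" "T \<subseteq> {..<m}" "S \<inter> T = {}"
  shows "cross (\<Union>(N ` S)) (\<Union>(N ` T)) \<subseteq> all_pairs n"
    and "card (cross (\<Union>(N ` S)) (\<Union>(N ` T))) = s\<^sup>2 * (card S * card T)"
proof -
  have disj: "\<Union>(N ` S) \<inter> \<Union>(N ` T) = {}"
  proof (rule ccontr)
    assume "\<Union>(N ` S) \<inter> \<Union>(N ` T) \<noteq> {}"
    then obtain i j x where "i \<in> S" "j \<in> T" "x \<in> N i" "x \<in> N j" by blast
    moreover have "i \<noteq> j" using \<open>i \<in> S\<close> \<open>j \<in> T\<close> assms by blast
    ultimately show False using N_int[of i j] assms by auto
  qed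
  have sub: "\<Union>(N ` S) \<subseteq> {..<n}" "\<Union>(N ` T) \<subseteq> {..<n}" using N_sub assms by blast+
  show "cross (\<Union>(N ` S)) (\<Union>(N ` T)) \<subseteq> all_pairs n"
    by (rule cross_subset_all_pairs[OF sub disj])
  have card: "card (\<Union>(N ` S)) = s * card S" if "S \<subseteq> {..<m}" for S
  proof -
    have "card (\<Union>(N ` S)) = (\<Sum>i\<in>S. card (N i))"
    proof (rule card_UN_disjoint)
      show "finite S" using that finite_subset by blast
      show "\<forall>i\<in>S. finite (N i)" using that N_finite by blast
      show "\<forall>i\<in>S. \<forall>j\<in>S. i \<noteq> j \<longrightarrow> N i \<inter> N j = {}" using that N_int by (meson lessThan_iff subsetD)
    qed
    also have "\<dots> = (\<Sum>i\<in>S. s)" using N_card that by (intro sum.cong) auto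
    finally show ?thesis by simp
  qed
  have "finite (\<Union>(N ` S))" "finite (\<Union>(N ` T))" using sub finite_subset by blast+
  then show "card (cross (\<Union>(N ` S)) (\<Union>(N ` T))) = s\<^sup>2 * (card S * card T)"
    using card_cross[OF _ _ disj] card assms by (simp add: power2_eq_square mult_ac)
qed

lemma not_cluster_adj_iff:
  "(\<forall>i\<in>S. \<forall>j\<in>T. \<not> cluster_adj N R i j) \<longleftrightarrow> R \<inter> cross (\<Union>(N ` S)) (\<Union>(N ` T)) = {}"
  unfolding cluster_adj_def cross_def by blast

text \<open>By \<open>Z_cong\<close> the set \<open>Z R\<close> is fixed once the edges away from
  cluster \<open>v\<close> are exposed. The pairs between \<open>N v\<close> and the clusters in
  \<open>Z R\<close> are still fresh then, and at least \<open>s\<^sup>2 * k\<close> of them have to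
  be missed.\<close>

lemma random_prob_miss:
  fixes Z :: "nat set set \<Rightarrow> nat set"
  assumes p: "0 \<le> p" "p \<le> 1" and v: "v < m"
    and Z_sub: "\<And>R. Z R \<subseteq> {..<m} - {v}"
    and Z_cong: "\<And>R R'. (\<And>i j. i \<in> {..<m} - {v} \<Longrightarrow> j \<in> {..<m} - {v} \<Longrightarrow>
        cluster_adj N R i j = cluster_adj N R' i j) \<Longrightarrow> Z R = Z R'"
  shows "random_prob p (all_pairs n) (\<lambda>R. k \<le> card (Z R) \<and> (\<forall>i\<in>Z R. \<not> cluster_adj N R v i))
     \<le> (1 - p) ^ (s\<^sup>2 * k)"
proof -
  define B where "B = cross (\<Union>(N ` {v})) (\<Union>(N ` ({..<m} - {v})))"
  have BA: "B \<subseteq> all_pairs n" unfolding B_def using v by (intro cross_clusters) auto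
  show ?thesis
  proof (rule random_prob_cond_le[OF finite_all_pairs BA p])
    fix R assume R: "R \<subseteq> all_pairs n - B"
    have ZR: "Z (R \<union> S) = Z R" if "S \<subseteq> B" for S
    proof (rule Z_cong)
      fix i j assume ij: "i \<in> {..<m} - {v}" "j \<in> {..<m} - {v}"
      have "{x, y} \<notin> B" if "x \<in> N i" "y \<in> N j" for x y
      proof
        assume "{x, y} \<in> B"
        then obtain a b where "{x, y} = {a, b}" "a \<in> N v" unfolding B_def cross_def by auto
        then have "x \<in> N v \<or> y \<in> N v" by (auto simp: doubleton_eq_iff)
        then show False using that N_int[of i v] N_int[of j v] ij v by blast
      qed
      then show "cluster_adj N (R \<union> S) i j = cluster_adj N R i j"
        using that unfolding cluster_adj_def by blast
    qed
    show "random_prob p B (\<lambda>S. k \<le> card (Z (R \<union> S)) \<and>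
        (\<forall>i\<in>Z (R \<union> S). \<not> cluster_adj N (R \<union> S) v i)) \<le> (1 - p) ^ (s\<^sup>2 * k)" (is "random_prob p B ?E \<le> _")
    proof (cases "k \<le> card (Z R)")
      case False
      have "random_prob p B ?E \<le> random_prob p B (\<lambda>_. False)"
        by (rule random_prob_mono[OF p]) (use False ZR in auto)
      also have "\<dots> = 0" by (simp add: random_prob_def random_expectation_def)
      also have "\<dots> \<le> (1 - p) ^ (s\<^sup>2 * k)" using p by simp
      finally show ?thesis .
    next
      case True
      define T where "T = cross (\<Union>(N ` {v})) (\<Union>(N ` Z R))"
      have TB: "T \<subseteq> B" unfolding T_def B_def cross_def using Z_sub[of R] by blast
      have cT: "card T = s\<^sup>2 * card (Z R)"
        unfolding T_def using v Z_sub[of R] by (subst cross_clusters) auto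
      have "random_prob p B ?E \<le> random_prob p B (\<lambda>S. S \<inter> T = {})"
      proof (rule random_prob_mono[OF p])
        fix S assume "S \<subseteq> B" "?E S"
        then have "(R \<union> S) \<inter> T = {}"
          unfolding T_def not_cluster_adj_iff[symmetric] using ZR by auto
        then show "S \<inter> T = {}" by blast
      qed
      also have "\<dots> = (1 - p) ^ card T"
        using BA TB finite_subset finite_all_pairs by (intro random_prob_disjoint) blast+
      also have "\<dots> \<le> (1 - p) ^ (s\<^sup>2 * k)"
        unfolding cT using p True by (intro power_decreasing) auto
      finally show ?thesis .
    qed
  qed
qed

definition expanding :: "nat \<Rightarrow> nat set set \<Rightarrow> bool" where
  "expanding k R \<longleftrightarrow> (\<forall>S\<subseteq>{..<m}. S \<noteq> {} \<and> card S \<le> k \<longrightarrow>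
      4 * card S < card (neighbours (cluster_adj N R) {..<m} S))"

text \<open>A set \<open>S\<close> of size j violating expansion has its neighbours inside some
  \<open>U\<close> of size 4j, so it misses at least m - 5j \<ge> k clusters entirely. There are at
  most m^(5j) choices of \<open>S\<close> and \<open>U\<close>, each of probability at most
  \<open>b ^ j\<close>.\<close>

lemma random_prob_not_expanding:
  assumes p: "0 \<le> p" "p \<le> 1" and m: "10 \<le> m" and k: "k = m div 10"
  shows "random_prob p (all_pairs n) (\<lambda>R. \<not> expanding k R) \<le> real m ^ 6 * (1 - p) ^ (s\<^sup>2 * k)"
proof -
  define b where "b = (1 - p) ^ (s\<^sup>2 * k)"
  have b: "0 \<le> b" using p by (simp add: b_def)
  define X where "X j = {S. S \<subseteq> {..<m} \<and> card S = j}" for j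
  have finX: "finite (X j)" for j unfolding X_def by simp
  have cX: "real (card (X j)) \<le> real m ^ j" if "j \<le> m" for j
    using n_subsets[of "{..<m}" j] binomial_le_pow[OF that] unfolding X_def
    by (simp flip: of_nat_power)
  define Q where "Q j S U R \<longleftrightarrow> R \<inter> cross (\<Union>(N ` S)) (\<Union>(N ` ({..<m} - S - U))) = {}"
    for j :: nat and S U R
  have one: "random_prob p (all_pairs n) (Q j S U) \<le> b ^ j"
    if "j \<in> {1..k}" "S \<in> X j" "U \<in> X (4 * j)" for j S U
  proof -
    have SU: "S \<subseteq> {..<m}" "card S = j" "U \<subseteq> {..<m}" "card U = 4 * j" using that by (auto simp: X_def)
    have "random_prob p (all_pairs n) (Q j S U) = (1 - p) ^ (s\<^sup>2 * (j * card ({..<m} - S - U)))"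
    proof -
      have disj: "S \<inter> ({..<m} - S - U) = {}" "{..<m} - S - U \<subseteq> {..<m}" by auto
      show ?thesis
        unfolding Q_def using cross_clusters[OF SU(1) disj(2,1)] SU(2) by (simp add: random_prob_disjoint)
    qed
    also have "\<dots> \<le> (1 - p) ^ (s\<^sup>2 * (j * k))"
    proof (rule power_decreasing)
      have "k \<le> m - j - 4 * j" using that k by auto
      also have "\<dots> \<le> card ({..<m} - S - U)"
        using SU diff_card_le_card_Diff[of U "{..<m} - S"] finite_subset[of U "{..<m}"]
          card_Diff_subset[of S "{..<m}"] finite_subset[of S "{..<m}"] by simp
      finally show "s\<^sup>2 * (j * k) \<le> s\<^sup>2 * (j * card ({..<m} - S - U))" by simp
    qed (use p in auto)
    also have "\<dots> = b ^ j" unfolding b_def by (simp add: power_mult[symmetric] mult_ac)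
    finally show ?thesis .
  qed
  have "random_prob p (all_pairs n) (\<lambda>R. \<not> expanding k R)
     \<le> random_prob p (all_pairs n) (\<lambda>R. \<exists>j\<in>{1..k}. \<exists>S\<in>X j. \<exists>U\<in>X (4 * j). Q j S U R)"
  proof (rule random_prob_mono[OF p])
    fix R assume "\<not> expanding k R"
    then obtain S where S: "S \<subseteq> {..<m}" "S \<noteq> {}" "card S \<le> k"
      "card (neighbours (cluster_adj N R) {..<m} S) \<le> 4 * card S"
      unfolding expanding_def by (auto simp: not_less)
    have j: "card S \<in> {1..k}"
      using S finite_subset[of S "{..<m}"] by (auto simp: Suc_le_eq card_gt_0_iff)
    have "neighbours (cluster_adj N R) {..<m} S \<subseteq> {..<m}" unfolding neighbours_def by auto
    moreover have "4 * card S \<le> card {..<m}" using S(3) k by simp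
    ultimately obtain U where U: "neighbours (cluster_adj N R) {..<m} S \<subseteq> U" "U \<subseteq> {..<m}" "card U = 4 * card S"
      using S(4) by (metis exists_subset_between finite_lessThan)
    have "Q (card S) S U R"
      unfolding Q_def not_cluster_adj_iff[symmetric] using U(1) unfolding neighbours_def by auto
    then show "\<exists>j\<in>{1..k}. \<exists>S\<in>X j. \<exists>U\<in>X (4 * j). Q j S U R"
      using j S U unfolding X_def by blast
  qed
  also have "\<dots> \<le> (\<Sum>j\<in>{1..k}. \<Sum>S\<in>X j. \<Sum>U\<in>X (4 * j). random_prob p (all_pairs n) (Q j S U))"
    by (intro order_trans[OF random_prob_Bex_le[OF p]] sum_mono finX finite_atLeastAtMost order_refl)
  also have "\<dots> \<le> (\<Sum>j\<in>{1..k}. (real m ^ 5 * b) ^ j)"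
  proof (rule sum_mono)
    fix j assume j: "j \<in> {1..k}"
    then have jm: "j \<le> m" "4 * j \<le> m" using k by auto
    have "(\<Sum>S\<in>X j. \<Sum>U\<in>X (4 * j). random_prob p (all_pairs n) (Q j S U)) \<le> (\<Sum>S\<in>X j. \<Sum>U\<in>X (4 * j). b ^ j)"
      using one[OF j] by (intro sum_mono) auto
    also have "\<dots> = real (card (X j)) * real (card (X (4 * j))) * b ^ j" by simp
    also have "\<dots> \<le> real m ^ j * real m ^ (4 * j) * b ^ j"
      using cX[OF jm(1)] cX[OF jm(2)] b by (intro mult_mono) auto
    also have "\<dots> = (real m ^ 5 * b) ^ j"
      by (simp add: power_mult_distrib flip: power_mult power_add)
    finally show "(\<Sum>S\<in>X j. \<Sum>U\<in>X (4 * j). random_prob p (all_pairs n) (Q j S U)) \<le> (real m ^ 5 * b) ^ j" .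
  qed
  finally have main: "random_prob p (all_pairs n) (\<lambda>R. \<not> expanding k R) \<le> (\<Sum>j\<in>{1..k}. (real m ^ 5 * b) ^ j)" .
  show ?thesis
  \<comment> \<open>When \<open>real m ^ 5 * b\<close> is at most 1, each of the k \<le> m terms is
    at most the first power; otherwise the claimed bound is at least 1 and holds trivially.\<close>
  proof (cases "real m ^ 5 * b \<le> 1")
    case True
    have "(\<Sum>j\<in>{1..k}. (real m ^ 5 * b) ^ j) \<le> (\<Sum>j\<in>{1..k}. real m ^ 5 * b)"
    proof (rule sum_mono)
      fix j assume "j \<in> {1..k}"
      then show "(real m ^ 5 * b) ^ j \<le> real m ^ 5 * b"
        using power_decreasing[of 1 j "real m ^ 5 * b"] True b by auto
    qed
    also have "\<dots> = real k * (real m ^ 5 * b)" by simp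
    also have "\<dots> \<le> real m * (real m ^ 5 * b)" using b k by (intro mult_right_mono) auto
    also have "\<dots> = real m ^ 6 * b" by (simp add: eval_nat_numeral)
    finally show ?thesis using main unfolding b_def by linarith
  next
    case False
    have "1 \<le> real m * (real m ^ 5 * b)"
      using False m mult_mono[of 1 "real m" 1 "real m ^ 5 * b"] by auto
    also have "\<dots> = real m ^ 6 * b" by (simp add: eval_nat_numeral)
    finally show ?thesis
      using random_prob_le_1[OF finite_all_pairs p, of n "\<lambda>R. \<not> expanding k R"] unfolding b_def by linarith
  qed
qed

lemma expanding_path_ends:
  assumes m: "10 \<le> m" and k: "k = m div 10" and ex: "expanding k R"
    and V: "V \<subseteq> {..<m}" "card ({..<m} - V) \<le> 2"
  shows "k \<le> card (path_ends (cluster_adj N R) V)"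
    and "x \<in> path_ends (cluster_adj N R) V \<Longrightarrow> k \<le> card (path_ends_from (cluster_adj N R) V x)"
proof -
  define adj where "adj = cluster_adj N R"
  have sym: "adj x y \<Longrightarrow> adj y x" for x y unfolding adj_def by (rule cluster_adj_sym)
  have finV: "finite V" using V finite_subset by blast
  have posa: "k < card (path_ends_from adj V (hd xs))" if "longest_path adj V xs" for xs
  proof (rule posa_rotation[OF sym finV that])
    fix S assume S: "S \<subseteq> V" "S \<noteq> {}" "card S \<le> k"
    have "1 \<le> card S" using S finV finite_subset[of S V] by (auto simp: Suc_le_eq card_gt_0_iff)
    moreover have "4 * card S < card (neighbours adj {..<m} S)"
      using ex S V unfolding expanding_def adj_def by auto
    ultimately show "2 * card S < card (neighbours adj V S)"
      using neighbours_remove[of "{..<m}" V S adj] V by auto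
  qed
  have "V \<noteq> {}" using V(2) m by auto
  then obtain a where "a \<in> V" by blast
  then have "is_path adj V [a]" by (simp add: is_path_def)
  then obtain xs where xs: "longest_path adj V xs" using ex_longest_path[OF finV] by blast
  have "card (path_ends_from adj V (hd xs)) \<le> card (path_ends adj V)"
    using path_ends_subset(1)[of adj V] finV finite_subset[of "path_ends adj V" V]
    unfolding path_ends_def path_ends_from_def by (intro card_mono) auto
  then show "k \<le> card (path_ends (cluster_adj N R) V)" using posa[OF xs] unfolding adj_def by linarith
  show "k \<le> card (path_ends_from (cluster_adj N R) V x)" if "x \<in> path_ends (cluster_adj N R) V"
    using path_endsE[of adj x V] sym posa that unfolding adj_def by (metis less_imp_le)
qed

text \<open>Index 0 plays the part of the special vertex \<open>z\<close> in Posa's argument. If the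
  cluster graph expands, every set of path ends involved has at least \<open>k\<close> members, so
  each remaining failure is that an index misses a large set determined without its own
  edges.\<close>

theorem random_prob_no_cluster_cycle:
  assumes p: "0 \<le> p" "p \<le> 1" and m: "10 \<le> m"
  shows "random_prob p (all_pairs n)
      (\<lambda>R. \<not> (\<exists>xs. is_cycle (cluster_adj N R) xs \<and> set xs = {..<m}))
    \<le> 3 * real m ^ 6 * (1 - p) ^ (s\<^sup>2 * (m div 10))"
proof -
  define k where "k = m div 10"
  define b where "b = (1 - p) ^ (s\<^sup>2 * k)"
  have b: "0 \<le> b" using p by (simp add: b_def)
  let ?a = "cluster_adj N"
  let ?V = "{..<m} - {0}"
  let ?P = "random_prob p (all_pairs n)"
  define E1 where "E1 v R \<longleftrightarrow> k \<le> card (path_ends (?a R) ({..<m} - {0, v})) \<and>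
      (\<forall>i\<in>path_ends (?a R) ({..<m} - {0, v}). \<not> ?a R v i)" for v R
  define E2 where "E2 R \<longleftrightarrow> k \<le> card (path_ends (?a R) ?V) \<and>
      (\<forall>i\<in>path_ends (?a R) ?V. \<not> ?a R 0 i)" for R
  \<comment> \<open>The start of the path is itself random; therefore the event is formed for each
    fixed \<open>x\<close>, with a union bound over all \<open>m\<close> values.\<close>
  define E3 where "E3 x R \<longleftrightarrow> k \<le> card (path_ends_from (?a R) ?V x) \<and>
      (\<forall>i\<in>path_ends_from (?a R) ?V x. \<not> ?a R 0 i)" for x R
  have m0: "0 < m" using m by simp
  have P1: "?P (E1 v) \<le> b" if "v < m" for v
    unfolding E1_def b_def
  proof (rule random_prob_miss[OF p that])
    show "path_ends (?a R) ({..<m} - {0, v}) \<subseteq> {..<m} - {v}" for R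
      using path_ends_subset(1)[of "?a R" "{..<m} - {0, v}"] by auto
  next
    fix R R' assume "\<And>i j. i \<in> {..<m} - {v} \<Longrightarrow> j \<in> {..<m} - {v} \<Longrightarrow> ?a R i j = ?a R' i j"
    then show "path_ends (?a R) ({..<m} - {0, v}) = path_ends (?a R') ({..<m} - {0, v})"
      by (intro path_ends_cong) auto
  qed
  have P2: "?P E2 \<le> b"
    unfolding E2_def b_def
  proof (rule random_prob_miss[OF p m0])
    fix R R' assume "\<And>i j. i \<in> ?V \<Longrightarrow> j \<in> ?V \<Longrightarrow> ?a R i j = ?a R' i j"
    then show "path_ends (?a R) ?V = path_ends (?a R') ?V" by (intro path_ends_cong) auto
  qed (rule path_ends_subset)
  have P3: "?P (E3 x) \<le> b" for x
    unfolding E3_def b_def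
  proof (rule random_prob_miss[OF p m0])
    fix R R' assume "\<And>i j. i \<in> ?V \<Longrightarrow> j \<in> ?V \<Longrightarrow> ?a R i j = ?a R' i j"
    then have "path_ends_from (?a R) ?V = path_ends_from (?a R') ?V" by (intro path_ends_cong) auto
    then show "path_ends_from (?a R) ?V x = path_ends_from (?a R') ?V x" by simp
  qed (rule path_ends_subset)
  have "?P (\<lambda>R. \<not> (\<exists>xs. is_cycle (?a R) xs \<and> set xs = {..<m})) \<le>
    ?P (\<lambda>R. \<not> expanding k R \<or> (E2 R \<or> ((\<exists>v\<in>{..<m}. E1 v R) \<or> (\<exists>x\<in>{..<m}. E3 x R))))"
  proof (rule random_prob_mono[OF p])
    fix R assume no: "\<not> (\<exists>xs. is_cycle (?a R) xs \<and> set xs = {..<m})"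
    show "\<not> expanding k R \<or> (E2 R \<or> ((\<exists>v\<in>{..<m}. E1 v R) \<or> (\<exists>x\<in>{..<m}. E3 x R)))"
    proof (rule ccontr)
      assume neg: "\<not> ?thesis"
      then have ex: "expanding k R" by blast
      note ends = expanding_path_ends[OF m k_def ex]
      have c1: "card ({..<m} - ({..<m} - {0, v})) \<le> 2" if "v < m" for v
      proof -
        have "card ({..<m} - ({..<m} - {0, v})) \<le> card {0, v}" by (intro card_mono) auto
        also have "\<dots> \<le> 2" by (simp add: card_insert_if)
        finally show ?thesis .
      qed
      have c2: "card ({..<m} - ?V) \<le> 2"
      proof -
        have "card ({..<m} - ?V) \<le> card {0::nat}" by (intro card_mono) auto
        then show ?thesis by simp
      qed
      have "\<exists>xs. is_cycle (?a R) xs \<and> set xs = {..<m}"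
      proof (rule expander_hamiltonian[where z = 0])
        show "?a R x y \<Longrightarrow> ?a R y x" for x y by (rule cluster_adj_sym)
        show "finite {..<m}" "0 \<in> {..<m}" "3 \<le> card {..<m}" using m by auto
        show "\<exists>x\<in>path_ends (?a R) ({..<m} - {0, v}). ?a R v x" if "v \<in> {..<m} - {0}" for v
          using neg that ends(1)[of "{..<m} - {0, v}"] c1[of v] unfolding E1_def by auto
        show "\<exists>x\<in>path_ends (?a R) ?V. ?a R 0 x"
          using neg ends(1)[of ?V] c2 unfolding E2_def by auto
        show "\<exists>y\<in>path_ends_from (?a R) ?V x. ?a R 0 y" if "x \<in> path_ends (?a R) ?V" for x
        proof -
          have "x < m" using that path_ends_subset(1)[of "?a R" ?V] by auto
          then show ?thesis using neg that ends(2)[of ?V x] c2 unfolding E3_def by auto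
        qed
      qed
      then show False using no by blast
    qed
  qed
  also have "\<dots> \<le> ?P (\<lambda>R. \<not> expanding k R) + (?P E2 + ((\<Sum>v<m. ?P (E1 v)) + (\<Sum>x<m. ?P (E3 x))))"
    by (intro order_trans[OF random_prob_disj_le[OF p]] add_mono order_refl random_prob_Bex_le[OF p] finite_lessThan)
  also have "\<dots> \<le> real m ^ 6 * b + (b + ((\<Sum>v<m. b) + (\<Sum>x<m. b)))"
    using random_prob_not_expanding[OF p m k_def] P1 P2 P3 unfolding b_def
    by (intro add_mono sum_mono) auto
  also have "\<dots> = real m ^ 6 * b + (1 + 2 * real m) * b" by (simp add: algebra_simps)
  also have "(1 + 2 * real m) * b \<le> (2 * real m ^ 6) * b"
  proof (rule mult_right_mono[OF _ b])
    have "real m ^ 2 \<le> real m ^ 6" using m by (intro power_increasing) auto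
    moreover have "10 * real m \<le> real m ^ 2" using m by (simp add: power2_eq_square)
    ultimately show "1 + 2 * real m \<le> 2 * real m ^ 6" using m by linarith
  qed
  finally show ?thesis unfolding b_def k_def by (simp add: algebra_simps)
qed

end

section \<open>Enlarging cycles\<close>

definition path_edges :: "'a list \<Rightarrow> 'a set set" where
  "path_edges xs = {{a, b} | a b. adjacent_in xs a b}"

definition cycle_edges :: "'a list \<Rightarrow> 'a set set" where
  "cycle_edges xs = insert {last xs, hd xs} (path_edges xs)"

lemma path_edges_append:
  assumes "A \<noteq> []" "B \<noteq> []"
  shows "path_edges (A @ B) = path_edges A \<union> path_edges B \<union> {{last A, hd B}}"
proof -
  have "path_edges (A @ B) = {{a, b} | a b. adjacent_in A a b \<or> adjacent_in B a b \<or>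
     (a = last A \<and> b = hd B \<or> b = last A \<and> a = hd B)}"
    unfolding path_edges_def using assms by (simp add: adjacent_in_append)
  also have "\<dots> = path_edges A \<union> path_edges B \<union> {{last A, hd B}}"
    unfolding path_edges_def by (auto simp: insert_commute)
  finally show ?thesis .
qed

lemma path_edges_rev [simp]: "path_edges (rev A) = path_edges A"
  by (simp add: path_edges_def adjacent_in_rev)

lemma cycle_edges_append:
  assumes "A \<noteq> []" "B \<noteq> []"
  shows "cycle_edges (A @ B) = path_edges A \<union> path_edges B \<union> {{last A, hd B}, {last B, hd A}}"
  unfolding cycle_edges_def using assms by (auto simp: path_edges_append)

lemma cycle_edges_subset: "xs \<noteq> [] \<Longrightarrow> e \<in> cycle_edges xs \<Longrightarrow> e \<subseteq> set xs"
  unfolding cycle_edges_def path_edges_def adjacent_in_def by auto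

lemma is_cycle_rotate:
  assumes "is_cycle adj (A @ B)" "A \<noteq> []" "B \<noteq> []"
  shows "is_cycle adj (B @ A)" "cycle_edges (B @ A) = cycle_edges (A @ B)"
  using assms by (auto simp: is_cycle_def successively_append_iff cycle_edges_append)

lemma is_cycle_insert_one:
  assumes "is_cycle adj C" "Q \<noteq> []" "distinct Q" "set Q \<inter> set C = {}" "successively adj Q"
    "adj (last C) (hd Q)" "adj (last Q) (hd C)"
  shows "is_cycle adj (C @ Q)"
    and "cycle_edges (C @ Q) = path_edges C \<union> path_edges Q \<union> {{last C, hd Q}, {last Q, hd C}}"
proof -
  have "C \<noteq> []" using assms(1) by (auto simp: is_cycle_def)
  then show "is_cycle adj (C @ Q)"
    "cycle_edges (C @ Q) = path_edges C \<union> path_edges Q \<union> {{last C, hd Q}, {last Q, hd C}}"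
    using assms by (auto simp: is_cycle_def successively_append_iff cycle_edges_append)
qed

text \<open>\<open>hd B\<close> and \<open>hd A\<close> follow \<open>last A\<close> and
  \<open>last B\<close> on the cycle. The new cycle runs back along \<open>A\<close>, crosses from
  \<open>hd A\<close> to \<open>hd B\<close>, follows \<open>B\<close> and returns through
  \<open>Q\<close> to \<open>last A\<close>; just the two edges joining the arcs are lost.\<close>

lemma is_cycle_insert_two:
  assumes sym: "\<And>x y. adj x y \<Longrightarrow> adj y x"
    and C: "is_cycle adj (A @ B)" and ne: "A \<noteq> []" "B \<noteq> []"
    and Q: "Q \<noteq> []" "distinct Q" "set Q \<inter> set (A @ B) = {}" "successively adj Q"
    and adj: "adj (last B) (hd Q)" "adj (last Q) (last A)" "adj (hd A) (hd B)"
  shows "is_cycle adj (rev A @ B @ Q)"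
    and "cycle_edges (A @ B) - {{last A, hd B}, {last B, hd A}} \<subseteq> cycle_edges (rev A @ B @ Q)"
proof -
  show "is_cycle adj (rev A @ B @ Q)"
    using C ne Q adj unfolding is_cycle_def
    by (auto simp: successively_append_iff successively_flip[of adj, OF sym] hd_rev last_rev)
  show "cycle_edges (A @ B) - {{last A, hd B}, {last B, hd A}} \<subseteq> cycle_edges (rev A @ B @ Q)"
    using ne Q(1) by (auto simp: cycle_edges_append path_edges_append)
qed

text \<open>The appended \<open>C\<close> supplies the first element as successor of the
  last.\<close>

definition cyclic_next :: "'a list \<Rightarrow> 'a \<Rightarrow> 'a" where
  "cyclic_next C x = hd (tl (dropWhile (\<lambda>y. y \<noteq> x) C) @ C)"

text \<open>Cuts the cycle after each of two given vertices, in whichever order they occur.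
  \<open>R\<close> may be empty, hence the successor of \<open>last M\<close> is
  \<open>hd (R @ P)\<close>.\<close>

lemma cyclic_next_split:
  assumes "distinct C" "x \<in> set C" "z \<in> set C" "x \<noteq> z"
  obtains P M R where "C = P @ M @ R" "P \<noteq> []" "M \<noteq> []"
    "{last P, last M} = {x, z}" "cyclic_next C (last P) = hd M" "cyclic_next C (last M) = hd (R @ P)"
proof -
  note th = that
  have *: thesis if xz: "C = P' @ a # M' @ b # R" "{a, b} = {x, z}" for P' M' R a b
  proof -
    define P M where "P = P' @ [a]" and "M = M' @ [b]"
    have C: "C = P @ M @ R" using xz by (simp add: P_def M_def)
    have "dropWhile (\<lambda>y. y \<noteq> a) C = a # M' @ b # R"
      using assms(1) unfolding xz(1) by (subst dropWhile_append2) auto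
    then have 1: "cyclic_next C (last P) = hd M"
      unfolding cyclic_next_def P_def M_def by (cases M') auto
    have "dropWhile (\<lambda>y. y \<noteq> b) ((P' @ a # M') @ b # R) = b # R"
      using assms(1) unfolding xz(1) by (subst dropWhile_append2) auto
    then have 2: "cyclic_next C (last M) = hd (R @ P)"
      unfolding cyclic_next_def M_def P_def using xz(1) by (cases R; cases P') auto
    show thesis
      by (rule th[OF C _ _ _ 1 2]) (use xz in \<open>auto simp: P_def M_def\<close>)
  qed
  obtain A B where AB: "C = A @ x # B" using assms(2) by (meson split_list)
  then have "z \<in> set A \<or> z \<in> set B" using assms by auto
  then show thesis
  proof
    assume "z \<in> set B"
    then obtain B1 B2 where "B = B1 @ z # B2" by (meson split_list)
    then show thesis using *[of A x B1 z B2] AB by auto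
  next
    assume "z \<in> set A"
    then obtain A1 A2 where "A = A1 @ z # A2" by (meson split_list)
    then show thesis using *[of A1 z A2 x B] AB by (auto simp: insert_commute)
  qed
qed

lemma cyclic_next_mem: "C \<noteq> [] \<Longrightarrow> cyclic_next C x \<in> set C"
proof -
  assume "C \<noteq> []"
  then have "cyclic_next C x \<in> set (tl (dropWhile (\<lambda>y. y \<noteq> x) C) @ C)"
    unfolding cyclic_next_def by (intro hd_in_set) auto
  moreover have "set (tl (dropWhile (\<lambda>y. y \<noteq> x) C)) \<subseteq> set C"
    by (metis list.set_sel(2) set_dropWhileD subsetI tl_Nil)
  ultimately show ?thesis by auto
qed

lemma inj_on_cyclic_next:
  assumes "distinct C"
  shows "inj_on (cyclic_next C) (set C)"
proof (rule inj_onI, rule ccontr)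
  fix x z assume xz: "x \<in> set C" "z \<in> set C" "cyclic_next C x = cyclic_next C z" "x \<noteq> z"
  then obtain P M R where PMR: "C = P @ M @ R" "P \<noteq> []" "M \<noteq> []"
    "{last P, last M} = {x, z}" "cyclic_next C (last P) = hd M" "cyclic_next C (last M) = hd (R @ P)"
    using cyclic_next_split[OF assms xz(1,2,4)] by metis
  then have "hd M = hd (R @ P)" using xz(3) by (metis doubleton_eq_iff)
  moreover have "hd M \<in> set M" "hd (R @ P) \<in> set (R @ P)"
    using PMR by (auto intro!: hd_in_set simp del: set_append)
  ultimately show False using assms PMR(1) by auto
qed

text \<open>The Chvatal-Erdos step with a set \<open>F\<close> of protected edges. Discarding their
  at most \<open>2 * card F\<close> vertices leaves more than \<open>a\<close> vertices of
  \<open>T\<close>. Their successors are distinct, so two of them are adjacent, and a path through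
  \<open>W\<close> closes the rearranged cycle.\<close>

lemma cycle_extension:
  fixes adj :: "'a \<Rightarrow> 'a \<Rightarrow> bool"
  assumes sym: "\<And>x y. adj x y \<Longrightarrow> adj y x" and irr: "\<And>x. \<not> adj x x"
    and C: "is_cycle adj C" and F: "F \<subseteq> cycle_edges C" "finite F"
    and T: "T \<subseteq> set C" "\<And>x. x \<in> T \<Longrightarrow> \<exists>w\<in>W. adj x w" "a + 2 * card F < card T"
    and indep: "\<And>U. U \<subseteq> set C \<Longrightarrow> a < card U \<Longrightarrow> \<exists>x\<in>U. \<exists>y\<in>U. adj x y"
    and W: "W \<inter> set C = {}"
      "\<And>w w'. w \<in> W \<Longrightarrow> w' \<in> W \<Longrightarrow> \<exists>Q. is_path adj W Q \<and> hd Q = w \<and> last Q = w' \<and> length Q \<le> l"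
  obtains C' where "is_cycle adj C'" "F \<subseteq> cycle_edges C'" "set C \<subseteq> set C'" "set C' \<subseteq> set C \<union> W"
    "length C < length C'" "length C' \<le> length C + l"
proof -
  have dC: "distinct C" and neC: "C \<noteq> []" using C by (auto simp: is_cycle_def)
  have finU: "finite (\<Union>F)" "card (\<Union>F) \<le> 2 * card F"
  proof -
    have e: "finite e \<and> card e \<le> 2" if eF: "e \<in> F" for e
    proof -
      obtain a b where "e = {a, b}" using F eF unfolding cycle_edges_def path_edges_def by blast
      then show ?thesis by (simp add: card_insert_if)
    qed
    then show "finite (\<Union>F)" using F by auto
    have "card (\<Union>F) \<le> (\<Sum>e\<in>F. card e)" using card_Union_le_sum_card by blast
    also have "\<dots> \<le> (\<Sum>e\<in>F. 2)" using e by (intro sum_mono) auto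
    finally show "card (\<Union>F) \<le> 2 * card F" by simp
  qed
  define T' where "T' = T - \<Union>F"
  have "card T - card (\<Union>F) \<le> card T'" unfolding T'_def by (rule diff_card_le_card_Diff[OF finU(1)])
  then have "a < card T'" using T(3) finU(2) by linarith
  moreover have "card (cyclic_next C ` T') = card T'"
    using T(1) by (intro card_image inj_on_subset[OF inj_on_cyclic_next[OF dC]]) (auto simp: T'_def)
  moreover have "cyclic_next C ` T' \<subseteq> set C" using cyclic_next_mem[OF neC] by auto
  ultimately obtain x z where xz: "x \<in> T'" "z \<in> T'" "adj (cyclic_next C x) (cyclic_next C z)"
    using indep[of "cyclic_next C ` T'"] by auto
  have "x \<noteq> z" using xz irr by auto
  moreover have "x \<in> set C" "z \<in> set C" using xz T by (auto simp: T'_def)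
  ultimately obtain P M R where PMR: "C = P @ M @ R" "P \<noteq> []" "M \<noteq> []"
    "{last P, last M} = {x, z}" "cyclic_next C (last P) = hd M" "cyclic_next C (last M) = hd (R @ P)"
    using cyclic_next_split[OF dC] by metis
  have lastT: "last P \<in> T'" "last M \<in> T'" using PMR(4) xz by auto
  have nn: "adj (hd M) (hd (R @ P))"
    using PMR(4-6) xz(3) sym by (metis doubleton_eq_iff)
  obtain w where w: "w \<in> W" "adj (last P) w" using T(2) lastT unfolding T'_def by blast
  obtain w' where w': "w' \<in> W" "adj (last M) w'" using T(2) lastT unfolding T'_def by blast
  obtain Q where Q: "is_path adj W Q" "hd Q = w" "last Q = w'" "length Q \<le> l" using W(2)[OF w(1) w'(1)] by blast
  have rot: "is_cycle adj (M @ (R @ P))" "cycle_edges (M @ (R @ P)) = cycle_edges C"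
    using is_cycle_rotate[of adj P "M @ R"] C PMR by auto
  have Qd: "set Q \<inter> set (M @ (R @ P)) = {}" using Q W PMR unfolding is_path_def by auto
  note ins = is_cycle_insert_two[OF sym rot(1) PMR(3) _ _ _ Qd]
  have c: "is_cycle adj (rev M @ (R @ P) @ Q)"
    and e: "cycle_edges C - {{last M, hd (R @ P)}, {last (R @ P), hd M}} \<subseteq> cycle_edges (rev M @ (R @ P) @ Q)"
    using ins Q w w' sym nn PMR(2) rot(2) by (auto simp: is_path_def)
  \<comment> \<open>Each of the two deleted edges starts at a vertex of \<open>T'\<close>, which no
    protected edge meets.\<close>
  have "F \<subseteq> cycle_edges C - {{last M, hd (R @ P)}, {last (R @ P), hd M}}"
    using F(1) lastT PMR(2) unfolding T'_def by auto
  then have "F \<subseteq> cycle_edges (rev M @ (R @ P) @ Q)" using e by blast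
  then show thesis
    using that[OF c] Q PMR(1) unfolding is_path_def by auto
qed

section \<open>Short paths and components\<close>

definition is_walk :: "('a \<Rightarrow> 'a \<Rightarrow> bool) \<Rightarrow> 'a set \<Rightarrow> 'a list \<Rightarrow> bool" where
  "is_walk adj V xs \<longleftrightarrow> xs \<noteq> [] \<and> set xs \<subseteq> V \<and> successively adj xs"

text \<open>On a shortest walk, vertices at distance at least three have disjoint neighbourhoods.
  Every third vertex thus contributes \<open>D\<close> new vertices of \<open>W\<close>, which
  bounds the length by \<open>3 * card W\<close> over \<open>D\<close>.\<close>

lemma short_path:
  fixes adj :: "'a \<Rightarrow> 'a \<Rightarrow> bool"
  assumes sym: "\<And>x y. adj x y \<Longrightarrow> adj y x" and fin: "finite W"
    and walk: "is_walk adj W ys" "hd ys = v" "last ys = w"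
    and deg: "\<And>x. x \<in> W \<Longrightarrow> D \<le> card {c \<in> W. adj x c}"
  obtains xs where "is_path adj W xs" "hd xs = v" "last xs = w" "length xs * D \<le> 3 * card W"
proof -
  define Wk where "Wk xs \<longleftrightarrow> is_walk adj W xs \<and> hd xs = v \<and> last xs = w" for xs
  obtain xs where xs: "Wk xs" and min: "\<And>zs. Wk zs \<Longrightarrow> length xs \<le> length zs"
    using walk ex_has_least_nat[of Wk ys length] unfolding Wk_def by blast
  have dist: "distinct xs"
  proof (rule ccontr)
    assume "\<not> distinct xs"
    then obtain A y B C where d: "xs = A @ [y] @ B @ [y] @ C" using not_distinct_decomp by blast
    have "Wk (A @ y # C)"
      using xs d unfolding Wk_def is_walk_def
      by (auto simp: successively_append_iff successively_Cons hd_append split: if_splits)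
    then show False using min d by fastforce
  qed
  \<comment> \<open>The number of positions 0, 3, 6, ... below \<open>length xs\<close>, a
    ceiling.\<close>
  define k where "k = (length xs + 2) div 3"
  define Nb where "Nb t = {c \<in> W. adj (xs ! (3 * t)) c}" for t
  have idx: "3 * t < length xs" if "t < k" for t using that unfolding k_def by simp
  have disj: "Nb s \<inter> Nb t = {}" if "s < t" "t < k" for s t
  proof (rule ccontr)
    assume "Nb s \<inter> Nb t \<noteq> {}"
    then obtain c where c: "c \<in> W" "adj (xs ! (3 * s)) c" "adj (xs ! (3 * t)) c" unfolding Nb_def by blast
    \<comment> \<open>The shortcut puts the single vertex \<open>c\<close> in place of the at least
      two vertices between the positions. \<open>c\<close> may occur elsewhere, which is harmless
      for a walk.\<close>
    define zs where "zs = take (Suc (3 * s)) xs @ c # drop (3 * t) xs"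
    have s3: "3 * s < length xs" "3 * t < length xs" using idx[of s] idx[of t] that by auto
    have lt: "last (take (Suc (3 * s)) xs) = xs ! (3 * s)"
      using s3 by (simp add: take_Suc_conv_app_nth)
    have hdd: "hd (drop (3 * t) xs) = xs ! (3 * t)" using s3 by (simp add: hd_drop_conv_nth)
    have "successively adj (take (Suc (3 * s)) xs @ drop (Suc (3 * s)) xs)"
      "successively adj (take (3 * t) xs @ drop (3 * t) xs)"
      using xs unfolding Wk_def is_walk_def by simp_all
    then have "successively adj (take (Suc (3 * s)) xs)" "successively adj (drop (3 * t) xs)"
      unfolding successively_append_iff by blast+
    then have "successively adj zs"
      unfolding zs_def using c sym lt hdd s3
      by (auto simp: successively_append_iff successively_Cons)
    moreover have "set zs \<subseteq> W"
      using xs c set_take_subset[of "Suc (3 * s)" xs] set_drop_subset[of "3 * t" xs]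
      unfolding zs_def Wk_def is_walk_def by auto
    moreover have "hd zs = v" "last zs = w"
      using xs s3 unfolding zs_def Wk_def is_walk_def by (auto simp: hd_append hd_take last_drop)
    ultimately have "Wk zs" unfolding Wk_def is_walk_def zs_def by auto
    moreover have "length zs < length xs"
      unfolding zs_def using s3 that by simp
    ultimately show False using min by fastforce
  qed
  have "k * D = (\<Sum>t<k. D)" by simp
  also have "\<dots> \<le> (\<Sum>t<k. card (Nb t))"
    unfolding Nb_def using deg idx xs
    by (intro sum_mono) (metis Wk_def is_walk_def lessThan_iff nth_mem subsetD)
  also have "\<dots> = card (\<Union>t<k. Nb t)"
  proof (rule card_UN_disjoint[symmetric])
    show "\<forall>i\<in>{..<k}. finite (Nb i)" using fin unfolding Nb_def by auto
    show "\<forall>i\<in>{..<k}. \<forall>j\<in>{..<k}. i \<noteq> j \<longrightarrow> Nb i \<inter> Nb j = {}"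
      using disj by (metis Int_commute lessThan_iff linorder_neqE_nat)
  qed simp
  also have "\<dots> \<le> card W" unfolding Nb_def by (intro card_mono fin) auto
  finally have "k * D \<le> card W" .
  moreover have "length xs * D \<le> 3 * k * D" unfolding k_def by (intro mult_right_mono) auto
  ultimately have "length xs * D \<le> 3 * card W" by linarith
  then show thesis using that[of xs] xs dist unfolding Wk_def is_walk_def is_path_def by blast
qed

lemma component_exists:
  fixes adj :: "'a \<Rightarrow> 'a \<Rightarrow> bool"
  assumes sym: "\<And>x y. adj x y \<Longrightarrow> adj y x" and w: "w \<in> Z"
  obtains W where "w \<in> W" "W \<subseteq> Z" "\<And>x y. x \<in> W \<Longrightarrow> y \<in> Z \<Longrightarrow> adj x y \<Longrightarrow> y \<in> W"
    "\<And>x y. x \<in> W \<Longrightarrow> y \<in> W \<Longrightarrow> \<exists>xs. is_walk adj W xs \<and> hd xs = x \<and> last xs = y"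
proof -
  define W where "W = {v. \<exists>xs. is_walk adj Z xs \<and> hd xs = w \<and> last xs = v}"
  have inW: "set xs \<subseteq> W" if "is_walk adj Z xs" "hd xs = w" for xs
  proof
    fix v assume "v \<in> set xs"
    then obtain A B where "xs = A @ v # B" by (meson split_list)
    then have "is_walk adj Z (A @ [v])" "hd (A @ [v]) = w" "last (A @ [v]) = v"
      using that unfolding is_walk_def by (auto simp: successively_append_iff hd_append)
    then show "v \<in> W" unfolding W_def by blast
  qed
  have 1: "w \<in> W" using w unfolding W_def is_walk_def by (auto intro!: exI[of _ "[w]"])
  have 2: "W \<subseteq> Z" unfolding W_def is_walk_def by auto
  have 3: "y \<in> W" if xy: "x \<in> W" "y \<in> Z" "adj x y" for x y
  proof -
    obtain xs where "is_walk adj Z xs" "hd xs = w" "last xs = x" using xy unfolding W_def by blast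
    then have "is_walk adj Z (xs @ [y])" "hd (xs @ [y]) = w" "last (xs @ [y]) = y"
      using xy unfolding is_walk_def by (auto simp: successively_append_iff)
    then show ?thesis unfolding W_def by blast
  qed
  have 4: "\<exists>xs. is_walk adj W xs \<and> hd xs = x \<and> last xs = y" if xy: "x \<in> W" "y \<in> W" for x y
  proof -
    obtain xs where xs: "is_walk adj Z xs" "hd xs = w" "last xs = x" using xy unfolding W_def by blast
    obtain ys where ys: "is_walk adj Z ys" "hd ys = w" "last ys = y" using xy unfolding W_def by blast
    have "is_walk adj W (rev xs @ tl ys)"
      using xs ys inW[OF xs(1,2)] inW[OF ys(1,2)] unfolding is_walk_def
      by (cases ys) (auto simp: successively_append_iff successively_flip[of adj, OF sym]
          successively_Cons last_rev)
    moreover have "hd (rev xs @ tl ys) = x" "last (rev xs @ tl ys) = y"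
      using xs ys unfolding is_walk_def by (cases ys; force simp: hd_rev last_rev)+
    ultimately show ?thesis by blast
  qed
  show thesis by (rule that[OF 1 2 3 4])
qed

section \<open>Cycles in decomposed graphs\<close>

abbreviation edge :: "'a set set \<Rightarrow> 'a \<Rightarrow> 'a \<Rightarrow> bool" where
  "edge E \<equiv> \<lambda>x y. {x, y} \<in> E"

lemma edge_sym: "edge E x y \<Longrightarrow> edge E y x"
  by (simp add: insert_commute)

lemma is_path_mono: "is_path (edge G) V xs \<Longrightarrow> G \<subseteq> E \<Longrightarrow> V \<subseteq> U \<Longrightarrow> is_path (edge E) U xs"
  unfolding is_path_def by (auto elim!: successively_mono)

text \<open>Once the chosen edge closes the list, replacing it by a path amounts to appending that
  path.\<close>

lemma is_cycle_rotate_to_edge: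
  assumes "is_cycle adj C" "e \<in> cycle_edges C"
  obtains C' where "is_cycle adj C'" "set C' = set C" "length C' = length C"
    "cycle_edges C' = cycle_edges C" "e = {last C', hd C'}"
proof (cases "e = {last C, hd C}")
  case True
  then show thesis using that[of C] assms by auto
next
  case False
  then obtain A a b B where AB: "C = A @ a # b # B" "e = {a, b}"
    using assms(2) unfolding cycle_edges_def path_edges_def adjacent_in_def by (auto simp: insert_commute)
  have C: "C = (A @ [a]) @ (b # B)" using AB by simp
  show thesis
    by (rule that[of "(b # B) @ (A @ [a])"])
      (use is_cycle_rotate[of adj "A @ [a]" "b # B"] assms(1) AB C in auto)
qed

text \<open>Gallai-Roy: orient the edges upwards along the linear order and let \<open>f x\<close>
  be the longest increasing path ending in \<open>x\<close>. Along an edge \<open>f\<close>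
  increases strictly, so each level of \<open>f\<close> is independent and has at most
  \<open>a\<close> vertices; \<open>L\<close> levels cannot exhaust \<open>X\<close>.\<close>

lemma long_path_if_no_large_independent_set:
  fixes X :: "'a :: linorder set"
  assumes fin: "finite X"
    and indep: "\<And>U. U \<subseteq> X \<Longrightarrow> a < card U \<Longrightarrow> \<exists>x\<in>U. \<exists>y\<in>U. edge G x y"
    and irr: "\<And>x. \<not> edge G x x" and big: "a * L < card X"
  obtains xs where "is_path (edge G) X xs" "length xs = Suc L"
proof -
  define up where "up = (\<lambda>x y. x < y \<and> edge G x y)"
  define Ps where "Ps x = {xs. is_path up X xs \<and> last xs = x}" for x
  define f where "f x = Max (length ` Ps x)" for x
  have finP: "finite (length ` Ps x)" for x
  proof (rule finite_subset)
    show "length ` Ps x \<subseteq> {..card X}"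
      unfolding Ps_def is_path_def using fin by (auto simp: card_mono distinct_card[symmetric])
  qed simp
  have P1: "[x] \<in> Ps x" if "x \<in> X" for x using that unfolding Ps_def is_path_def by auto
  have step: "f x < f y" if xy: "x \<in> X" "y \<in> X" "x < y" "edge G x y" for x y
  proof -
    have "f x \<in> length ` Ps x" unfolding f_def using finP P1[OF xy(1)] by (intro Max_in) auto
    then obtain xs where xs: "xs \<in> Ps x" "f x = length xs" by auto
    \<comment> \<open>The end of an increasing path is its maximum, so a larger vertex can be
      appended without repetition.\<close>
    have "z \<le> last zs" if "successively up zs" "z \<in> set zs" for z zs
      using that
    proof (induction zs rule: rev_induct)
      case (snoc w zs)
      show ?case
      proof (cases "z \<in> set zs")
        case True
        then have "zs \<noteq> []" by auto
        then have "z \<le> last zs" "up (last zs) w"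
          using snoc True by (auto simp: successively_append_iff)
        then show ?thesis by (auto simp: up_def)
      qed (use snoc in auto)
    qed simp
    then have "\<forall>z\<in>set xs. z \<le> x" using xs(1) unfolding Ps_def is_path_def by blast
    then have "xs @ [y] \<in> Ps y"
      using xs(1) xy unfolding Ps_def is_path_def up_def
      by (auto simp: successively_append_iff)
    then have "length (xs @ [y]) \<le> f y" unfolding f_def using finP by (intro Max_ge imageI)
    then show ?thesis using xs by simp
  qed
  show thesis
  proof (cases "\<exists>x\<in>X. L < f x")
    case True
    then obtain x where x: "x \<in> X" "L < f x" by blast
    have "f x \<in> length ` Ps x" unfolding f_def using finP P1[OF x(1)] by (intro Max_in) auto
    then obtain xs where xs: "is_path up X xs" "f x = length xs" unfolding Ps_def by auto
    have "successively (edge G) xs"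
      using xs(1) unfolding is_path_def up_def by (auto elim: successively_mono)
    then have "successively (edge G) (take (Suc L) xs @ drop (Suc L) xs)" by simp
    then have "successively (edge G) (take (Suc L) xs)" unfolding successively_append_iff by blast
    then have "is_path (edge G) X (take (Suc L) xs)"
      using xs(1) set_take_subset[of "Suc L" xs] unfolding is_path_def by auto
    then show thesis using that x xs by simp
  next
    case False
    have "f ` X \<subseteq> {1..L}"
    proof
      fix c assume "c \<in> f ` X"
      then obtain x where x: "x \<in> X" "c = f x" by blast
      have "length [x] \<le> f x" unfolding f_def using finP P1[OF x(1)] by (intro Max_ge imageI)
      then show "c \<in> {1..L}" using x False by auto
    qed
    then have "card (f ` X) \<le> L" using card_mono[of "{1..L}" "f ` X"] by simp
    have "card X \<le> (\<Sum>c\<in>f ` X. card {x \<in> X. f x = c})"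
      using sum.image_gen[OF fin, of "\<lambda>_. 1 :: nat" f] by simp
    also have "\<dots> \<le> (\<Sum>c\<in>f ` X. a)"
    proof (rule sum_mono, rule ccontr)
      fix c assume "\<not> card {x \<in> X. f x = c} \<le> a"
      then obtain x y where xy: "x \<in> X" "y \<in> X" "f x = c" "f y = c" "edge G x y"
        using indep[of "{x \<in> X. f x = c}"] by auto
      then have "x \<noteq> y" using irr by auto
      then show False using step[of x y] step[of y x] xy by (auto simp: insert_commute neq_iff)
    qed
    also have "\<dots> \<le> a * L" using \<open>card (f ` X) \<le> L\<close> by simp
    finally show thesis using big by simp
  qed
qed

text \<open>Degrees, independence and connectivity concern the deterministic \<open>G\<close>, while
  cycles live in the larger \<open>E\<close>. \<open>D\<close> holds the deleted separators and
  \<open>PP\<close> the parts. \<open>conn\<close> states \<kappa>-connectivity as the absence of a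
  cut after fewer than \<kappa> deletions inside a part.\<close>

locale decomposed_graph =
  fixes n d \<kappa> \<alpha> :: nat and G E :: "nat set set" and D :: "nat set" and PP :: "nat set set"
  assumes graphE: "is_graph n E" and GE: "G \<subseteq> E"
    and indepG: "\<And>U. U \<subseteq> {..<n} \<Longrightarrow> \<alpha> < card U \<Longrightarrow> \<exists>x\<in>U. \<exists>y\<in>U. {x, y} \<in> G"
    and degG: "\<And>v. v < n \<Longrightarrow> d \<le> card {u. u < n \<and> {u, v} \<in> G}"
    and cover: "\<Union>PP = {..<n} - D" and Dn: "D \<subseteq> {..<n}"
    and disjPP: "\<And>X Y. X \<in> PP \<Longrightarrow> Y \<in> PP \<Longrightarrow> X \<noteq> Y \<Longrightarrow> X \<inter> Y = {}"
    and noedge: "\<And>X Y x y. X \<in> PP \<Longrightarrow> Y \<in> PP \<Longrightarrow> X \<noteq> Y \<Longrightarrow> x \<in> X \<Longrightarrow> y \<in> Y \<Longrightarrow> {x, y} \<notin> G"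
    and conn: "\<And>Y S X. Y \<in> PP \<Longrightarrow> S \<subseteq> Y \<Longrightarrow> card S < \<kappa> \<Longrightarrow> X \<subseteq> Y - S \<Longrightarrow> X \<noteq> {} \<Longrightarrow> X \<noteq> Y - S \<Longrightarrow>
         \<exists>x\<in>X. \<exists>y\<in>Y - S - X. {x, y} \<in> G"
begin

lemma irrE: "{x} \<notin> E"
  using graphE unfolding is_graph_def all_pairs_def by (auto simp: doubleton_eq_iff)

lemma finD: "finite D" using Dn finite_subset by blast

lemma PP_sub: "Y \<in> PP \<Longrightarrow> Y \<subseteq> {..<n} - D" using cover by blast

lemma PP_fin: "Y \<in> PP \<Longrightarrow> finite Y" using PP_sub finite_subset by blast

lemma finite_PP: "finite PP"
proof -
  have "PP \<subseteq> Pow {..<n}" using PP_sub by blast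
  then show ?thesis using finite_subset by blast
qed

text \<open>A neighbour of \<open>x\<close> in \<open>G\<close> is in \<open>D\<close> or in the
  same part. Whatever \<open>A\<close> does not take is in \<open>W\<close>, which gives a lower
  bound for the degree into \<open>W\<close>.\<close>

lemma inner_degree:
  assumes "Y \<in> PP" "x \<in> Y" "finite A" "card A \<le> b" "\<And>c. c \<in> Y \<Longrightarrow> {x, c} \<in> G \<Longrightarrow> c \<notin> A \<Longrightarrow> c \<in> W" "finite W"
  shows "d \<le> card D + b + card {c \<in> W. {x, c} \<in> G}"
proof -
  have xn: "x < n" using assms PP_sub by auto
  have "{u. u < n \<and> {u, x} \<in> G} \<subseteq> D \<union> A \<union> {c \<in> W. {x, c} \<in> G}"
  proof
    fix c assume "c \<in> {u. u < n \<and> {u, x} \<in> G}"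
    then have c: "c < n" "{x, c} \<in> G" by (auto simp: insert_commute)
    show "c \<in> D \<union> A \<union> {c \<in> W. {x, c} \<in> G}"
    proof (cases "c \<in> D")
      case False
      then obtain Y' where "Y' \<in> PP" "c \<in> Y'" using cover c by auto
      then have "c \<in> Y" using noedge[of Y Y' x c] assms c by auto
      then show ?thesis using assms(5) c by blast
    qed simp
  qed
  then have "card {u. u < n \<and> {u, x} \<in> G} \<le> card (D \<union> A \<union> {c \<in> W. {x, c} \<in> G})"
    using assms finD by (intro card_mono) auto
  also have "\<dots> \<le> card (D \<union> A) + card {c \<in> W. {x, c} \<in> G}" by (rule card_Un_le)
  also have "card (D \<union> A) \<le> card D + card A" by (rule card_Un_le)
  finally show ?thesis using degG[OF xn] assms(4) by linarith
qed

text \<open>The invariant of the enlargement. \<open>Z\<close> is kept free for the reserve path,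
  \<open>e\<close> is the edge later replaced by a detour through it, and every part keeps a cycle
  edge other than \<open>e\<close> that may be opened.\<close>

definition good :: "nat set \<Rightarrow> nat set \<Rightarrow> nat list \<Rightarrow> bool" where
  "good Z e C \<longleftrightarrow> is_cycle (edge E) C \<and> set C \<subseteq> {..<n} - Z \<and> e \<in> cycle_edges C \<and>
     (\<forall>Y\<in>PP. \<exists>f\<in>cycle_edges C. f \<subseteq> Y \<and> f \<noteq> e)"

lemma short_path_in:
  assumes W: "finite W" "W \<subseteq> {..<n}" "\<And>x. x \<in> W \<Longrightarrow> q \<le> card {c \<in> W. {x, c} \<in> G}"
    and walk: "\<exists>xs. is_walk (edge G) W xs \<and> hd xs = v \<and> last xs = w"
    and J: "3 * n < Suc J * q"
  obtains Q where "is_path (edge G) W Q" "hd Q = v" "last Q = w" "length Q \<le> J"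
proof -
  obtain Q where Q: "is_path (edge G) W Q" "hd Q = v" "last Q = w" "length Q * q \<le> 3 * card W"
  proof -
    obtain ys where "is_walk (edge G) W ys" "hd ys = v" "last ys = w" using walk by blast
    from short_path[OF edge_sym W(1) this W(3)] that show thesis by blast
  qed
  have "card W \<le> n" using W card_mono[of "{..<n}" W] by simp
  then have "length Q * q < Suc J * q" using Q J by linarith
  then have "length Q < Suc J" by (metis mult_less_cancel2)
  then show thesis using that Q by simp
qed

text \<open>Protecting \<open>e\<close> and one edge per part raises the required number of
  neighbours from \<alpha> to \<open>a0\<close>. An uncovered vertex with more than
  \<open>a0\<close> neighbours on the cycle is inserted alone. Otherwise uncovered components have
  minimum degree at least \<open>q\<close>, hence paths with at most \<open>J\<close> vertices. Such
  a component is inserted between two cycle vertices whose successors are adjacent, or into a cycle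
  edge of its part.\<close>

lemma good_step:
  assumes good: "good Z e C" and Z: "Z \<subseteq> {..<n}" "card Z \<le> L" and nfull: "set C \<noteq> {..<n} - Z"
    and a0: "a0 = \<alpha> + 2 * (card PP + 1)" and q: "q + a0 + L + card D \<le> d" "1 \<le> q"
    and J: "3 * n < Suc J * q" "1 \<le> J" and k: "L + a0 < \<kappa>"
  shows "\<exists>C'. good Z e C' \<and> length C < length C' \<and> length C' \<le> length C + J"
proof -
  have C: "is_cycle (edge E) C" "set C \<subseteq> {..<n} - Z" "e \<in> cycle_edges C"
    using good by (auto simp: good_def)
  have "\<forall>Y\<in>PP. \<exists>f. f \<in> cycle_edges C \<and> f \<subseteq> Y \<and> f \<noteq> e" using good by (auto simp: good_def)
  then obtain f where f: "\<And>Y. Y \<in> PP \<Longrightarrow> f Y \<in> cycle_edges C \<and> f Y \<subseteq> Y \<and> f Y \<noteq> e"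
    using bchoice by metis
  define F where "F = insert e (f ` PP)"
  have F: "F \<subseteq> cycle_edges C" "finite F" "card F \<le> card PP + 1"
    unfolding F_def using f C finite_PP card_image_le[of PP f]
    by (auto simp: card_insert_if)
  have finZ: "finite Z" using Z finite_subset by blast
  have ind: "\<exists>x\<in>U. \<exists>y\<in>U. edge E x y" if "U \<subseteq> set C" "\<alpha> < card U" for U
    using indepG[of U] that C(2) GE by blast
  have extend: "\<exists>C'. good Z e C' \<and> length C < length C' \<and> length C' \<le> length C + J"
    if T: "T \<subseteq> set C" "\<And>x. x \<in> T \<Longrightarrow> \<exists>w\<in>W. edge E x w" "a0 < card T"
      and W: "W \<inter> set C = {}" "W \<subseteq> {..<n} - Z" "\<And>w w'. w \<in> W \<Longrightarrow> w' \<in> W \<Longrightarrow>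
         \<exists>Q. is_path (edge E) W Q \<and> hd Q = w \<and> last Q = w' \<and> length Q \<le> J" for T W
  proof -
    have cT: "\<alpha> + 2 * card F < card T" using T(3) F(3) unfolding a0 by simp
    obtain C' where C': "is_cycle (edge E) C'" "F \<subseteq> cycle_edges C'" "set C \<subseteq> set C'" "set C' \<subseteq> set C \<union> W"
      "length C < length C'" "length C' \<le> length C + J"
      using cycle_extension[where adj = "edge E" and C = C and F = F and T = T and W = W and l = J and a = \<alpha>,
          OF edge_sym _ C(1) F(1,2) T(1,2) cT ind W(1,3)] irrE by auto
    have "good Z e C'"
      unfolding good_def
    proof (intro conjI ballI)
      show "set C' \<subseteq> {..<n} - Z" using C'(4) C(2) W(2) by blast
      show "e \<in> cycle_edges C'" using C'(2) unfolding F_def by blast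
      show "\<exists>g\<in>cycle_edges C'. g \<subseteq> Y \<and> g \<noteq> e" if "Y \<in> PP" for Y
        using f[OF that] C'(2) that unfolding F_def by blast
    qed (rule C'(1))
    then show ?thesis using C' by blast
  qed
  show ?thesis
  proof (cases "\<exists>w\<in>{..<n} - Z - set C. a0 < card {x \<in> set C. edge G x w}")
    case True
    then obtain w where w: "w \<in> {..<n} - Z - set C" "a0 < card {x \<in> set C. edge G x w}" by blast
    show ?thesis
    proof (rule extend[OF _ _ w(2), of "{w}"])
      fix w1 w2 assume "w1 \<in> {w}" "w2 \<in> {w}"
      then show "\<exists>Q. is_path (edge E) {w} Q \<and> hd Q = w1 \<and> last Q = w2 \<and> length Q \<le> J"
        using J(2) by (intro exI[of _ "[w]"]) (auto simp: is_path_def)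
    qed (use w GE in auto)
  next
    case False
    then have few: "card {x \<in> set C. edge G x w} \<le> a0" if "w \<in> {..<n} - Z - set C" for w
      using that by (meson not_le)
    \<comment> \<open>Otherwise an uncovered vertex would have all its neighbours in
      \<open>C\<close>, \<open>Z\<close> or \<open>D\<close>, at most \<open>a0 + L + card D\<close>
      of them, fewer than \<open>d\<close>.\<close>
    have "\<exists>w\<in>{..<n} - Z - set C. w \<notin> D"
    proof (rule ccontr)
      assume neg: "\<not> ?thesis"
      obtain w where w: "w \<in> {..<n} - Z - set C" using nfull C(2) by blast
      have "{u. u < n \<and> {u, w} \<in> G} \<subseteq> {x \<in> set C. edge G x w} \<union> (Z \<union> D)" using neg by auto
      then have "card {u. u < n \<and> {u, w} \<in> G} \<le> card ({x \<in> set C. edge G x w} \<union> (Z \<union> D))"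
        using finZ finD by (intro card_mono) auto
      also have "\<dots> \<le> card {x \<in> set C. edge G x w} + card (Z \<union> D)" by (rule card_Un_le)
      also have "card (Z \<union> D) \<le> card Z + card D" by (rule card_Un_le)
      finally show False using degG[of w] few[OF w] w q Z by auto
    qed
    then obtain w0 where w0: "w0 \<in> {..<n} - Z - set C" "w0 \<notin> D" by blast
    then obtain Y where Y: "Y \<in> PP" "w0 \<in> Y" using cover by auto
    define Zn where "Zn = Y - set C - Z"
    have "w0 \<in> Zn" using w0 Y by (simp add: Zn_def)
    from this obtain W where W: "w0 \<in> W" "W \<subseteq> Zn" "\<And>x y. x \<in> W \<Longrightarrow> y \<in> Zn \<Longrightarrow> edge G x y \<Longrightarrow> y \<in> W"
      "\<And>x y. x \<in> W \<Longrightarrow> y \<in> W \<Longrightarrow> \<exists>xs. is_walk (edge G) W xs \<and> hd xs = x \<and> last xs = y"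
    proof (rule component_exists[where adj = "edge G" and w = w0 and Z = Zn, rotated])
      show "edge G x y \<Longrightarrow> edge G y x" for x y by (rule edge_sym)
    qed (rule that)
    have Wn: "W \<subseteq> {..<n} - Z - set C" using W(2) PP_sub[OF Y(1)] unfolding Zn_def by blast
    have finW: "finite W" using Wn finite_subset by blast
    have degW: "q \<le> card {c \<in> W. {x, c} \<in> G}" if "x \<in> W" for x
    proof -
      have "d \<le> card D + (a0 + L) + card {c \<in> W. {x, c} \<in> G}"
      proof (rule inner_degree[OF Y(1), where A = "{u \<in> set C. edge G u x} \<union> Z"])
        show "card ({u \<in> set C. edge G u x} \<union> Z) \<le> a0 + L"
          using few[of x] that Wn Z card_Un_le[of "{u \<in> set C. edge G u x}" Z] by auto
        show "c \<in> W" if "c \<in> Y" "{x, c} \<in> G" "c \<notin> {u \<in> set C. edge G u x} \<union> Z" for c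
        proof -
          have "{c, x} \<in> G" using that by (simp add: insert_commute)
          then have "c \<in> Zn" using that unfolding Zn_def by auto
          then show ?thesis using W(3)[OF \<open>x \<in> W\<close>] that by blast
        qed
      qed (use that W(2) finZ finW in \<open>auto simp: Zn_def\<close>)
      then show ?thesis using q by linarith
    qed
    have pathW: "\<exists>Q. is_path (edge E) W Q \<and> hd Q = w \<and> last Q = w' \<and> length Q \<le> J"
      if ww: "w \<in> W" "w' \<in> W" for w w'
    proof -
      obtain Q where "is_path (edge G) W Q" "hd Q = w" "last Q = w'" "length Q \<le> J"
        using short_path_in[OF finW _ degW W(4)[OF ww] J(1)] Wn by blast
      then show ?thesis using is_path_mono[OF _ GE, of W Q W] by blast
    qed
    define Nb where "Nb = {x \<in> set C \<inter> Y. \<exists>w\<in>W. edge G x w}"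
    define S where "S = Nb \<union> (Z \<inter> Y)"
    show ?thesis
    proof (cases "card S < \<kappa>")
      case False
      have "card S \<le> card Nb + card (Z \<inter> Y)" unfolding S_def by (rule card_Un_le)
      also have "card (Z \<inter> Y) \<le> card Z" using finZ by (intro card_mono) auto
      finally have "a0 < card Nb" using False Z k by linarith
      then show ?thesis
        using extend[of Nb W] pathW Wn GE unfolding Nb_def by blast
    next
      case True
      \<comment> \<open>\<open>S\<close> contains all neighbours of \<open>W\<close> in
        \<open>Y\<close> outside \<open>W\<close>, so with fewer than \<kappa> vertices it cannot
        leave anything else of \<open>Y\<close> behind. Therefore every cycle vertex in
        \<open>Y\<close> has a neighbour in \<open>W\<close>.\<close>
      have "W = Y - S"
      proof (rule ccontr)
        assume "W \<noteq> Y - S"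
        moreover have "W \<subseteq> Y - S" using W(2) unfolding S_def Nb_def Zn_def by auto
        moreover have "S \<subseteq> Y" unfolding S_def Nb_def by auto
        ultimately obtain x y where xy: "x \<in> W" "y \<in> Y - S - W" "{x, y} \<in> G"
          using conn[OF Y(1) _ True, of W] W(1) by blast
        then have "y \<notin> Zn" using W(3) by blast
        then have "y \<in> set C" using xy unfolding S_def Zn_def by auto
        then have "y \<in> Nb" using xy unfolding Nb_def by (auto simp: insert_commute)
        then show False using xy unfolding S_def by auto
      qed
      then have CY: "set C \<inter> Y \<subseteq> Nb" using Wn C(2) unfolding S_def by auto
      obtain C1 where C1: "is_cycle (edge E) C1" "set C1 = set C" "length C1 = length C"
        "cycle_edges C1 = cycle_edges C" "f Y = {last C1, hd C1}"
        using is_cycle_rotate_to_edge[OF C(1)] f[OF Y(1)] by metis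
      have ne: "C1 \<noteq> []" using C1(1) by (auto simp: is_cycle_def)
      have fY: "f Y \<subseteq> Y" using f[OF Y(1)] by blast
      have "last C1 \<in> Nb" "hd C1 \<in> Nb" using CY C1 fY ne by auto
      then obtain w w' where w: "w \<in> W" "{last C1, w} \<in> G" "w' \<in> W" "{hd C1, w'} \<in> G"
        unfolding Nb_def by blast
      obtain Q where Q: "is_path (edge E) W Q" "hd Q = w" "last Q = w'" "length Q \<le> J"
        using pathW[OF w(1,3)] by blast
      have adjQ: "edge E (last C1) (hd Q)" "edge E (last Q) (hd C1)"
        using Q w GE by (auto simp: insert_commute)
      note ins = is_cycle_insert_one[OF C1(1), of Q, OF _ _ _ _ adjQ]
      have Qp: "Q \<noteq> []" "distinct Q" "set Q \<inter> set C1 = {}" "successively (edge E) Q" "set Q \<subseteq> W"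
        using Q(1) Wn C1(2) unfolding is_path_def by auto
      have sub: "cycle_edges C - {f Y} \<subseteq> path_edges C1"
        using C1(4,5) unfolding cycle_edges_def[of C1] by blast
      have new: "is_cycle (edge E) (C1 @ Q)"
        "cycle_edges C - {f Y} \<subseteq> cycle_edges (C1 @ Q)" "{last C1, hd Q} \<in> cycle_edges (C1 @ Q)"
        using ins(1)[OF Qp(1-4)] sub unfolding ins(2)[OF Qp(1-4)] by blast+
      \<comment> \<open>In \<open>Y\<close> the opened edge is succeeded by
        \<open>{last C1, hd Q}\<close>, different from \<open>e\<close> because \<open>hd Q\<close>
        is new to the cycle. The edges kept for other parts are not the opened one, since parts are
        disjoint.\<close>
      have "\<exists>g\<in>cycle_edges (C1 @ Q). g \<subseteq> Y' \<and> g \<noteq> e" if Y': "Y' \<in> PP" for Y'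
      proof (cases "Y' = Y")
        case True
        have "w \<notin> set C" using w Wn by auto
        moreover have "e \<subseteq> set C" using cycle_edges_subset[OF _ C(3)] ne C1(3) by fastforce
        ultimately have "{last C1, hd Q} \<noteq> e" using Q(2) by auto
        moreover have "{last C1, hd Q} \<subseteq> Y" using fY C1(5) Q(2) w W(2) unfolding Zn_def by auto
        ultimately show ?thesis using new True by blast
      next
        case False
        have "f Y' \<noteq> {}" using f[OF Y'] unfolding cycle_edges_def path_edges_def by auto
        then have "f Y' \<noteq> f Y" using f[OF Y'] fY disjPP[OF Y' Y(1) False] by auto
        then show ?thesis using f[OF Y'] new by blast
      qed
      moreover have "e \<in> cycle_edges (C1 @ Q)" using f[OF Y(1)] C(3) new by auto
      moreover have "set (C1 @ Q) \<subseteq> {..<n} - Z" using C(2) C1(2) Qp(5) Wn by auto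
      ultimately have "good Z e (C1 @ Q)" unfolding good_def using new by blast
      then show ?thesis using Q C1(3) Qp(1) by (intro exI[of _ "C1 @ Q"]) auto
    qed
  qed
qed

text \<open>As \<open>v\<close> sees every vertex of \<open>us\<close>, the edge from
  \<open>v\<close> to \<open>u\<close> can be replaced by u, the first \<open>r\<close> vertices of
  \<open>us\<close>, and back to \<open>v\<close>, for any \<open>r\<close>. The two cases are the
  two orientations of that edge.\<close>

lemma good_comb_cycle:
  assumes C: "good (set us) {v, u} C" and us: "is_path (edge E) {..<n} (u # us)"
    and v: "\<And>x. x \<in> set us \<Longrightarrow> {v, x} \<in> E" and r: "r \<le> length us"
  shows "\<exists>xs. is_cycle (edge E) xs \<and> set xs \<subseteq> {..<n} \<and> length xs = length C + r"
proof (cases "r = 0")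
  case True
  then show ?thesis using C unfolding good_def by auto
next
  case False
  obtain C1 where C1: "is_cycle (edge E) C1" "set C1 = set C" "length C1 = length C"
    "cycle_edges C1 = cycle_edges C" "{v, u} = {last C1, hd C1}"
    using is_cycle_rotate_to_edge[of "edge E" C "{v, u}"] C unfolding good_def by metis
  define Q where "Q = take r us"
  have "successively (edge E) (take r us @ drop r us)"
    using us unfolding is_path_def by (cases us) auto
  then have sQ: "successively (edge E) Q" unfolding Q_def successively_append_iff by blast
  have Qs: "set Q \<subseteq> set us" unfolding Q_def by (rule set_take_subset)
  have Q: "Q \<noteq> []" "distinct Q" "set Q \<inter> set C1 = {}" "length Q = r" "set Q \<subseteq> {..<n}"
    using False r us C C1(2) Qs unfolding Q_def good_def is_path_def by auto
  have uQ: "{u, hd Q} \<in> E" using us False r unfolding is_path_def Q_def by (cases us; cases r) auto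
  have vQ: "{v, last Q} \<in> E" using v Qs Q(1) by (meson last_in_set subsetD)
  from C1(5) consider "last C1 = v" "hd C1 = u" | "last C1 = u" "hd C1 = v"
    by (auto simp: doubleton_eq_iff)
  then show ?thesis
  proof cases
    case 1
    have "is_cycle (edge E) (C1 @ rev Q)"
      using Q sQ uQ vQ 1
      by (intro is_cycle_insert_one[OF C1(1)])
        (auto simp: hd_rev last_rev insert_commute)
    then show ?thesis using Q C C1 unfolding good_def by (intro exI[of _ "C1 @ rev Q"]) auto
  next
    case 2
    have "is_cycle (edge E) (C1 @ Q)"
      using Q sQ uQ vQ 2
      by (intro is_cycle_insert_one[OF C1(1)]) (auto simp: insert_commute)
    then show ?thesis using Q C C1 unfolding good_def by (intro exI[of _ "C1 @ Q"]) auto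
  qed
qed

end

lemma has_cycle_if_is_cycle:
  assumes "is_cycle (edge E) xs" "set xs \<subseteq> {..<n}" "length xs = l"
  shows "has_cycle n E l"
proof -
  have "{xs ! i, xs ! ((i + 1) mod l)} \<in> E" if "i < l" for i
  proof (cases "Suc i = l")
    case True
    have "xs \<noteq> []" using that assms(3) by auto
    then have "last xs = xs ! i" "hd xs = xs ! 0" using True assms(3) by (auto simp: last_conv_nth hd_conv_nth)
    then show ?thesis using True assms(1) unfolding is_cycle_def by simp
  next
    case False
    then have "Suc i < length xs" using that assms(3) by simp
    then show ?thesis using assms successively_nth[of "edge E" xs i] unfolding is_cycle_def by simp
  qed
  then show ?thesis using assms unfolding has_cycle_def is_cycle_def by auto
qed

context decomposed_graph
begin

text \<open>A longest good cycle of length at most \<open>l\<close> either misses \<open>l\<close>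
  by less than \<open>J\<close>, as an enlargement step would overshoot, or covers everything but
  the \<open>L\<close> reserved vertices. In both cases the reserve fills the gap.\<close>

lemma good_all_lengths:
  assumes good: "good (set us) {v, u} C" and us: "is_path (edge E) {..<n} (u # us)"
    and v: "\<And>x. x \<in> set us \<Longrightarrow> {v, x} \<in> E" and L: "length us = L"
    and a0: "a0 = \<alpha> + 2 * (card PP + 1)" and q: "q + a0 + L + card D \<le> d" "1 \<le> q"
    and J: "3 * n < Suc J * q" "1 \<le> J" "J \<le> L" and k: "L + a0 < \<kappa>"
    and l: "length C \<le> l" "l \<le> n"
  shows "has_cycle n E l"
proof -
  define P where "P C' \<longleftrightarrow> good (set us) {v, u} C' \<and> length C' \<le> l" for C'
  have "P C" using good l unfolding P_def by blast
  then obtain C' where C': "P C'" and max: "\<And>C''. P C'' \<Longrightarrow> length C'' \<le> length C'"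
    using ex_has_greatest_nat[of P C length "Suc l"] unfolding P_def by (metis less_Suc_eq_le)
  have g: "good (set us) {v, u} C'" "length C' \<le> l" using C' unfolding P_def by auto
  have us_n: "set us \<subseteq> {..<n}" "distinct us" using us unfolding is_path_def by auto
  have cus: "card (set us) = L" using us_n L distinct_card by metis
  have "l \<le> length C' + L"
  proof (cases "set C' = {..<n} - set us")
    case True
    have "length C' = card (set C')" using g(1) unfolding good_def is_cycle_def by (metis distinct_card)
    also have "\<dots> = n - L" unfolding True using us_n cus by (subst card_Diff_subset) auto
    finally show ?thesis using l by simp
  next
    case False
    obtain C'' where "good (set us) {v, u} C''" "length C' < length C''" "length C'' \<le> length C' + J"
      using good_step[OF g(1) us_n(1) _ False a0 q J(1,2) k] cus by auto
    then show ?thesis using max[of C''] J(3) unfolding P_def by fastforce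
  qed
  then have "l - length C' \<le> length us" using L by simp
  from good_comb_cycle[OF g(1) us v this]
  obtain xs where "is_cycle (edge E) xs" "set xs \<subseteq> {..<n}" "length xs = length C' + (l - length C')"
    by blast
  then show ?thesis using has_cycle_if_is_cycle[of E xs n l] g(2) by simp
qed

text \<open>The neighbourhood of a cycle vertex \<open>v\<close> in its part, off the cycle, has
  more than \<open>\<alpha> * L\<close> vertices and so contains a path \<open>u # us\<close> with
  \<open>L\<close> vertices after \<open>u\<close>. Rerouting the cycle through \<open>u\<close>
  makes it good for the reserve \<open>us\<close>; shorter lengths come from \<open>v\<close> and an
  initial piece of that path.\<close>

theorem pancyclic_if_initial_cycle:
  assumes C: "is_cycle (edge E) C" "set C \<subseteq> {..<n}" "length C \<le> c"
    and pass: "\<And>Y. Y \<in> PP \<Longrightarrow> \<exists>x v y. {x, v} \<in> cycle_edges C \<and> {v, y} \<in> cycle_edges C \<and> x \<noteq> y \<and>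
        x \<in> Y \<and> v \<in> Y \<and> y \<in> Y"
    and PP: "PP \<noteq> {}"
    and a0: "a0 = \<alpha> + 2 * (card PP + 1)" and q: "q + a0 + L + card D \<le> d" "1 \<le> q"
    and q': "q + c + L + card D \<le> d"
    and J: "3 * n < Suc J * q" "1 \<le> J" "c + J \<le> L" and k: "L + a0 < \<kappa>" "c + L < \<kappa>"
    and long: "\<alpha> * L + c + card D < d"
  shows "pancyclic n E"
proof -
  obtain Y where Y: "Y \<in> PP" using PP by blast
  obtain x v y where xvy: "{x, v} \<in> cycle_edges C" "{v, y} \<in> cycle_edges C" "x \<noteq> y" "x \<in> Y" "v \<in> Y" "y \<in> Y"
    using pass[OF Y] by blast
  have neC: "C \<noteq> []" using C(1) by (auto simp: is_cycle_def)
  have cC: "card (set C) \<le> c" using C(3) card_length[of C] by linarith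
  have Yn: "Y \<subseteq> {..<n}" using PP_sub[OF Y] by blast
  define X where "X = {z \<in> Y - set C. {v, z} \<in> G}"
  have XY: "X \<subseteq> Y - set C" "finite X" using PP_fin[OF Y] unfolding X_def by auto
  have "d \<le> card D + c + card {z \<in> Y - set C. {v, z} \<in> G}"
    by (rule inner_degree[OF Y xvy(5), where A = "set C"]) (use cC PP_fin[OF Y] in auto)
  then have "\<alpha> * L < card X" using long unfolding X_def by linarith
  then obtain us' where us': "is_path (edge G) X us'" "length us' = Suc L"
  proof (rule long_path_if_no_large_independent_set[where G = G and a = \<alpha>, OF XY(2), rotated 2])
    show "\<exists>x\<in>U. \<exists>y\<in>U. edge G x y" if "U \<subseteq> X" "\<alpha> < card U" for U
      using indepG[of U] that XY(1) Yn by blast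
    show "\<not> edge G x x" for x using irrE GE by auto
  qed (rule that)
  obtain u us where us: "us' = u # us" using us'(2) by (cases us') auto
  have lus: "length us = L" using us' us by simp
  have uus: "is_path (edge E) {..<n} (u # us)"
    using is_path_mono[OF us'(1) GE] XY Yn us by blast
  have usX: "u \<in> X" "set us \<subseteq> X" "u \<notin> set us" using us'(1) us unfolding is_path_def by auto
  have vus: "{v, z} \<in> G" if "z \<in> X" for z using that unfolding X_def by blast
  define S where "S = set C \<inter> Y \<union> set us"
  define W where "W = Y - S"
  have SY: "S \<subseteq> Y" using usX(2) XY unfolding S_def by auto
  have cS: "card S \<le> c + L"
  proof -
    have "card S \<le> card (set C \<inter> Y) + card (set us)" unfolding S_def by (rule card_Un_le)
    moreover have "card (set C \<inter> Y) \<le> card (set C)" by (intro card_mono) auto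
    ultimately show ?thesis using cC card_length[of us] lus by linarith
  qed
  have finS: "finite S" unfolding S_def by simp
  have uW: "u \<in> W" using usX XY unfolding W_def S_def by auto
  have degW: "q \<le> card {z \<in> W. {x, z} \<in> G}" if "x \<in> Y" for x
  proof -
    have "d \<le> card D + (c + L) + card {z \<in> W. {x, z} \<in> G}"
      by (rule inner_degree[OF Y that, where A = S])
        (use finS cS PP_fin[OF Y] in \<open>auto simp: W_def\<close>)
    then show ?thesis using q' by linarith
  qed
  have "{z \<in> W. {y, z} \<in> G} \<noteq> {}" using degW[OF xvy(6)] q(2) by (metis card.empty not_one_le_zero le_trans)
  then obtain w where w: "w \<in> W" "{y, w} \<in> G" by blast
  obtain W' where W': "u \<in> W'" "W' \<subseteq> W" "\<And>x y. x \<in> W' \<Longrightarrow> y \<in> W \<Longrightarrow> edge G x y \<Longrightarrow> y \<in> W'"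
    "\<And>x y. x \<in> W' \<Longrightarrow> y \<in> W' \<Longrightarrow> \<exists>xs. is_walk (edge G) W' xs \<and> hd xs = x \<and> last xs = y"
  proof (rule component_exists[where adj = "edge G" and w = u and Z = W])
    show "edge G x y \<Longrightarrow> edge G y x" for x y by (rule edge_sym)
    show "u \<in> W" by (rule uW)
  qed (rule that)
  \<comment> \<open>\<open>S\<close> has at most \<open>c + L < \<kappa>\<close> vertices, so
    \<open>Y\<close> stays connected without it and a short path from \<open>u\<close> to
    \<open>w\<close> avoids both the cycle and the reserve.\<close>
  have "W' = W"
  proof (rule ccontr)
    assume "W' \<noteq> W"
    moreover have "card S < \<kappa>" using cS k by linarith
    ultimately obtain a b where "a \<in> W'" "b \<in> Y - S - W'" "{a, b} \<in> G"
      using conn[OF Y SY, of W'] W'(1,2) unfolding W_def by blast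
    then show False using W'(3)[of a b] unfolding W_def by blast
  qed
  have finW: "finite W" "W \<subseteq> {..<n}" "W \<subseteq> Y" using PP_fin[OF Y] Yn unfolding W_def by auto
  have wW': "w \<in> W'" using w \<open>W' = W\<close> by simp
  obtain Q where Q: "is_path (edge G) W Q" "hd Q = u" "last Q = w" "length Q \<le> J"
    using short_path_in[OF finW(1,2) _ W'(4)[OF W'(1) wW', unfolded \<open>W' = W\<close>] J(1)] degW finW(3) by blast
  have QE: "successively (edge E) Q" "Q \<noteq> []" "distinct Q" "set Q \<subseteq> W"
    using is_path_mono[OF Q(1) GE, of W] unfolding is_path_def by auto
  obtain C1 where C1: "is_cycle (edge E) C1" "set C1 = set C" "length C1 = length C"
    "cycle_edges C1 = cycle_edges C" "{v, y} = {last C1, hd C1}"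
    using is_cycle_rotate_to_edge[OF C(1) xvy(2)] by metis
  have QC: "set Q \<inter> set C1 = {}" using QE C1(2) finW(3) unfolding W_def S_def by auto
  have vuE: "{v, u} \<in> E" "{w, y} \<in> E" using vus[OF usX(1)] w GE by (auto simp: insert_commute)
  have sub: "cycle_edges C - {{v, y}} \<subseteq> path_edges C1"
    using C1(4,5) unfolding cycle_edges_def[of C1] by blast
  \<comment> \<open>The edge from \<open>v\<close> to \<open>y\<close> is replaced by a path through
    \<open>u\<close> and \<open>w\<close>. The edge \<open>{x, v}\<close> stays as the edge of
    \<open>Y\<close> besides \<open>{v, u}\<close>; for this reason \<open>pass\<close> supplies two
    consecutive edges inside a part.\<close>
  have "\<exists>C2. is_cycle (edge E) C2 \<and> set C2 = set C \<union> set Q \<and> length C2 = length C + length Q \<and>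
     {v, u} \<in> cycle_edges C2 \<and> path_edges C1 \<subseteq> cycle_edges C2"
  proof -
    from C1(5) consider "last C1 = v" "hd C1 = y" | "last C1 = y" "hd C1 = v"
      by (auto simp: doubleton_eq_iff)
    then show ?thesis
    proof cases
      case 1
      have *: "edge E (last C1) (hd Q)" "edge E (last Q) (hd C1)" using 1 Q vuE by auto
      note ins = is_cycle_insert_one[OF C1(1) QE(2,3) QC QE(1) *]
      show ?thesis
        using ins 1 Q C1(2,3) by (intro exI[of _ "C1 @ Q"]) auto
    next
      case 2
      have *: "edge E (last C1) (hd (rev Q))" "edge E (last (rev Q)) (hd C1)"
        using 2 Q vuE QE(2) by (auto simp: hd_rev last_rev insert_commute)
      have rQ: "rev Q \<noteq> []" "distinct (rev Q)" "set (rev Q) \<inter> set C1 = {}" "successively (edge E) (rev Q)"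
        using QE QC by (auto simp: insert_commute)
      note ins = is_cycle_insert_one[OF C1(1) rQ *]
      have "{v, u} = {last (rev Q), hd C1}" using 2 Q QE(2) by (auto simp: last_rev)
      then show ?thesis
        using ins C1(2,3) by (intro exI[of _ "C1 @ rev Q"]) auto
    qed
  qed
  then obtain C2 where C2: "is_cycle (edge E) C2" "set C2 = set C \<union> set Q" "length C2 = length C + length Q"
     "{v, u} \<in> cycle_edges C2" "path_edges C1 \<subseteq> cycle_edges C2" by blast
  have uC: "u \<notin> set C" using usX XY by blast
  have "\<exists>f\<in>cycle_edges C2. f \<subseteq> Y' \<and> f \<noteq> {v, u}" if Y': "Y' \<in> PP" for Y'
  proof -
    have ne: "f \<noteq> {v, u}" if "f \<in> cycle_edges C" for f
      using cycle_edges_subset[OF neC that] uC by auto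
    show ?thesis
    proof (cases "Y' = Y")
      case True
      have "{x, v} \<noteq> {v, y}" using xvy(3) by (auto simp: doubleton_eq_iff)
      then have "{x, v} \<in> cycle_edges C2" using xvy(1) sub C2(5) by blast
      moreover have "{x, v} \<subseteq> Y'" using xvy True by simp
      ultimately show ?thesis using ne[OF xvy(1)] by blast
    next
      case False
      obtain a b where ab: "{a, b} \<in> cycle_edges C" "a \<in> Y'" "b \<in> Y'" using pass[OF Y'] by blast
      have "v \<notin> Y'" using disjPP[OF Y' Y False] xvy(5) by blast
      then have "{a, b} \<noteq> {v, y}" using ab by auto
      then have "{a, b} \<in> cycle_edges C2" using ab(1) sub C2(5) by blast
      moreover have "{a, b} \<subseteq> Y'" using ab by simp
      ultimately show ?thesis using ne[OF ab(1)] by blast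
    qed
  qed
  moreover have "set C2 \<subseteq> {..<n} - set us"
    using C2(2) C(2) usX(2) XY QE(4) finW(2) unfolding W_def S_def by auto
  ultimately have good: "good (set us) {v, u} C2" unfolding good_def using C2 by blast
  show ?thesis
    unfolding pancyclic_def
  proof (intro allI impI)
    fix l assume l: "3 \<le> l \<and> l \<le> n"
    show "has_cycle n E l"
    proof (cases "length C2 \<le> l")
      case True
      have "{v, z} \<in> E" if "z \<in> set us" for z using vus usX(2) GE that by blast
      moreover have "J \<le> L" "l \<le> n" using J(3) l by auto
      ultimately show ?thesis
        using good_all_lengths[OF good uus _ lus a0 q J(1,2) _ k(1) True] by blast
    next
      case False
      \<comment> \<open>\<open>v\<close> and \<open>u\<close> account for two vertices. The rest
        fits into \<open>us\<close> because the rerouted cycle has length at most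
        \<open>c + J \<le> L\<close>.\<close>
      define r where "r = l - 2"
      have r: "1 \<le> r" "r \<le> L" using False l C2(3) C(3) Q(4) J(3) unfolding r_def by auto
      define xs where "xs = v # u # take r us"
      have lx: "length xs = l" unfolding xs_def using r lus l by (simp add: r_def)
      have "successively (edge E) (take (Suc r) (u # us) @ drop (Suc r) (u # us))"
        using uus unfolding is_path_def by (simp only: append_take_drop_id)
      then have "successively (edge E) (u # take r us)" unfolding successively_append_iff by simp
      moreover have tk: "set (take r us) \<subseteq> set us" by (rule set_take_subset)
      moreover have "v \<noteq> u" "v \<notin> set us" using usX vus irrE GE by fastforce+
      moreover have "take r us \<noteq> []" using r lus by auto
      moreover have "{v, last (take r us)} \<in> E"
        using \<open>take r us \<noteq> []\<close> tk usX vus GE by (meson last_in_set subsetD)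
      ultimately have "is_cycle (edge E) xs"
        unfolding is_cycle_def using lx l uus vuE r
        by (auto simp: xs_def is_path_def insert_commute successively_Cons)
      moreover have "set xs \<subseteq> {..<n}" using xvy(5) Yn uus tk unfolding xs_def is_path_def by auto
      ultimately show ?thesis using has_cycle_if_is_cycle lx by blast
    qed
  qed
qed

end

section \<open>Decomposition into highly connected parts\<close>

text \<open>Each cut adds one part and fewer than \<kappa> vertices to \<open>D\<close>, which the
  bound on \<open>card D\<close> records.\<close>

definition decomposition :: "nat \<Rightarrow> nat set set \<Rightarrow> nat \<Rightarrow> nat set \<Rightarrow> nat set set \<Rightarrow> bool" where
  "decomposition n G \<kappa> D PP \<longleftrightarrow> D \<subseteq> {..<n} \<and> \<Union>PP = {..<n} - D \<and> {} \<notin> PP \<and> card D \<le> card PP * \<kappa> \<and>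
     (\<forall>X\<in>PP. \<forall>Y\<in>PP. X \<noteq> Y \<longrightarrow> X \<inter> Y = {} \<and> (\<forall>x\<in>X. \<forall>y\<in>Y. {x, y} \<notin> G))"

lemma decomposition_finite: "decomposition n G \<kappa> D PP \<Longrightarrow> finite PP \<and> (\<forall>Y\<in>PP. finite Y) \<and> finite D"
proof -
  assume a: "decomposition n G \<kappa> D PP"
  then have PP: "PP \<subseteq> Pow {..<n}" and D: "D \<subseteq> {..<n}" unfolding decomposition_def by auto
  show ?thesis
  proof (intro conjI ballI)
    show "finite PP" using PP by (rule finite_subset) simp
    show "finite D" using D by (rule finite_subset) simp
    show "finite Y" if "Y \<in> PP" for Y using PP that by (intro finite_subset[of Y "{..<n}"]) auto
  qed
qed

text \<open>With at most \<open>M\<close> parts, \<open>D\<close> takes at most half of a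
  neighbourhood, so each part has at least d/2 vertices and there are at most 2n/d <
  \<open>M\<close> of them. The cap improves itself to a strict one, leaving room for one more
  cut.\<close>

lemma decomposition_card:
  assumes dec: "decomposition n G \<kappa> D PP" and M: "card PP \<le> M" "2 * (M * \<kappa>) \<le> d" "2 * n < M * d"
    and deg: "\<And>v. v < n \<Longrightarrow> d \<le> card {u. u < n \<and> {u, v} \<in> G}"
  shows "card PP < M" "2 * card D \<le> d"
proof -
  note fin = decomposition_finite[OF dec]
  have cov: "\<Union>PP = {..<n} - D" and ne: "{} \<notin> PP"
    and noedge: "\<And>X Y x y. X \<in> PP \<Longrightarrow> Y \<in> PP \<Longrightarrow> X \<noteq> Y \<Longrightarrow> x \<in> X \<Longrightarrow> y \<in> Y \<Longrightarrow> {x, y} \<notin> G"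
    using dec unfolding decomposition_def by auto
  have "card D \<le> card PP * \<kappa>" using dec unfolding decomposition_def by blast
  also have "\<dots> \<le> M * \<kappa>" using M by simp
  finally show D: "2 * card D \<le> d" using M by linarith
  have half: "d \<le> 2 * card Y" if Y: "Y \<in> PP" for Y
  proof -
    obtain y where y: "y \<in> Y" using ne Y by (metis all_not_in_conv)
    have yn: "y < n" using cov Y y by auto
    have "{u. u < n \<and> {u, y} \<in> G} \<subseteq> Y \<union> D"
    proof
      fix u assume u: "u \<in> {u. u < n \<and> {u, y} \<in> G}"
      show "u \<in> Y \<union> D"
      proof (cases "u \<in> D")
        case False
        then obtain X where "X \<in> PP" "u \<in> X" using u cov by auto
        then have "X = Y" using u y Y noedge[of X Y u y] by blast
        then show ?thesis using \<open>u \<in> X\<close> by blast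
      qed simp
    qed
    then have "card {u. u < n \<and> {u, y} \<in> G} \<le> card (Y \<union> D)" using fin Y by (intro card_mono) auto
    also have "\<dots> \<le> card Y + card D" by (rule card_Un_le)
    finally show ?thesis using deg[OF yn] D by linarith
  qed
  have "card PP * d = (\<Sum>Y\<in>PP. d)" by simp
  also have "\<dots> \<le> (\<Sum>Y\<in>PP. 2 * card Y)" using half by (intro sum_mono)
  also have "\<dots> = 2 * card (\<Union>PP)"
  proof -
    have "card (\<Union>PP) = (\<Sum>Y\<in>PP. card Y)"
      using fin dec by (intro card_Union_disjoint) (auto simp: decomposition_def pairwise_def disjnt_def)
    then show ?thesis by (simp add: sum_distrib_left)
  qed
  also have "card (\<Union>PP) \<le> card {..<n}"
    using dec unfolding decomposition_def by (intro card_mono) auto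
  finally have "card PP * d \<le> 2 * n" by simp
  then have "card PP * d < M * d" using M(3) by linarith
  then show "card PP < M" by (metis mult_less_cancel2)
qed

text \<open>Take a decomposition into the most parts among those with at most \<open>M\<close>. A
  small separator would split a part in two, and by the strict cap the refinement is still
  admissible, a contradiction.\<close>

lemma ex_decomposition:
  assumes n: "0 < n" and M: "1 \<le> M" "2 * (M * \<kappa>) \<le> d" "2 * n < M * d"
    and deg: "\<And>v. v < n \<Longrightarrow> d \<le> card {u. u < n \<and> {u, v} \<in> G}"
  obtains D PP where "decomposition n G \<kappa> D PP" "card PP < M" "2 * card D \<le> d" "PP \<noteq> {}"
    "\<And>Y S X. Y \<in> PP \<Longrightarrow> S \<subseteq> Y \<Longrightarrow> card S < \<kappa> \<Longrightarrow> X \<subseteq> Y - S \<Longrightarrow> X \<noteq> {} \<Longrightarrow> X \<noteq> Y - S \<Longrightarrow>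
         \<exists>x\<in>X. \<exists>y\<in>Y - S - X. {x, y} \<in> G"
proof -
  define Q where "Q = (\<lambda>(D, PP). decomposition n G \<kappa> D PP \<and> 1 \<le> card PP \<and> card PP \<le> M)"
  have "Q ({}, {{..<n}})" unfolding Q_def decomposition_def using n M by (auto simp: lessThan_empty_iff)
  moreover have "\<forall>DP. Q DP \<longrightarrow> card (snd DP) < Suc M" unfolding Q_def by auto
  ultimately obtain DP where DP: "Q DP" "\<And>DP'. Q DP' \<Longrightarrow> card (snd DP') \<le> card (snd DP)"
    using ex_has_greatest_nat[of Q "({}, {{..<n}})" "\<lambda>DP. card (snd DP)" "Suc M"] by blast
  obtain D PP where eq: "DP = (D, PP)" by (cases DP)
  have dec: "decomposition n G \<kappa> D PP" "1 \<le> card PP" "card PP \<le> M" using DP(1) eq unfolding Q_def by auto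
  note cd = decomposition_card[OF dec(1,3) M(2,3) deg]
  note fin = decomposition_finite[OF dec(1)]
  have "\<exists>x\<in>X. \<exists>y\<in>Y - S - X. {x, y} \<in> G"
    if h: "Y \<in> PP" "S \<subseteq> Y" "card S < \<kappa>" "X \<subseteq> Y - S" "X \<noteq> {}" "X \<noteq> Y - S" for Y S X
  proof (rule ccontr)
    assume no: "\<not> ?thesis"
    define X' where "X' = Y - S - X"
    define PP' where "PP' = insert X (insert X' (PP - {Y}))"
    have X': "X' \<noteq> {}" "X' \<subseteq> Y" "X \<inter> X' = {}" "X \<subseteq> Y" using h unfolding X'_def by auto
    have disj: "A \<inter> B = {} \<and> (\<forall>x\<in>A. \<forall>y\<in>B. {x, y} \<notin> G)" if "A \<in> PP" "B \<in> PP" "A \<noteq> B" for A B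
      using dec(1) that unfolding decomposition_def by blast
    have disjY: "A \<inter> Y = {} \<and> (\<forall>x\<in>A. \<forall>y\<in>Y. {x, y} \<notin> G \<and> {y, x} \<notin> G)" if "A \<in> PP - {Y}" for A
      using disj[of A Y] disj[of Y A] that h(1) by auto
    have noXX': "\<forall>x\<in>X. \<forall>y\<in>X'. {x, y} \<notin> G \<and> {y, x} \<notin> G"
      using no unfolding X'_def by (auto simp: insert_commute)
    have "card PP' = card PP + 1"
    proof -
      have "X \<notin> PP - {Y}" "X' \<notin> PP - {Y}" using disjY[of X] disjY[of X'] X' h(5) by blast+
      moreover have "X \<noteq> X'" using X' h(5) by auto
      ultimately have "card PP' = Suc (Suc (card (PP - {Y})))" unfolding PP'_def using fin by simp
      then show ?thesis using h(1) fin dec(2) by (simp add: card_Diff_singleton)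
    qed
    moreover have "decomposition n G \<kappa> (D \<union> S) PP'"
      unfolding decomposition_def
    proof (intro conjI ballI impI)
      have cov: "\<Union>PP = {..<n} - D" and Dn: "D \<subseteq> {..<n}" and ne: "{} \<notin> PP"
        using dec(1) unfolding decomposition_def by auto
      have Yn: "Y \<subseteq> {..<n} - D" using cov h(1) by blast
      show "D \<union> S \<subseteq> {..<n}" using Dn Yn h(2) by blast
      show "{} \<notin> PP'" using ne X' h(5) unfolding PP'_def by auto
      have "\<Union>PP' = X \<union> X' \<union> \<Union>(PP - {Y})" unfolding PP'_def by blast
      also have "X \<union> X' = Y - S" using h(4) unfolding X'_def by blast
      also have "Y - S \<union> \<Union>(PP - {Y}) = \<Union>PP - S" using disjY h(1,2) by blast
      finally show "\<Union>PP' = {..<n} - (D \<union> S)" using cov by blast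
      have "card (D \<union> S) \<le> card D + card S" by (rule card_Un_le)
      also have "\<dots> \<le> card PP * \<kappa> + \<kappa>" using h(3) dec(1) unfolding decomposition_def by simp
      finally show "card (D \<union> S) \<le> card PP' * \<kappa>" using \<open>card PP' = card PP + 1\<close> by simp
    next
      fix A B assume AB: "A \<in> PP'" "B \<in> PP'" "A \<noteq> B"
      have "A \<inter> B = {} \<and> (\<forall>x\<in>A. \<forall>y\<in>B. {x, y} \<notin> G)"
      proof -
        consider "A \<in> PP - {Y}" "B \<in> PP - {Y}" | "A \<in> PP - {Y}" "B \<subseteq> Y" | "A \<subseteq> Y" "B \<in> PP - {Y}"
          | "A = X" "B = X'" | "A = X'" "B = X"
          using AB X' unfolding PP'_def by blast
        then show ?thesis
        proof cases
          case 1 then show ?thesis using disj[of A B] AB by blast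
        next
          case 2 then show ?thesis using disjY[of A] by blast
        next
          case 3 then show ?thesis using disjY[of B] by blast
        next
          case 4 then show ?thesis using noXX' X' by blast
        next
          case 5 then show ?thesis using noXX' X' by blast
        qed
      qed
      then show "A \<inter> B = {}" and "\<And>x y. x \<in> A \<Longrightarrow> y \<in> B \<Longrightarrow> {x, y} \<notin> G" by blast+
    qed
    ultimately have "Q (D \<union> S, PP')" unfolding Q_def using cd(1) by simp
    then have "card PP' \<le> card PP" using DP(2)[of "(D \<union> S, PP')"] eq by simp
    then show False using \<open>card PP' = card PP + 1\<close> by simp
  qed
  then show thesis using that[OF dec(1) cd] dec(2) by (metis card.empty not_one_le_zero)
qed

context decomposed_graph
begin

text \<open>A family with the largest number of hubs covers at least half of every part, since
  otherwise another hub fits in. The number is bounded because the sets are disjoint and of size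
  \<open>t\<close>.\<close>

lemma ex_hub_families:
  assumes t: "1 \<le> t" "2 * t + m0 + card D \<le> d" "n < Suc m0 * t" and ne: "{} \<notin> PP"
  obtains m h N where "inj_on h {..<m}" "disjoint_family_on N {..<m}" "m * t \<le> n"
    "\<And>i. i < m \<Longrightarrow> \<exists>Y\<in>PP. h i \<in> Y \<and> N i \<subseteq> Y \<and> (\<forall>x\<in>N i. {x, h i} \<in> G) \<and> card (N i) = t"
    "n \<le> card D + 2 * (m * t)" "\<And>Y. Y \<in> PP \<Longrightarrow> \<exists>i<m. N i \<subseteq> Y \<and> h i \<in> Y"
proof -
  define fam where "fam = (\<lambda>(m, h, N). inj_on h {..<m :: nat} \<and> disjoint_family_on N {..<m} \<and>
    (\<forall>i<m. \<exists>Y\<in>PP. h i \<in> Y \<and> N i \<subseteq> Y \<and> (\<forall>x\<in>N i. {x, h i} \<in> G) \<and> card (N i) = t))"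
  have NU: "card (\<Union>i<m. N i) = m * t" "(\<Union>i<m. N i) \<subseteq> {..<n}" if "fam (m, h, N)" for m h N
  proof -
    have f: "\<And>i. i < m \<Longrightarrow> \<exists>Y\<in>PP. N i \<subseteq> Y \<and> card (N i) = t" "disjoint_family_on N {..<m}"
      using that unfolding fam_def by blast+
    have Nn: "N i \<subseteq> {..<n}" if "i < m" for i using f(1)[OF that] PP_sub by blast
    then show sub: "(\<Union>i<m. N i) \<subseteq> {..<n}" by auto
    have "card (\<Union>i<m. N i) = (\<Sum>i<m. card (N i))"
    proof (rule card_UN_disjoint)
      show "\<forall>i\<in>{..<m}. finite (N i)" using Nn finite_subset[OF _ finite_lessThan] by blast
      show "\<forall>i\<in>{..<m}. \<forall>j\<in>{..<m}. i \<noteq> j \<longrightarrow> N i \<inter> N j = {}"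
        using f(2) unfolding disjoint_family_on_def by blast
    qed simp
    also have "\<dots> = (\<Sum>i<m. t)" using f(1) by (intro sum.cong) auto
    finally show "card (\<Union>i<m. N i) = m * t" by simp
  qed
  have bound: "m * t \<le> n" if "fam (m, h, N)" for m h N
    using NU[OF that] card_mono[of "{..<n}" "\<Union>i<m. N i"] by simp
  have bound': "m \<le> m0" if "fam (m, h, N)" for m h N
  proof -
    have "m * t < Suc m0 * t" using bound[OF that] t(3) by linarith
    then show ?thesis by (metis less_Suc_eq_le mult_less_cancel2)
  qed
  define ex where "ex m \<longleftrightarrow> (\<exists>h N. fam (m, h, N))" for m
  have "ex 0" unfolding ex_def fam_def by (auto simp: disjoint_family_on_def)
  moreover have "ex m \<Longrightarrow> m \<le> m0" for m unfolding ex_def using bound' by blast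
  ultimately obtain m where m: "ex m" "\<And>m'. ex m' \<Longrightarrow> m' \<le> m"
    using ex_has_greatest_nat[of ex 0 "\<lambda>x. x" "Suc m0"] by (auto simp: less_Suc_eq_le)
  obtain h N where fam: "fam (m, h, N)" using m(1) unfolding ex_def by blast
  have f: "inj_on h {..<m}" "disjoint_family_on N {..<m}"
    "\<And>i. i < m \<Longrightarrow> \<exists>Y\<in>PP. h i \<in> Y \<and> N i \<subseteq> Y \<and> (\<forall>x\<in>N i. {x, h i} \<in> G) \<and> card (N i) = t"
    using fam unfolding fam_def by blast+
  define U where "U = (\<Union>i<m. N i)"
  have finU: "finite U" using NU(2)[OF fam] finite_subset unfolding U_def by blast
  have half: "card Y \<le> 2 * card (Y \<inter> U)" if Y: "Y \<in> PP" for Y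
  proof (rule ccontr)
    assume neg: "\<not> card Y \<le> 2 * card (Y \<inter> U)"
    define B where "B = Y - U"
    have finY: "finite Y" "finite B" using PP_fin[OF Y] unfolding B_def by auto
    have "card Y = card (Y \<inter> U) + card B"
      unfolding B_def using finY(1) card_Int_Diff by blast
    then have B: "card Y < 2 * card B" using neg by linarith
    define H where "H = h ` {..<m}"
    have cH: "card H \<le> m0" "finite H"
      using card_image_le[of "{..<m}" h] bound'[OF fam] unfolding H_def by auto
    \<comment> \<open>Double counting between the uncovered \<open>B\<close> and
      \<open>Y - H\<close>: each vertex of \<open>B\<close> has at least \<open>2 * t\<close>
      neighbours there, and \<open>card Y < 2 * card B\<close>. Old hubs are excluded to keep
      \<open>h\<close> injective, but the new hub may lie in an existing cluster.\<close>
    have "\<exists>v\<in>Y - H. t \<le> card {b \<in> B. {v, b} \<in> G}"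
    proof (rule ccontr)
      assume "\<not> ?thesis"
      then have few: "card {b \<in> B. {v, b} \<in> G} \<le> t" if "v \<in> Y - H" for v
        using that by (meson nat_le_linear)
      have "card B * (2 * t) = (\<Sum>b\<in>B. 2 * t)" by simp
      also have "\<dots> \<le> (\<Sum>b\<in>B. card {v \<in> Y - H. {b, v} \<in> G})"
      proof (rule sum_mono)
        fix b assume b: "b \<in> B"
        have "d \<le> card D + m0 + card {v \<in> Y - H. {b, v} \<in> G}"
          by (rule inner_degree[OF Y, where A = H]) (use b cH finY in \<open>auto simp: B_def\<close>)
        then show "2 * t \<le> card {v \<in> Y - H. {b, v} \<in> G}" using t by linarith
      qed
      also have "\<dots> = (\<Sum>b\<in>B. \<Sum>v\<in>Y - H. of_bool ({b, v} \<in> G))"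
      proof (rule sum.cong[OF refl])
        fix b
        show "card {v \<in> Y - H. {b, v} \<in> G} = (\<Sum>v\<in>Y - H. of_bool ({b, v} \<in> G))"
          using finY by (subst sum_of_bool_eq) (auto simp: Int_def)
      qed
      also have "\<dots> = (\<Sum>v\<in>Y - H. \<Sum>b\<in>B. of_bool ({b, v} \<in> G))" by (rule sum.swap)
      also have "\<dots> = (\<Sum>v\<in>Y - H. card {b \<in> B. {v, b} \<in> G})"
      proof (rule sum.cong[OF refl])
        fix v
        show "(\<Sum>b\<in>B. of_bool ({b, v} \<in> G)) = card {b \<in> B. {v, b} \<in> G}"
          using finY by (subst sum_of_bool_eq) (auto simp: Int_def insert_commute)
      qed
      also have "\<dots> \<le> (\<Sum>v\<in>Y - H. t)" using few by (intro sum_mono)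
      also have "\<dots> = card (Y - H) * t" by simp
      also have "\<dots> \<le> card Y * t" using finY by (intro mult_right_mono card_mono) auto
      also have "\<dots> < 2 * card B * t" using B t(1) by simp
      finally show False by simp
    qed
    then obtain v where v: "v \<in> Y - H" "t \<le> card {b \<in> B. {v, b} \<in> G}" by blast
    obtain T where T: "T \<subseteq> {b \<in> B. {v, b} \<in> G}" "card T = t"
      using obtain_subset_with_card_n[OF v(2)] by blast
    define h' N' where "h' = h(m := v)" and "N' = N(m := T)"
    have TU: "T \<inter> U = {}" "T \<subseteq> Y" "\<forall>x\<in>T. {x, v} \<in> G" using T(1) unfolding B_def by (force simp: insert_commute)+
    have "fam (Suc m, h', N')"
      unfolding fam_def
    proof (clarify, intro conjI)
      show "inj_on h' {..<Suc m}"
        using f(1) v(1) unfolding h'_def H_def lessThan_Suc by (auto simp: inj_on_def)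
      show "disjoint_family_on N' {..<Suc m}"
        using f(2) TU(1) unfolding N'_def U_def lessThan_Suc disjoint_family_on_def by auto
      show "\<forall>i<Suc m. \<exists>Y\<in>PP. h' i \<in> Y \<and> N' i \<subseteq> Y \<and> (\<forall>x\<in>N' i. {x, h' i} \<in> G) \<and> card (N' i) = t"
      proof (intro allI impI)
        fix i assume "i < Suc m"
        then consider "i < m" | "i = m" by linarith
        then show "\<exists>Y\<in>PP. h' i \<in> Y \<and> N' i \<subseteq> Y \<and> (\<forall>x\<in>N' i. {x, h' i} \<in> G) \<and> card (N' i) = t"
        proof cases
          case 1 then show ?thesis using f(3)[of i] unfolding h'_def N'_def by simp
        next
          case 2 then show ?thesis using Y v(1) TU T(2) unfolding h'_def N'_def by auto
        qed
      qed
    qed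
    then show False using m(2)[of "Suc m"] unfolding ex_def by fastforce
  qed
  have "n - card D = card (\<Union>PP)" unfolding cover using Dn finD by (subst card_Diff_subset) auto
  also have "\<dots> = (\<Sum>Y\<in>PP. card Y)"
    using PP_fin disjPP by (intro card_Union_disjoint) (auto simp: pairwise_def disjnt_def)
  also have "\<dots> \<le> (\<Sum>Y\<in>PP. 2 * card (Y \<inter> U))" using half by (intro sum_mono)
  also have "\<dots> = 2 * card (\<Union>Y\<in>PP. Y \<inter> U)"
    using finite_PP finU disjPP by (subst card_UN_disjoint) (auto simp: sum_distrib_left)
  also have "card (\<Union>Y\<in>PP. Y \<inter> U) \<le> card U" using finU by (intro card_mono) auto
  also have "card U = m * t" using NU[OF fam] unfolding U_def by blast
  finally have total: "n \<le> card D + 2 * (m * t)" by linarith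
  have each: "\<exists>i<m. N i \<subseteq> Y \<and> h i \<in> Y" if Y: "Y \<in> PP" for Y
  proof -
    have "Y \<noteq> {}" using ne Y by blast
    then have "0 < card Y" using PP_fin[OF Y] by (simp add: card_gt_0_iff)
    then have "Y \<inter> U \<noteq> {}" using half[OF Y] by (metis card.empty less_le_not_le mult_0_right)
    then obtain i x where i: "i < m" "x \<in> N i" "x \<in> Y" unfolding U_def by blast
    obtain Y' where Y': "Y' \<in> PP" "h i \<in> Y'" "N i \<subseteq> Y'" using f(3)[OF i(1)] by blast
    then have "Y' = Y" using disjPP[OF Y'(1) Y] i by blast
    then show ?thesis using i Y' by blast
  qed
  show thesis using that[OF f(1,2) bound[OF fam] f(3) total each] by blast
qed

end

section \<open>Hubs and clusters\<close>

lemma successively_concat_triples: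
  assumes "\<And>k. k \<in> set ks \<Longrightarrow> adj (a k) (b k) \<and> adj (b k) (c k)"
    and "successively (\<lambda>i j. adj (c i) (a j)) ks"
  shows "successively adj (concat (map (\<lambda>k. [a k, b k, c k]) ks))"
  using assms
proof (induction ks rule: induct_list012)
  case (3 x y zs)
  then have "successively adj (concat (map (\<lambda>k. [a k, b k, c k]) (y # zs)))" by auto
  then show ?case using 3(3,4) by auto
qed auto

lemma adjacent_in_concat:
  assumes "g \<in> set gs" "adjacent_in g a b"
  shows "adjacent_in (concat gs) a b"
  using assms by (induction gs) (auto simp: adjacent_in_append)

text \<open>Cluster number k of the cycle is traversed as \<open>x k\<close>, hub,
  \<open>y k\<close>, where a random edge arrives at \<open>x k\<close> and another one leaves from
  \<open>y k\<close>. Hubs lie in no cluster, so the triples of different clusters do not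
  overlap.\<close>

lemma cycle_from_cluster_cycle:
  assumes R: "matching R"
    and cyc: "is_cycle (cluster_adj N R) xs" "set xs = {..<m}"
    and disj: "disjoint_family_on N {..<m}" and inj: "inj_on h {..<m}"
    and hN: "\<And>i j. i < m \<Longrightarrow> j < m \<Longrightarrow> h i \<notin> N j"
    and hG: "\<And>i x. i < m \<Longrightarrow> x \<in> N i \<Longrightarrow> {x, h i} \<in> G"
  obtains C where "is_cycle (edge (G \<union> R)) C" "length C = 3 * m" "set C \<subseteq> (\<Union>i<m. insert (h i) (N i))"
    "\<And>i. i < m \<Longrightarrow> \<exists>x\<in>N i. \<exists>y\<in>N i. x \<noteq> y \<and> {x, h i} \<in> cycle_edges C \<and> {h i, y} \<in> cycle_edges C"
proof -
  have dx: "distinct xs" "3 \<le> length xs" "successively (cluster_adj N R) xs" "cluster_adj N R (last xs) (hd xs)"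
    using cyc(1) unfolding is_cycle_def by auto
  have len: "length xs = m" using cyc(2) dx(1) distinct_card by fastforce
  have m3: "3 \<le> m" using dx(2) len by simp
  define nx where "nx k = Suc k mod m" for k
  have xm: "xs ! k < m" if "k < m" for k using cyc(2) len that nth_mem by fastforce
  have inj_xs: "k = l" if "k < m" "l < m" "xs ! k = xs ! l" for k l
    using dx(1) len that nth_eq_iff_index_eq by metis
  have nx: "nx k < m" for k
    using m3 unfolding nx_def by simp
  have adj: "cluster_adj N R (xs ! k) (xs ! nx k)" if "k < m" for k
  proof (cases "Suc k = m")
    case True
    have "xs \<noteq> []" using dx(2) by auto
    then have "last xs = xs ! k" "hd xs = xs ! nx k"
      using True len unfolding nx_def by (auto simp: last_conv_nth hd_conv_nth)
    then show ?thesis using dx(4) by simp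
  next
    case False
    then show ?thesis using successively_nth[OF dx(3), of k] that len unfolding nx_def by simp
  qed
  have "\<exists>y z. k < m \<longrightarrow> y \<in> N (xs ! k) \<and> z \<in> N (xs ! nx k) \<and> {y, z} \<in> R" for k
    using adj unfolding cluster_adj_def by blast
  then obtain y z where yz: "\<And>k. k < m \<Longrightarrow> y k \<in> N (xs ! k) \<and> z k \<in> N (xs ! nx k) \<and> {y k, z k} \<in> R"
    by metis
  \<comment> \<open>Cyclic predecessor, wrapping from 0 to \<open>m - 1\<close>. It differs from the
    cyclic successor because there are at least three clusters.\<close>
  define pv where "pv k = (if k = 0 then m - 1 else k - 1)" for k
  have pv: "pv k < m" "nx (pv k) = k" if "k < m" for k using that m3 unfolding pv_def nx_def by auto
  have pvnx: "pv k \<noteq> nx k" if "k < m" for k using that m3 unfolding pv_def nx_def by (auto simp: mod_Suc)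
  define x where "x k = z (pv k)" for k
  have xN: "x k \<in> N (xs ! k)" if "k < m" for k using yz[of "pv k"] pv[OF that] unfolding x_def by auto
  have Ndisj: "k = l" if "k < m" "l < m" "c \<in> N (xs ! k)" "c \<in> N (xs ! l)" for k l c
  proof (rule inj_xs[OF that(1,2)])
    show "xs ! k = xs ! l"
      using disj xm[OF that(1)] xm[OF that(2)] that(3,4) unfolding disjoint_family_on_def by blast
  qed
  have xy: "x k \<noteq> y k" if k: "k < m" for k
  proof
    assume eq: "x k = y k"
    have e1: "{y k, z k} \<in> R" "z k \<in> N (xs ! nx k)" using yz[OF k] by auto
    have e2: "{y (pv k), y k} \<in> R" "y (pv k) \<in> N (xs ! pv k)"
      using yz[OF pv(1)[OF k]] eq unfolding x_def by auto
    \<comment> \<open>The other ends of the two random edges lie in the next and the previous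
      cluster, which are different. So these would be two edges of a matching with a common
      vertex.\<close>
    have "{y k, z k} \<noteq> {y (pv k), y k}"
    proof
      assume "{y k, z k} = {y (pv k), y k}"
      then have "z k = y (pv k)" by (auto simp: doubleton_eq_iff)
      then have "nx k = pv k" using Ndisj[of "nx k" "pv k" "z k"] nx e1 e2 pv[OF k] by auto
      then show False using pvnx[OF k] by simp
    qed
    then have "{y k, z k} \<inter> {y (pv k), y k} = {}" using R e1(1) e2(1) unfolding matching_def by fast
    then show False by simp
  qed
  define g where "g k = [x k, h (xs ! k), y k]" for k
  define C where "C = concat (map g [0..<m])"
  have gset: "set (g k) = {x k, h (xs ! k), y k}" for k unfolding g_def by simp
  have gsub: "set (g k) \<subseteq> insert (h (xs ! k)) (N (xs ! k))" if "k < m" for k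
    using xN[OF that] yz[OF that] unfolding gset by simp
  have gdisj: "set (g k) \<inter> set (g l) = {}" if kl: "k < m" "l < m" "k \<noteq> l" for k l
  proof -
    have "xs ! k \<noteq> xs ! l" using inj_xs[OF kl(1,2)] kl(3) by blast
    then have "h (xs ! k) \<noteq> h (xs ! l)"
      using inj_onD[OF inj, of "xs ! k" "xs ! l"] xm[OF kl(1)] xm[OF kl(2)] by blast
    moreover have "N (xs ! k) \<inter> N (xs ! l) = {}" using Ndisj[OF kl(1,2)] kl(3) by blast
    moreover have "h (xs ! k) \<notin> N (xs ! l)" "h (xs ! l) \<notin> N (xs ! k)" using hN xm kl by auto
    ultimately have "insert (h (xs ! k)) (N (xs ! k)) \<inter> insert (h (xs ! l)) (N (xs ! l)) = {}" by simp
    then show ?thesis using gsub[OF kl(1)] gsub[OF kl(2)] by blast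
  qed
  have gd: "distinct (g k)" if "k < m" for k
  proof -
    have "h (xs ! k) \<notin> N (xs ! k)" by (rule hN[OF xm[OF that] xm[OF that]])
    then show ?thesis using xy[OF that] xN[OF that] yz[OF that] unfolding g_def by auto
  qed
  have "distinct C"
    unfolding C_def
  proof (rule distinct_concat)
    show "distinct (map g [0..<m])"
      unfolding distinct_map
    proof
      show "inj_on g (set [0..<m])"
      proof (rule inj_onI, rule ccontr)
        fix k l assume "k \<in> set [0..<m]" "l \<in> set [0..<m]" "g k = g l" "k \<noteq> l"
        then show False using gdisj[of k l] gset[of l] by auto
      qed
    qed simp
    show "distinct ys" if "ys \<in> set (map g [0..<m])" for ys using that gd by auto
    show "set ys \<inter> set zs = {}" if yz: "ys \<in> set (map g [0..<m])" "zs \<in> set (map g [0..<m])" "ys \<noteq> zs" for ys zs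
    proof -
      obtain k l where "k < m" "l < m" "ys = g k" "zs = g l" using yz(1,2) by auto
      then show ?thesis using gdisj[of k l] yz(3) by metis
    qed
  qed
  have lenC: "length C = 3 * m"
  proof -
    have "length C = (\<Sum>k\<leftarrow>[0..<m]. length (g k))" unfolding C_def by (simp add: length_concat o_def)
    also have "\<dots> = 3 * m" unfolding g_def by (simp add: sum_list_triv)
    finally show ?thesis .
  qed
  have E: "edge (G \<union> R) (x k) (h (xs ! k)) \<and> edge (G \<union> R) (h (xs ! k)) (y k)" if "k < m" for k
    using hG[OF xm[OF that]] xN[OF that] yz[OF that] by (auto simp: insert_commute)
  have "successively (edge (G \<union> R)) C"
    unfolding C_def g_def
  proof (rule successively_concat_triples)
    show "successively (\<lambda>i j. edge (G \<union> R) (y i) (x j)) [0..<m]"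
      unfolding successively_conv_nth using yz by (auto simp: x_def pv_def)
  qed (use E in auto)
  moreover have "hd C = x 0" "last C = y (m - 1)"
  proof -
    obtain m' where "m = Suc m'" using m3 by (cases m) auto
    then show "last C = y (m - 1)" unfolding C_def g_def by simp
    have "[0..<m] = 0 # [1..<m]" using m3 by (simp add: upt_conv_Cons)
    then show "hd C = x 0" unfolding C_def g_def by simp
  qed
  moreover have "{y (m - 1), x 0} \<in> R" using yz[of "m - 1"] m3 unfolding x_def pv_def by simp
  ultimately have cycC: "is_cycle (edge (G \<union> R)) C"
    unfolding is_cycle_def using \<open>distinct C\<close> lenC m3 by auto
  have setC: "set C \<subseteq> (\<Union>i<m. insert (h i) (N i))"
  proof
    fix c assume "c \<in> set C"
    then obtain k where k: "k < m" "c \<in> {x k, h (xs ! k), y k}" unfolding C_def using gset by auto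
    then have "c \<in> insert (h (xs ! k)) (N (xs ! k))" using xN[OF k(1)] yz[OF k(1)] by auto
    then show "c \<in> (\<Union>i<m. insert (h i) (N i))" using xm[OF k(1)] by blast
  qed
  have pass: "\<exists>a\<in>N i. \<exists>b\<in>N i. a \<noteq> b \<and> {a, h i} \<in> cycle_edges C \<and> {h i, b} \<in> cycle_edges C" if i: "i < m" for i
  proof -
    obtain k where k: "k < m" "xs ! k = i" using i cyc(2) len by (metis in_set_conv_nth lessThan_iff)
    have gk: "g k \<in> set (map g [0..<m])" using k by auto
    have "adjacent_in C (x k) (h i)" "adjacent_in C (h i) (y k)"
      unfolding C_def by (rule adjacent_in_concat[OF gk], simp add: g_def k adjacent_in_Cons)+
    then have "{x k, h i} \<in> cycle_edges C" "{h i, y k} \<in> cycle_edges C"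
      unfolding cycle_edges_def path_edges_def by blast+
    then show ?thesis using xN[OF k(1)] yz[OF k(1)] xy[OF k(1)] k(2) by blast
  qed
  show thesis by (rule that[OF cycC lenC setC pass])
qed

text \<open>The constants below are chosen generously; only the orders of magnitude
  \<open>\<kappa> \<approx> d\<^sup>2 / n\<close>, \<open>L \<approx> n / d\<close> and \<open>s \<approx> d\<close> matter.\<close>

theorem ex_clusters_pancyclic:
  fixes n d s L \<alpha> \<kappa> M :: nat
  assumes G: "is_graph n G" and n: "0 < n"
    and deg: "\<And>v. v < n \<Longrightarrow> d \<le> card {u. u < n \<and> {u, v} \<in> G}"
    and indep: "\<And>U. U \<subseteq> {..<n} \<Longrightarrow> \<alpha> < card U \<Longrightarrow> \<exists>x\<in>U. \<exists>y\<in>U. {x, y} \<in> G"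
    and M: "1 \<le> M" "2 * (M * \<kappa>) \<le> d" "2 * n < M * d"
    and s: "1 \<le> s" "16 * s \<le> d" "n < 2 * s * s"
    and a0: "a0 = \<alpha> + 2 * M" and m0: "n \<le> 2 * s * m0"
    and q: "1 \<le> q" "4 * q \<le> d" "16 * a0 \<le> d" "16 * (L + 3 * m0) \<le> d"
    and J: "3 * n < Suc J * q" "1 \<le> J" "3 * m0 + J \<le> L"
    and k: "L + a0 + 3 * m0 < \<kappa>" and long: "8 * (\<alpha> * L) \<le> d"
  obtains m N where "clusters n m s N" "m \<le> m0" "n \<le> 8 * (m * s)"
    "\<And>R. R \<subseteq> all_pairs n \<Longrightarrow> matching R \<Longrightarrow>
       (\<exists>xs. is_cycle (cluster_adj N R) xs \<and> set xs = {..<m}) \<Longrightarrow> pancyclic n (G \<union> R)"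
proof -
  obtain D PP where dec: "decomposition n G \<kappa> D PP" "card PP < M" "2 * card D \<le> d" "PP \<noteq> {}"
    and conn: "\<And>Y S X. Y \<in> PP \<Longrightarrow> S \<subseteq> Y \<Longrightarrow> card S < \<kappa> \<Longrightarrow> X \<subseteq> Y - S \<Longrightarrow> X \<noteq> {} \<Longrightarrow> X \<noteq> Y - S \<Longrightarrow>
         \<exists>x\<in>X. \<exists>y\<in>Y - S - X. {x, y} \<in> G"
    by (rule ex_decomposition[OF n M deg]) (assumption | rule that)+
  have dg: "decomposed_graph n d \<kappa> \<alpha> G E D PP" if "is_graph n E" "G \<subseteq> E" for E
  proof
    show "D \<subseteq> {..<n}" "\<Union>PP = {..<n} - D" using dec(1) unfolding decomposition_def by blast+
    show "X \<inter> Y = {}" if "X \<in> PP" "Y \<in> PP" "X \<noteq> Y" for X Y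
      using dec(1) that unfolding decomposition_def by blast
    show "{x, y} \<notin> G" if "X \<in> PP" "Y \<in> PP" "X \<noteq> Y" "x \<in> X" "y \<in> Y" for X Y x y
      using dec(1) that unfolding decomposition_def by blast
  qed (fact that indep deg conn)+
  interpret G: decomposed_graph n d \<kappa> \<alpha> G G D PP by (rule dg[OF G order_refl])
  have "d \<le> n"
    using deg[OF n] card_mono[of "{..<n}" "{u. u < n \<and> {u, 0} \<in> G}"] by fastforce
  have ne: "{} \<notin> PP" using dec(1) unfolding decomposition_def by blast
  have ms: "m \<le> s \<and> m \<le> m0" if "m * (2 * s) \<le> n" for m
  proof
    have "m * (2 * s) < s * (2 * s)"
      by (rule le_less_trans[OF that]) (use s(3) in \<open>simp only: mult_ac\<close>)
    then show "m \<le> s" by (metis less_imp_le mult_less_cancel2)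
    have "m * (2 * s) \<le> m0 * (2 * s)"
      by (rule order_trans[OF that]) (use m0 in \<open>simp only: mult_ac\<close>)
    then show "m \<le> m0" using s(1) by simp
  qed
  have t1: "1 \<le> 2 * s" using s(1) by simp
  have t2: "2 * (2 * s) + s + card D \<le> d" using s(2) dec(3) by linarith
  have t3: "n < Suc s * (2 * s)" using s(3) by (simp add: mult_ac)
  obtain m h N where f: "inj_on h {..<m}" "disjoint_family_on N {..<m}" "m * (2 * s) \<le> n"
    "\<And>i. i < m \<Longrightarrow> \<exists>Y\<in>PP. h i \<in> Y \<and> N i \<subseteq> Y \<and> (\<forall>x\<in>N i. {x, h i} \<in> G) \<and> card (N i) = 2 * s"
    "n \<le> card D + 2 * (m * (2 * s))" "\<And>Y. Y \<in> PP \<Longrightarrow> \<exists>i<m. N i \<subseteq> Y \<and> h i \<in> Y"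
    by (rule G.ex_hub_families[OF t1 t2 t3 ne]) (assumption | rule that)+
  \<comment> \<open>A hub may lie in the family of another hub. Families are therefore built with
    \<open>2 * s\<close> vertices; there are at most \<open>s\<close> hubs, so \<open>s\<close>
    vertices remain after deleting all of them.\<close>
  have "\<exists>T\<subseteq>N i - h ` {..<m}. card T = s" if i: "i < m" for i
  proof -
    have "card (N i) = 2 * s" using f(4)[OF i] by blast
    moreover have "card (h ` {..<m}) \<le> s" using card_image_le[of "{..<m}" h] ms[OF f(3)] by simp
    ultimately have "s \<le> card (N i) - card (h ` {..<m})" by linarith
    also have "\<dots> \<le> card (N i - h ` {..<m})" by (rule diff_card_le_card_Diff) simp
    finally show ?thesis by (metis obtain_subset_with_card_n)
  qed
  then obtain T where T: "\<And>i. i < m \<Longrightarrow> T i \<subseteq> N i - h ` {..<m} \<and> card (T i) = s" by metis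
  have TY: "\<exists>Y\<in>PP. h i \<in> Y \<and> T i \<subseteq> Y \<and> (\<forall>x\<in>T i. {x, h i} \<in> G)" if i: "i < m" for i
  proof -
    obtain Y where "Y \<in> PP" "h i \<in> Y" "N i \<subseteq> Y" "\<forall>x\<in>N i. {x, h i} \<in> G" using f(4)[OF i] by blast
    moreover have "T i \<subseteq> N i" using T[OF i] by auto
    ultimately show ?thesis by (meson subset_trans subsetD)
  qed
  have Tdisj: "disjoint_family_on T {..<m}"
    unfolding disjoint_family_on_def
  proof (intro ballI impI)
    fix i j assume ij: "i \<in> {..<m}" "j \<in> {..<m}" "i \<noteq> j"
    then have "N i \<inter> N j = {}" using f(2) unfolding disjoint_family_on_def by blast
    moreover have "T i \<subseteq> N i" "T j \<subseteq> N j" using T[of i] T[of j] ij(1,2) by auto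
    ultimately show "T i \<inter> T j = {}" by blast
  qed
  have hn: "insert (h i) (T i) \<subseteq> {..<n}" if "i < m" for i
    using TY[OF that] G.PP_sub by blast
  have cl: "clusters n m s T"
    unfolding clusters_def using hn T Tdisj by auto
  have total: "n \<le> 8 * (m * s)" using f(5) dec(3) \<open>d \<le> n\<close> by (simp add: mult_ac)
  have mm: "m \<le> m0" using ms[OF f(3)] by simp
  have main: "pancyclic n (G \<union> R)"
    if R: "R \<subseteq> all_pairs n" "matching R" "\<exists>xs. is_cycle (cluster_adj T R) xs \<and> set xs = {..<m}" for R
  proof -
    have gr: "is_graph n (G \<union> R)" using G R(1) unfolding is_graph_def by blast
    interpret H: decomposed_graph n d \<kappa> \<alpha> G "G \<union> R" D PP by (rule dg[OF gr]) blast
    obtain xs where xs: "is_cycle (cluster_adj T R) xs" "set xs = {..<m}" using R(3) by blast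
    have hT: "h i \<notin> T j" if "i < m" "j < m" for i j using T[OF that(2)] that(1) by blast
    have hG: "{x, h i} \<in> G" if "i < m" "x \<in> T i" for i x using TY[OF that(1)] that(2) by blast
    obtain C where C: "is_cycle (edge (G \<union> R)) C" "length C = 3 * m" "set C \<subseteq> (\<Union>i<m. insert (h i) (T i))"
      "\<And>i. i < m \<Longrightarrow> \<exists>x\<in>T i. \<exists>y\<in>T i. x \<noteq> y \<and> {x, h i} \<in> cycle_edges C \<and> {h i, y} \<in> cycle_edges C"
      by (rule cycle_from_cluster_cycle[OF R(2) xs Tdisj f(1) hT hG]) (assumption | rule that)+
    \<comment> \<open>The exact number of parts enters here; \<open>card PP < M\<close> gives
      \<open>card PP + 1 \<le> M\<close> and thus \<open>a1 \<le> a0\<close>.\<close>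
    define a1 where "a1 = \<alpha> + 2 * (card PP + 1)"
    have a1: "a1 \<le> a0" unfolding a1_def a0 using dec(2) by simp
    show ?thesis
    proof (rule H.pancyclic_if_initial_cycle[OF C(1) _ _ _ dec(4) a1_def _ q(1) _ J _ _ _])
      show "set C \<subseteq> {..<n}" using C(3) hn by blast
      show "length C \<le> 3 * m0" using C(2) mm by simp
      show "\<exists>x v y. {x, v} \<in> cycle_edges C \<and> {v, y} \<in> cycle_edges C \<and> x \<noteq> y \<and> x \<in> Y \<and> v \<in> Y \<and> y \<in> Y"
        if Y: "Y \<in> PP" for Y
      proof -
        obtain i where i: "i < m" "N i \<subseteq> Y" "h i \<in> Y" using f(6)[OF Y] by blast
        obtain x y where "x \<in> T i" "y \<in> T i" "x \<noteq> y" "{x, h i} \<in> cycle_edges C" "{h i, y} \<in> cycle_edges C"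
          using C(4)[OF i(1)] by blast
        moreover have "T i \<subseteq> Y" using T[OF i(1)] i(2) by blast
        ultimately show ?thesis using i(3) by blast
      qed
      show "q + a1 + L + card D \<le> d" using a1 q dec(3) by simp
      show "q + 3 * m0 + L + card D \<le> d" using q dec(3) by simp
      show "L + a1 < \<kappa>" "3 * m0 + L < \<kappa>" using k a1 by auto
      show "\<alpha> * L + 3 * m0 + card D < d" using long q dec(3) by simp
    qed
  qed
  show thesis by (rule that[OF cl mm total main])
qed

section \<open>Pancyclicity of the perturbed graph\<close>

lemma div_bounds:
  fixes a b :: nat
  assumes "0 < b"
  shows "real (a div b) \<le> real a / real b" "real a / real b - 1 \<le> real (a div b)"
proof -
  have "real a = real b * real (a div b) + real (a mod b)"
    by (simp flip: of_nat_mult of_nat_add)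
  moreover have "0 \<le> real (a mod b)" "real (a mod b) \<le> real b" using assms by (auto intro: less_imp_le)
  ultimately show "real (a div b) \<le> real a / real b" "real a / real b - 1 \<le> real (a div b)"
    using assms by (auto simp: field_simps)
qed

text \<open>Two scales govern the choice of parameters: r = n/d and K = d^2/n. \<open>M\<close>,
  \<open>m0\<close>, \<open>J\<close> and \<open>L\<close> are of order r, while the connectivity
  \<open>k\<close> is of order K and the independence number is at most K/4000. The two error terms
  are the failure to be a matching and the absence of a Hamilton cycle of clusters.\<close>

lemma pancyclic_failure_bound:
  fixes \<delta> p :: real
  assumes G: "is_graph n G" and n: "0 < n" and p: "0 \<le> p" "p \<le> 1"
    and mindeg: "\<delta> * real n \<le> real (min_degree n G)"
    and \<delta>: "200 * real n powr (-1/3) \<le> \<delta>"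
    and \<alpha>: "real (independence_number n G) \<le> 1 / 4000 * \<delta>\<^sup>2 * real n"
  shows "1 - prob_union n G p (pancyclic n) \<le>
     real n ^ 3 * p\<^sup>2 + 3 * (129 / \<delta>) ^ 6 * exp (- p * \<delta> * (real n)\<^sup>2 / 40960)"
proof -
  define d where "d = nat \<lceil>\<delta> * real n\<rceil>"
  define r where "r = real n / real d"
  define a where "a = independence_number n G"
  have \<delta>0: "0 < \<delta>"
  proof -
    have "0 < 200 * real n powr (-1/3)" using n by simp
    then show ?thesis using \<delta> by linarith
  qed
  have dn: "\<delta> * real n \<le> real d" unfolding d_def by linarith
  have d0: "0 < d"
  proof -
    have "0 < \<delta> * real n" using \<delta>0 n by simp
    then have "0 < real d" using dn by linarith
    then show ?thesis by simp
  qed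
  have dmin: "d \<le> min_degree n G"
    using mindeg unfolding d_def by (metis ceiling_le_iff nat_le_iff of_int_of_nat_eq)
  have deg: "d \<le> card {u. u < n \<and> {u, v} \<in> G}" if "v < n" for v
  proof -
    have "min_degree n G \<le> degree n G v" unfolding min_degree_def using that by (intro Min_le) auto
    then show ?thesis using dmin unfolding degree_def by simp
  qed
  have "d \<le> n"
    using deg[OF n] card_mono[of "{..<n}" "{u. u < n \<and> {u, 0} \<in> G}"] by fastforce
  have r1: "1 \<le> r" using \<open>d \<le> n\<close> d0 unfolding r_def by simp
  have rd: "real n = r * real d" using d0 unfolding r_def by simp
  \<comment> \<open>8000000 is 200^3. In terms of r the inequality reads 8000000 r^2 \<le> d, or
    8000000 r \<le> K.\<close>
  have cube: "8000000 * (real n)\<^sup>2 \<le> real d ^ 3"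
  proof -
    have "(real n powr (-1/3)) ^ 3 = real n powr (-1/3 + (-1/3 + -1/3))"
      unfolding powr_add by (simp add: power3_eq_cube mult.assoc)
    also have "\<dots> = 1 / real n" using n by (simp add: powr_minus_divide)
    finally have "8000000 / real n = (200 * real n powr (-1/3)) ^ 3"
      unfolding power_mult_distrib by simp
    also have "\<dots> \<le> \<delta> ^ 3" using \<delta> by (intro power_mono) auto
    finally have "8000000 \<le> \<delta> ^ 3 * real n" using n by (simp add: field_simps)
    then have "8000000 * (real n)\<^sup>2 \<le> \<delta> ^ 3 * real n * (real n)\<^sup>2" by (intro mult_right_mono) auto
    also have "\<dots> = (\<delta> * real n) ^ 3" by (simp add: power_mult_distrib eval_nat_numeral)
    also have "\<dots> \<le> real d ^ 3" using dn \<delta>0 by (intro power_mono) auto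
    finally show ?thesis .
  qed
  have dr2: "8000000 * r * r \<le> real d"
  proof -
    have "8000000 * (r * r) * (real d)\<^sup>2 \<le> real d * (real d)\<^sup>2"
      using cube unfolding rd by (simp add: eval_nat_numeral mult_ac)
    then show ?thesis using d0 by simp
  qed
  have dr: "8000000 * r \<le> real d"
  proof -
    have "8000000 * r * 1 \<le> 8000000 * r * r" using r1 by (intro mult_left_mono) auto
    then show ?thesis using dr2 by simp
  qed
  have dbig: "8000000 \<le> real d" using dr r1 by linarith
  define K where "K = real d / r"
  have K: "8000000 * r \<le> K" "K \<le> real d" "K * r = real d"
    unfolding K_def using dr2 r1 d0 by (auto simp: field_simps)
  have aK: "real a \<le> K / 4000"
  proof -
    have "\<delta> \<le> real d / real n" using dn n by (simp add: field_simps)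
    then have "\<delta>\<^sup>2 * real n \<le> (real d / real n)\<^sup>2 * real n" using \<delta>0 by (intro mult_right_mono power_mono) auto
    also have "\<dots> = K" unfolding K_def r_def using n d0 by (simp add: power2_eq_square field_simps)
    finally show ?thesis using \<alpha> unfolding a_def by simp
  qed
  have indep: "\<exists>x\<in>U. \<exists>y\<in>U. {x, y} \<in> G" if U: "U \<subseteq> {..<n}" "a < card U" for U
  proof (rule ccontr)
    assume "\<not> ?thesis"
    then have "independent n G U" using U unfolding independent_def by blast
    moreover have "finite {S. independent n G S}"
      by (rule finite_subset[of _ "Pow {..<n}"]) (auto simp: independent_def)
    ultimately have "card U \<le> a" unfolding a_def independence_number_def by (intro Max_ge) auto
    then show False using U by simp
  qed
  define M where "M = 2 * n div d + 1"
  have M: "real M \<le> 3 * r"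
    using div_bounds(1)[OF d0, of "2 * n"] r1 unfolding M_def r_def by simp
  have M3: "2 * n < M * d" unfolding M_def using d0 by (simp add: dividend_less_div_times)
  \<comment> \<open>The largest connectivity for which the separators of \<open>M\<close> parts take
    at most d/2 vertices; it is about K/6 or more because M \<le> 3r.\<close>
  define k where "k = d div (2 * M)"
  have M2: "2 * (M * k) \<le> d"
    unfolding k_def using div_times_less_eq_dividend[of d "2 * M"] by (simp add: mult_ac)
  have k: "K / 6 - 1 \<le> real k"
  proof -
    have "real d / (6 * r) \<le> real d / (2 * real M)"
      using M r1 by (intro divide_left_mono) (auto simp: M_def)
    then show ?thesis using div_bounds(2)[of "2 * M" d] unfolding k_def K_def M_def by simp
  qed
  define s where "s = d div 128"
  have s: "real s \<le> real d / 128" "real d / 256 \<le> real s"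
    using div_bounds[of 128 d] dbig unfolding s_def by auto
  have s1: "1 \<le> s" using s(2) dbig by linarith
  have ns: "real n < 2 * real s * real s"
  proof -
    have "32768 * r < real d" using dr r1 by linarith
    then have "32768 * r * real d < real d * real d" using d0 by (intro mult_strict_right_mono) auto
    moreover have "(real d / 256) * (real d / 256) \<le> real s * real s" using s(2) by (intro mult_mono) auto
    ultimately show ?thesis unfolding rd by simp
  qed
  define m0 where "m0 = n div (2 * s) + 1"
  have m0: "n \<le> 2 * s * m0"
  proof -
    have "n < 2 * s * (n div (2 * s)) + 2 * s"
      using dividend_less_times_div[of "2 * s" n] s1 by linarith
    then show ?thesis unfolding m0_def by (simp add: algebra_simps)
  qed
  have m0r: "real m0 \<le> 129 * r"
  proof -
    have "real (n div (2 * s)) \<le> real n / real (2 * s)" by (rule div_bounds) (use s1 in simp)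
    also have "\<dots> \<le> real n / (real d / 128)"
      using s d0 by (intro divide_left_mono) auto
    also have "\<dots> = 128 * r" unfolding r_def by simp
    finally show ?thesis using r1 unfolding m0_def by simp
  qed
  define q where "q = d div 4"
  have q: "real d / 8 \<le> real q" "4 * q \<le> d" using div_bounds[of 4 d] dbig unfolding q_def by auto
  have q1: "1 \<le> q" using q(1) dbig by linarith
  define J where "J = 3 * n div q"
  have J: "3 * n < Suc J * q" unfolding J_def using q1 by (simp add: dividend_less_div_times)
  have Jr: "real J \<le> 24 * r"
  proof -
    have "real J \<le> real (3 * n) / real q" unfolding J_def by (rule div_bounds) (use q1 in simp)
    also have "\<dots> \<le> real (3 * n) / (real d / 8)" using q d0 by (intro divide_left_mono) auto
    finally show ?thesis unfolding r_def by simp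
  qed
  have J1: "1 \<le> J"
  proof -
    have "q \<le> 3 * n" using q(2) \<open>d \<le> n\<close> by linarith
    then show ?thesis unfolding J_def using q1 by (simp add: div_greater_zero_iff Suc_le_eq)
  qed
  define L where "L = 3 * m0 + J"
  have L: "real L \<le> 411 * r" unfolding L_def using m0r Jr by simp
  define a0 where "a0 = a + 2 * M"
  have a0: "real a0 \<le> K / 4000 + 6 * r" unfolding a0_def using aK M by simp
  have c1: "16 * s \<le> d" using s(1) by linarith
  have c2: "n < 2 * s * s" using ns by (metis (mono_tags, opaque_lifting) of_nat_less_iff of_nat_mult of_nat_numeral)
  have c3: "16 * a0 \<le> d" using a0 K dr r1 by linarith
  have c4: "16 * (L + 3 * m0) \<le> d"
  proof -
    have "16 * real L + 48 * real m0 \<le> real d" using L m0r dr r1 by linarith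
    then show ?thesis by simp
  qed
  have c5: "3 * m0 + J \<le> L" unfolding L_def by simp
  have c6: "L + a0 + 3 * m0 < k"
  proof -
    have "real L + real a0 + 3 * real m0 < real k" using L a0 m0r k K r1 by linarith
    then show ?thesis by linarith
  qed
  \<comment> \<open>This comparison dictates the constant 1/4000: 8 * 411 < 4000, where 411 = 3 *
    129 + 24 collects the bounds on \<open>m0\<close> and \<open>J\<close>.\<close>
  have c7: "8 * (a * L) \<le> d"
  proof -
    have "real a * real L \<le> (K / 4000) * (411 * r)" using aK L K r1 by (intro mult_mono) auto
    also have "\<dots> = (K * r) * (411 / 4000)" by simp
    also have "\<dots> = real d * (411 / 4000)" using K(3) by simp
    finally have "8 * (real a * real L) \<le> real d" by simp
    then show ?thesis by (metis (mono_tags, opaque_lifting) of_nat_le_iff of_nat_mult of_nat_numeral)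
  qed
  obtain m N where N: "clusters n m s N" "m \<le> m0" "n \<le> 8 * (m * s)"
    and pan: "\<And>R. R \<subseteq> all_pairs n \<Longrightarrow> matching R \<Longrightarrow>
       (\<exists>xs. is_cycle (cluster_adj N R) xs \<and> set xs = {..<m}) \<Longrightarrow> pancyclic n (G \<union> R)"
    by (rule ex_clusters_pancyclic[OF G n deg indep _ M2 M3 s1 c1 c2 a0_def m0 q1 q(2) c3 c4 J J1 c5 c6 c7])
      (assumption | rule that | simp add: M_def)+
  \<comment> \<open>The choice of d/128 for \<open>s\<close> forces many clusters, as s \<le> n/128
    and n \<le> 8ms. The Hamiltonicity bound asks for at least ten.\<close>
  have m16: "16 \<le> m"
  proof -
    have "real n \<le> 8 * (real m * real s)" using N(3) by (metis (mono_tags, opaque_lifting) of_nat_le_iff of_nat_mult of_nat_numeral)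
    also have "\<dots> \<le> 8 * (real m * (real n / 128))"
      using s(1) \<open>d \<le> n\<close> by (intro mult_left_mono) auto
    finally show ?thesis using n by simp
  qed
  interpret clusters n m s N by (rule N(1))
  have "1 - prob_union n G p (pancyclic n) = random_prob p (all_pairs n) (\<lambda>R. \<not> pancyclic n (G \<union> R))"
    unfolding prob_union_eq_random_prob by (simp add: random_prob_compl)
  also have "\<dots> \<le> random_prob p (all_pairs n) (\<lambda>R. \<not> matching R \<or>
      \<not> (\<exists>xs. is_cycle (cluster_adj N R) xs \<and> set xs = {..<m}))"
    by (rule random_prob_mono[OF p]) (use pan in blast)
  also have "\<dots> \<le> random_prob p (all_pairs n) (\<lambda>R. \<not> matching R) + random_prob p (all_pairs n) (\<lambda>R.
      \<not> (\<exists>xs. is_cycle (cluster_adj N R) xs \<and> set xs = {..<m}))"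
    by (rule random_prob_disj_le[OF p])
  also have "\<dots> \<le> real n ^ 3 * p\<^sup>2 + 3 * real m ^ 6 * (1 - p) ^ (s\<^sup>2 * (m div 10))"
    using m16 by (intro add_mono random_prob_not_matching random_prob_no_cluster_cycle p) auto
  also have "3 * real m ^ 6 * (1 - p) ^ (s\<^sup>2 * (m div 10)) \<le>
      3 * (129 / \<delta>) ^ 6 * exp (- p * \<delta> * (real n)\<^sup>2 / 40960)"
  proof (intro mult_mono power_mono order_refl)
    have "r \<le> 1 / \<delta>" unfolding r_def using dn \<delta>0 d0 by (simp add: field_simps)
    then show "real m \<le> 129 / \<delta>" using N(2) m0r by simp
    \<comment> \<open>40960 = 256 * 8 * 20, from s \<ge> d/256, ms \<ge> n/8 and m div 10 \<ge>
      m/20.\<close>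
    have e: "\<delta> * (real n)\<^sup>2 / 40960 \<le> real (s\<^sup>2 * (m div 10))"
    proof -
      have "1 \<le> m div 10" using m16 by (simp add: Suc_le_eq div_greater_zero_iff)
      then have "m \<le> 20 * (m div 10)" using dividend_less_times_div[of 10 m] by linarith
      then have md: "real m / 20 \<le> real (m div 10)" by linarith
      have "\<delta> * (real n)\<^sup>2 / 40960 = (\<delta> * real n / 256) * (real n / 8) / 20" by (simp add: power2_eq_square)
      also have "\<dots> \<le> (real d / 256) * (real m * real s) / 20"
      proof (intro divide_right_mono mult_mono)
        show "real n / 8 \<le> real m * real s" using N(3) by (simp flip: of_nat_mult)
      qed (use dn \<delta>0 in auto)
      also have "\<dots> \<le> real s * (real m * real s) / 20"
        using s(2) by (intro divide_right_mono mult_right_mono) auto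
      also have "\<dots> = (real s)\<^sup>2 * (real m / 20)" by (simp add: power2_eq_square)
      also have "\<dots> \<le> (real s)\<^sup>2 * real (m div 10)" using md by (intro mult_left_mono) auto
      finally show ?thesis by simp
    qed
    have "(1 - p) ^ (s\<^sup>2 * (m div 10)) \<le> exp (- p) ^ (s\<^sup>2 * (m div 10))"
      using p exp_ge_add_one_self[of "-p"] by (intro power_mono) auto
    also have "\<dots> = exp (- (p * real (s\<^sup>2 * (m div 10))))"
      by (simp add: exp_of_nat_mult[symmetric] mult.commute)
    also have "\<dots> \<le> exp (- (p * (\<delta> * (real n)\<^sup>2 / 40960)))"
      using mult_left_mono[OF e p(1)] by simp
    finally show "(1 - p) ^ (s\<^sup>2 * (m div 10)) \<le> exp (- p * \<delta> * (real n)\<^sup>2 / 40960)" by (simp add: mult_ac)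
  qed (use p \<delta>0 in auto)
  finally show ?thesis by simp
qed

section \<open>Passage to the limit in part (a)\<close>

lemma pancyclic_mono:
  assumes "E \<subseteq> E'" "pancyclic n E"
  shows "pancyclic n E'"
  using assms unfolding pancyclic_def has_cycle_def by (meson subsetD)

text \<open>Everything reduces to \<open>X\<close> tending to infinity and dominating
  ln(1/\<delta>): the exponential factor then absorbs the power of 1/\<delta> and still
  vanishes.\<close>

theorem aas_pancyclic:
  fixes G :: "nat \<Rightarrow> nat set set" and \<delta> p :: "nat \<Rightarrow> real"
  assumes G: "\<forall>n. is_graph n (G n)" and p: "\<forall>n. 0 \<le> p n \<and> p n \<le> 1"
    and mindeg: "\<forall>\<^sub>F n in sequentially. real (min_degree n (G n)) \<ge> \<delta> n * real n"
    and \<delta>: "\<forall>\<^sub>F n in sequentially. \<delta> n \<ge> 200 * real n powr (-1/3)"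
    and \<alpha>: "\<forall>\<^sub>F n in sequentially. real (independence_number n (G n)) \<le> 1 / 4000 * \<delta> n ^ 2 * real n"
    and p1: "p \<in> \<omega>(\<lambda>n. real n powr (-2))"
    and p2: "\<forall>\<^sub>F n in sequentially. p n \<ge> 286720 * ln (1 / \<delta> n) / (\<delta> n * real n ^ 2)"
  shows "(\<lambda>n. prob_union n (G n) (p n) (pancyclic n)) \<longlonglongrightarrow> 1"
proof -
  define c :: real where "c = 286720"
  \<comment> \<open>Lowering \<open>p\<close> to at most \<open>n\<^sup>-\<^sup>8\<^sup>/\<^sup>5\<close> makes the random edges a matching a.a.s.\<close>
  define p' where "p' n = min (p n) (real n powr (-8/5))" for n
  define X where "X n = p' n * \<delta> n * (real n)\<^sup>2" for n
  have p'01: "0 \<le> p' n" "p' n \<le> 1" "p' n \<le> p n" for n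
    using p unfolding p'_def by (auto simp: min_le_iff_disj)
  have pos: "\<forall>\<^sub>F n in sequentially. 0 < \<delta> n \<and> \<delta> n \<le> 1 \<and> ln (1 / \<delta> n) \<le> ln (real n)"
    using mindeg \<delta> eventually_gt_at_top[of 0]
  proof eventually_elim
    case (elim n)
    have n1: "1 \<le> real n" using elim by simp
    have "min_degree n (G n) \<le> n"
    proof -
      have "min_degree n (G n) \<le> degree n (G n) 0" unfolding min_degree_def using elim by (intro Min_le) auto
      also have "\<dots> \<le> card {..<n}" unfolding degree_def by (intro card_mono) auto
      finally show ?thesis by simp
    qed
    then have "\<delta> n * real n \<le> real n" using elim by linarith
    then have "\<delta> n \<le> 1" using n1 by simp
    have "real n powr (-1) \<le> real n powr (-1/3)" using n1 by (intro powr_mono) auto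
    moreover have "0 < real n powr (-1)" using elim by simp
    ultimately have "real n powr (-1) \<le> \<delta> n" using elim by linarith
    then have ge: "1 / real n \<le> \<delta> n" using elim by (simp add: powr_minus_divide)
    then have "0 < \<delta> n" using elim(3) by (meson less_le_trans of_nat_0_less_iff zero_less_divide_1_iff)
    moreover have "ln (1 / \<delta> n) \<le> ln (real n)"
      using ge elim(3) \<open>0 < \<delta> n\<close> by (subst ln_le_cancel_iff) (auto simp: field_simps)
    ultimately show ?case using \<open>\<delta> n \<le> 1\<close> by auto
  qed
  \<comment> \<open>The cap respects the logarithmic lower bound too: \<delta> n^2 n^(-8/5) is at
    least 200 n^(1/15), which outgrows ln n and hence ln(1/\<delta>).\<close>
  have Xln: "\<forall>\<^sub>F n in sequentially. c * ln (1 / \<delta> n) \<le> X n"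
  proof -
    have "\<forall>\<^sub>F n in sequentially. c * ln (real n) \<le> 200 * real n powr (-1/3) * real n powr (-8/5) * (real n)\<^sup>2"
      unfolding c_def by real_asymp
    then show ?thesis
      using pos \<delta> p2 eventually_gt_at_top[of 0]
    proof eventually_elim
      case (elim n)
      have "c * ln (1 / \<delta> n) \<le> p n * \<delta> n * (real n)\<^sup>2"
        using elim unfolding c_def by (simp add: field_simps)
      moreover have "c * ln (1 / \<delta> n) \<le> real n powr (-8/5) * \<delta> n * (real n)\<^sup>2"
      proof -
        have "c * ln (1 / \<delta> n) \<le> c * ln (real n)" using elim unfolding c_def by simp
        also have "\<dots> \<le> 200 * real n powr (-1/3) * real n powr (-8/5) * (real n)\<^sup>2" using elim by blast
        also have "\<dots> \<le> \<delta> n * real n powr (-8/5) * (real n)\<^sup>2"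
          using elim by (intro mult_right_mono) auto
        finally show ?thesis by (simp add: mult_ac)
      qed
      ultimately show ?case unfolding X_def p'_def by (simp add: min_def)
    qed
  qed
  have Xtop: "filterlim X at_top sequentially"
    unfolding filterlim_at_top
  proof
    fix Z :: real
    define K where "K = max Z 1"
    define \<delta>0 where "\<delta>0 = exp (- K / c)"
    have K: "1 \<le> K" "Z \<le> K" and \<delta>0: "0 < \<delta>0" unfolding K_def \<delta>0_def by auto
    have "\<forall>\<^sub>F n in sequentially. K / \<delta>0 * norm (real n powr (-2)) \<le> norm (p n)"
      by (rule landau_omega.smallD[OF p1]) (use K \<delta>0 in auto)
    moreover have "\<forall>\<^sub>F n in sequentially. K / \<delta>0 * real n powr (-2) \<le> real n powr (-8/5)"
      by real_asymp
    ultimately show "\<forall>\<^sub>F n in sequentially. Z \<le> X n"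
      using Xln pos eventually_gt_at_top[of 0]
    proof eventually_elim
      case (elim n)
      show ?case
      \<comment> \<open>For small \<delta> the logarithmic condition makes \<open>X\<close> large;
        for \<delta> above the threshold, \<delta> costs only a constant factor and p =
        \<omega>(n^(-2)) suffices.\<close>
      proof (cases "\<delta> n \<le> \<delta>0")
        case True
        have "K / c \<le> ln (1 / \<delta> n)"
        proof -
          have "ln (\<delta> n) \<le> ln \<delta>0" using True elim \<delta>0 by simp
          then show ?thesis using elim unfolding \<delta>0_def by (simp add: ln_div)
        qed
        then have "K \<le> c * ln (1 / \<delta> n)" unfolding c_def by simp
        then show ?thesis using elim K by linarith
      next
        case False
        have "K / \<delta>0 * real n powr (-2) \<le> p' n"
          unfolding p'_def using elim p by simp
        then have "K / \<delta>0 * real n powr (-2) * \<delta>0 * (real n)\<^sup>2 \<le> p' n * \<delta> n * (real n)\<^sup>2"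
          using False \<delta>0 p'01 elim by (intro mult_right_mono mult_mono) auto
        moreover have "real n powr (-2) * (real n)\<^sup>2 = 1"
          using elim by (simp add: powr_minus_divide)
        moreover have "K / \<delta>0 * real n powr (-2) * \<delta>0 * (real n)\<^sup>2 = K * (real n powr (-2) * (real n)\<^sup>2)"
          using \<delta>0 by simp
        ultimately show ?thesis using K unfolding X_def by simp
      qed
    qed
  qed
  have lower: "\<forall>\<^sub>F n in sequentially. 1 - (real n ^ 3 * (real n powr (-8/5))\<^sup>2 + 3 * 129 ^ 6 * exp (- X n / 286720))
     \<le> prob_union n (G n) (p n) (pancyclic n)"
    using mindeg \<delta> \<alpha> pos Xln eventually_gt_at_top[of 0]
  proof eventually_elim
    case (elim n)
    have "1 - prob_union n (G n) (p' n) (pancyclic n) \<le>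
     real n ^ 3 * (p' n)\<^sup>2 + 3 * (129 / \<delta> n) ^ 6 * exp (- p' n * \<delta> n * (real n)\<^sup>2 / 40960)"
      using G elim p'01 by (intro pancyclic_failure_bound) auto
    also have "real n ^ 3 * (p' n)\<^sup>2 \<le> real n ^ 3 * (real n powr (-8/5))\<^sup>2"
      using p'01[of n] unfolding p'_def by (intro mult_left_mono power_mono) auto
    also have "3 * (129 / \<delta> n) ^ 6 * exp (- p' n * \<delta> n * (real n)\<^sup>2 / 40960) \<le> 3 * 129 ^ 6 * exp (- X n / 286720)"
    proof -
      \<comment> \<open>286720 = 7 * 40960: the factor \<delta>^(-6) consumes six sevenths of the
        exponent and one seventh is left.\<close>
      have "(1 / \<delta> n) ^ 6 = exp (6 * ln (1 / \<delta> n))"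
        using elim by (simp add: exp_of_nat_mult[of 6, simplified])
      also have "\<dots> \<le> exp (6 * (X n / 286720))"
        using elim unfolding c_def by simp
      finally have b: "(1 / \<delta> n) ^ 6 \<le> exp (6 * (X n / 286720))" .
      have "3 * (129 / \<delta> n) ^ 6 * exp (- p' n * \<delta> n * (real n)\<^sup>2 / 40960) =
         3 * 129 ^ 6 * ((1 / \<delta> n) ^ 6 * exp (- X n / 40960))"
        unfolding X_def by (simp add: power_divide)
      also have "\<dots> \<le> 3 * 129 ^ 6 * (exp (6 * (X n / 286720)) * exp (- X n / 40960))"
        using b by (intro mult_left_mono mult_right_mono) auto
      also have "exp (6 * (X n / 286720)) * exp (- X n / 40960) = exp (- X n / 286720)"
        by (simp flip: exp_add)
      finally show ?thesis .
    qed
    finally have "1 - (real n ^ 3 * (real n powr (-8/5))\<^sup>2 + 3 * 129 ^ 6 * exp (- X n / 286720))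
       \<le> prob_union n (G n) (p' n) (pancyclic n)" by simp
    also have "\<dots> \<le> prob_union n (G n) (p n) (pancyclic n)"
      unfolding prob_union_eq_random_prob
    proof (rule random_prob_mono_p)
      show "pancyclic n (G n \<union> S)" if "R \<subseteq> S" "pancyclic n (G n \<union> R)" for R S
        using that by (intro pancyclic_mono[of "G n \<union> R" "G n \<union> S"]) auto
    qed (use p p'01 in auto)
    finally show ?case .
  qed
  have "((\<lambda>x :: real. exp (- x / 286720)) \<longlongrightarrow> 0) at_top" by real_asymp
  then have "(\<lambda>n. exp (- X n / 286720)) \<longlonglongrightarrow> 0" using Xtop by (rule filterlim_compose)
  moreover have "(\<lambda>n. real n ^ 3 * (real n powr (-8/5))\<^sup>2) \<longlonglongrightarrow> 0" by real_asymp
  ultimately have "(\<lambda>n. 1 - (real n ^ 3 * (real n powr (-8/5))\<^sup>2 + 3 * 129 ^ 6 * exp (- X n / 286720)))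
     \<longlonglongrightarrow> 1 - (0 + 3 * 129 ^ 6 * 0)" by (intro tendsto_intros)
  then have lim: "(\<lambda>n. 1 - (real n ^ 3 * (real n powr (-8/5))\<^sup>2 + 3 * 129 ^ 6 * exp (- X n / 286720))) \<longlonglongrightarrow> 1"
    by simp
  show ?thesis
  proof (rule tendsto_sandwich[OF lower _ lim tendsto_const])
    show "\<forall>\<^sub>F n in sequentially. prob_union n (G n) (p n) (pancyclic n) \<le> 1"
      using p by (auto simp: prob_union_eq_random_prob intro!: always_eventually random_prob_le_1)
  qed
qed

section \<open>Disjoint unions of cliques\<close>

text \<open>Membership in \<open>U\<close> is constant along the vertex list of a Hamilton cycle,
  since no edge leaves \<open>U\<close>.\<close>

lemma not_hamiltonian_if_cut:
  assumes "U \<subseteq> {..<n}" "U \<noteq> {}" "U \<noteq> {..<n}"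
    and cut: "\<And>x y. x \<in> U \<Longrightarrow> y \<in> {..<n} - U \<Longrightarrow> {x, y} \<notin> E"
  shows "\<not> hamiltonian n E"
proof
  assume "hamiltonian n E"
  then obtain vs where vs: "length vs = n" "distinct vs" "set vs \<subseteq> {..<n}"
    "\<And>i. i < n \<Longrightarrow> {vs ! i, vs ! ((i + 1) mod n)} \<in> E"
    unfolding hamiltonian_def has_cycle_def by blast
  have sv: "set vs = {..<n}"
    using vs(1-3) by (intro card_subset_eq) (auto simp: distinct_card)
  have step: "vs ! Suc i \<in> U \<longleftrightarrow> vs ! i \<in> U" if "Suc i < n" for i
  proof -
    have "{vs ! i, vs ! Suc i} \<in> E" using vs(4)[of i] that by simp
    moreover have "vs ! i \<in> {..<n}" "vs ! Suc i \<in> {..<n}" using sv vs(1) that by (metis Suc_lessD nth_mem)+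
    ultimately show ?thesis using cut[of "vs ! i" "vs ! Suc i"] cut[of "vs ! Suc i" "vs ! i"]
      by (auto simp: insert_commute)
  qed
  have all: "vs ! i \<in> U \<longleftrightarrow> vs ! 0 \<in> U" if "i < n" for i
    using that by (induction i) (use step in auto)
  have "x \<in> U \<longleftrightarrow> vs ! 0 \<in> U" if "x < n" for x
    using all that sv vs(1) by (metis in_set_conv_nth lessThan_iff)
  then show False using assms(1-3) by (metis lessThan_iff subsetI subset_antisym subsetD all_not_in_conv)
qed

definition block_graph :: "nat \<Rightarrow> (nat \<Rightarrow> nat) \<Rightarrow> nat set set" where
  "block_graph n b = {{u, v} | u v. u < n \<and> v < n \<and> u \<noteq> v \<and> b u = b v}"

lemma block_graph_iff: "{u, v} \<in> block_graph n b \<longleftrightarrow> u < n \<and> v < n \<and> u \<noteq> v \<and> b u = b v"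
  unfolding block_graph_def by (auto simp: doubleton_eq_iff)

lemma is_graph_block_graph: "is_graph n (block_graph n b)"
  unfolding is_graph_def block_graph_def all_pairs_def by blast

lemma degree_block_graph:
  assumes "v < n"
  shows "degree n (block_graph n b) v = card {u. u < n \<and> b u = b v} - 1"
proof -
  have "{u. u < n \<and> {u, v} \<in> block_graph n b} = {u. u < n \<and> b u = b v} - {v}"
    using assms by (auto simp: block_graph_iff)
  then show ?thesis unfolding degree_def using assms by simp
qed

text \<open>A set is independent exactly when \<open>b\<close> is injective on it; choosing one
  vertex per clique attains the maximum.\<close>

lemma independence_number_block_graph: "independence_number n (block_graph n b) = card (b ` {..<n})"
  unfolding independence_number_def
proof (rule Max_eqI)
  show "finite (card ` {S. independent n (block_graph n b) S})"
  proof -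
    have "{S. independent n (block_graph n b) S} \<subseteq> Pow {..<n}" by (auto simp: independent_def)
    then have "finite {S. independent n (block_graph n b) S}" by (rule finite_subset) simp
    then show ?thesis by (rule finite_imageI)
  qed
  show "y \<le> card (b ` {..<n})" if y: "y \<in> card ` {S. independent n (block_graph n b) S}" for y
  proof -
    obtain S where S: "independent n (block_graph n b) S" "y = card S" using y by blast
    have "inj_on b S" using S(1) unfolding independent_def inj_on_def by (auto simp: block_graph_iff)
    then have "card S = card (b ` S)" by (simp add: card_image)
    also have "\<dots> \<le> card (b ` {..<n})" using S(1) unfolding independent_def by (intro card_mono) auto
    finally show ?thesis using S(2) by simp
  qed
  obtain S where S: "S \<subseteq> {..<n}" "inj_on b S" "b ` S = b ` {..<n}"
    using subset_image_inj[of "b ` {..<n}" b "{..<n}"] by auto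
  then have "independent n (block_graph n b) S"
    unfolding independent_def inj_on_def by (auto simp: block_graph_iff)
  moreover have "card S = card (b ` {..<n})" using S card_image by metis
  ultimately show "card (b ` {..<n}) \<in> card ` {S. independent n (block_graph n b) S}"
    by (intro image_eqI[of _ _ S]) auto
qed

text \<open>Uses ln(1 - p) \<ge> -p - 2p^2, which is at least -2p for p \<le> 1/2.\<close>

lemma exp_le_one_minus:
  fixes p :: real
  assumes "0 \<le> p" "p \<le> 1 / 2"
  shows "exp (- (2 * p * real k)) \<le> (1 - p) ^ k"
proof -
  have "p * p \<le> p * (1 / 2)" using assms by (intro mult_left_mono) auto
  then have "- (2 * p) \<le> ln (1 - p)"
    using ln_one_minus_pos_lower_bound[OF assms] by (simp add: power2_eq_square)
  then have "exp (- (2 * p)) \<le> 1 - p" using assms by (simp add: ln_ge_iff)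
  then have "exp (- (2 * p)) ^ k \<le> (1 - p) ^ k" by (intro power_mono) auto
  then show ?thesis by (simp add: exp_of_nat_mult[symmetric] mult_ac)
qed

section \<open>Two cliques: the bound of order n^(-2)\<close>

definition two_cliques :: "nat \<Rightarrow> nat set set" where
  "two_cliques n = block_graph n (\<lambda>u. if u < n div 2 then 0 else 1)"

lemma two_cliques_min_degree:
  assumes "2 \<le> n"
  shows "min_degree n (two_cliques n) = n div 2 - 1"
proof -
  have deg: "degree n (two_cliques n) v = (if v < n div 2 then n div 2 else n - n div 2) - 1" if "v < n" for v
  proof -
    have "{u. u < n \<and> (if u < n div 2 then 0 else 1 :: nat) = (if v < n div 2 then 0 else 1)} =
      (if v < n div 2 then {..<n div 2} else {n div 2..<n})" by auto
    then show ?thesis unfolding two_cliques_def degree_block_graph[OF that] by simp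
  qed
  show ?thesis
    unfolding min_degree_def
  proof (rule Min_eqI)
    show "n div 2 - 1 \<le> y" if "y \<in> degree n (two_cliques n) ` {..<n}" for y
      using that deg by (auto split: if_splits)
    show "n div 2 - 1 \<in> degree n (two_cliques n) ` {..<n}"
      by (rule image_eqI[of _ _ 0]) (use assms deg[of 0] in auto)
  qed simp
qed

lemma two_cliques_independence_number:
  assumes "2 \<le> n"
  shows "independence_number n (two_cliques n) = 2"
proof -
  have "(\<lambda>u. if u < n div 2 then 0 else 1 :: nat) ` {..<n} = {0, 1}"
  proof
    show "{0, 1} \<subseteq> (\<lambda>u. if u < n div 2 then 0 else 1 :: nat) ` {..<n}"
    proof -
      have "0 \<in> (\<lambda>u. if u < n div 2 then 0 else 1 :: nat) ` {..<n}"
        by (rule image_eqI[of _ _ 0]) (use assms in auto)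
      moreover have "1 \<in> (\<lambda>u. if u < n div 2 then 0 else 1 :: nat) ` {..<n}"
        by (rule image_eqI[of _ _ "n - 1"]) (use assms in auto)
      ultimately show ?thesis by blast
    qed
  qed auto
  then show ?thesis unfolding two_cliques_def independence_number_block_graph by simp
qed

lemma two_cliques_hamiltonian_prob:
  assumes n: "2 \<le> n" and p: "0 \<le> p" "p \<le> 1"
  shows "prob_union n (two_cliques n) p (hamiltonian n) \<le> 1 - (1 - p) ^ (n * n)"
proof -
  define T where "T = cross {..<n div 2} {n div 2..<n}"
  have TA: "T \<subseteq> all_pairs n" unfolding T_def by (rule cross_subset_all_pairs) auto
  have "card T = card {..<n div 2} * card {n div 2..<n}" unfolding T_def by (rule card_cross) auto
  also have "\<dots> \<le> n * n" by (intro mult_mono) auto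
  finally have cT: "card T \<le> n * n" .
  have "prob_union n (two_cliques n) p (hamiltonian n) \<le> random_prob p (all_pairs n) (\<lambda>R. \<not> R \<inter> T = {})"
    unfolding prob_union_eq_random_prob
  proof (rule random_prob_mono[OF p])
    fix R assume ham: "hamiltonian n (two_cliques n \<union> R)"
    show "R \<inter> T \<noteq> {}"
    proof
      assume no: "R \<inter> T = {}"
      have "\<not> hamiltonian n (two_cliques n \<union> R)"
      proof (rule not_hamiltonian_if_cut[of "{..<n div 2}"])
        show "{..<n div 2} \<noteq> {..<n}" using n by auto
        show "{..<n div 2} \<noteq> {}" using n by (auto simp: lessThan_empty_iff)
        show "{x, y} \<notin> two_cliques n \<union> R" if "x \<in> {..<n div 2}" "y \<in> {..<n} - {..<n div 2}" for x y
        proof -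
          have "{x, y} \<in> T" using that unfolding T_def cross_def by force
          then show ?thesis using that no by (auto simp: two_cliques_def block_graph_iff)
        qed
      qed auto
      then show False using ham by blast
    qed
  qed
  also have "\<dots> = 1 - (1 - p) ^ card T"
    using TA by (simp add: random_prob_compl random_prob_disjoint)
  also have "\<dots> \<le> 1 - (1 - p) ^ (n * n)" using p cT by (simp add: power_decreasing)
  finally show ?thesis .
qed

text \<open>A Hamilton cycle needs a random edge between the cliques. If p \<le> c n^(-2) at some
  large n, such an edge is missing with probability at least exp(-2c), which convergence to 1
  excludes from some point on.\<close>

theorem two_cliques_threshold:
  fixes p :: "nat \<Rightarrow> real"
  assumes p: "\<forall>n. 0 \<le> p n \<and> p n \<le> 1"
    and lim: "(\<lambda>n. prob_union n (two_cliques n) (p n) (hamiltonian n)) \<longlonglongrightarrow> 1"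
  shows "p \<in> \<omega>(\<lambda>n. real n powr (-2))"
proof (rule landau_omega.smallI)
  fix c :: real assume c: "0 < c"
  have "1 - exp (- (2 * c)) < 1" by simp
  then have "\<forall>\<^sub>F n in sequentially. 1 - exp (- (2 * c)) < prob_union n (two_cliques n) (p n) (hamiltonian n)"
    using order_tendstoD(1)[OF lim] by blast
  moreover have "\<forall>\<^sub>F n in sequentially. c * real n powr (-2) \<le> 1 / 2" by real_asymp
  ultimately show "\<forall>\<^sub>F n in sequentially. c * norm (real n powr (-2)) \<le> norm (p n)"
    using eventually_ge_at_top[of 2]
  proof eventually_elim
    case (elim n)
    show ?case
    proof (rule ccontr)
      assume "\<not> ?case"
      then have pn: "p n \<le> c * real n powr (-2)" using p by auto
      have "p n * real (n * n) \<le> c * real n powr (-2) * real (n * n)" using pn by (intro mult_right_mono) auto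
      also have "\<dots> = c" using elim by (simp add: powr_minus_divide power2_eq_square)
      finally have "exp (- (2 * c)) \<le> exp (- (2 * p n * real (n * n)))" by simp
      also have "\<dots> \<le> (1 - p n) ^ (n * n)"
        using p pn elim by (intro exp_le_one_minus) auto
      finally show False
        using two_cliques_hamiltonian_prob[of n "p n"] elim p by fastforce
    qed
  qed
qed

section \<open>Many cliques: the logarithmic bound\<close>

definition clique_blocks :: "nat \<Rightarrow> nat \<Rightarrow> nat set set" where
  "clique_blocks n s = block_graph n (\<lambda>u. min (u div s) (n div s - 1))"

text \<open>The \<open>min\<close> in the block function merges the leftover vertices into the last
  block, so every block has at least \<open>s\<close> vertices.\<close>

lemma clique_blocks_min_degree:
  assumes "1 \<le> s" "s \<le> n"
  shows "s - 1 \<le> min_degree n (clique_blocks n s)"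
proof -
  have "s - 1 \<le> degree n (clique_blocks n s) v" if v: "v < n" for v
  proof -
    define i where "i = min (v div s) (n div s - 1)"
    have "1 \<le> n div s" using assms by (simp add: Suc_le_eq div_greater_zero_iff)
    then have i: "i < n div s" "i \<le> n div s - 1" unfolding i_def by auto
    have "(i + 1) * s \<le> (n div s) * s" using i by (intro mult_right_mono) auto
    also have "\<dots> \<le> n" by simp
    finally have "{i * s..<(i + 1) * s} \<subseteq> {..<n}" by auto
    moreover have "u div s = i" if "u \<in> {i * s..<(i + 1) * s}" for u
      using that assms by (intro div_nat_eqI) (auto simp: mult.commute)
    ultimately have "{i * s..<(i + 1) * s} \<subseteq> {u. u < n \<and> min (u div s) (n div s - 1) = min (v div s) (n div s - 1)}"
      using i unfolding i_def[symmetric] by auto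
    then have "card {i * s..<(i + 1) * s} \<le> card {u. u < n \<and> min (u div s) (n div s - 1) = min (v div s) (n div s - 1)}"
      by (intro card_mono) auto
    then show ?thesis unfolding clique_blocks_def degree_block_graph[OF v] by (intro diff_le_mono) simp
  qed
  moreover have "0 < n" using assms by simp
  ultimately show ?thesis unfolding min_degree_def by (subst Min_ge_iff) (auto simp: lessThan_empty_iff)
qed

lemma clique_blocks_independence_number:
  assumes "1 \<le> s" "s \<le> n"
  shows "independence_number n (clique_blocks n s) \<le> n div s"
proof -
  have "1 \<le> n div s" using assms by (simp add: Suc_le_eq div_greater_zero_iff)
  then have "(\<lambda>u. min (u div s) (n div s - 1)) ` {..<n} \<subseteq> {..<n div s}" by auto
  then have "card ((\<lambda>u. min (u div s) (n div s - 1)) ` {..<n}) \<le> card {..<n div s}" by (intro card_mono) auto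
  then show ?thesis unfolding clique_blocks_def independence_number_block_graph by simp
qed

lemma card_all_pairs_le: "card (all_pairs n) \<le> n * n"
proof -
  have "all_pairs n \<subseteq> (\<lambda>(u, v). {u, v}) ` ({..<n} \<times> {..<n})" unfolding all_pairs_def by auto
  then have "card (all_pairs n) \<le> card ((\<lambda>(u, v). {u, v}) ` ({..<n} \<times> {..<n}))" by (intro card_mono) auto
  also have "\<dots> \<le> card ({..<n} \<times> {..<n})" by (rule card_image_le) simp
  finally show ?thesis by (simp add: card_cartesian_product)
qed

text \<open>Only the first \<open>k\<close> blocks are watched; by
  \<open>k + 1 \<le> n div s\<close> the enlarged last block is not among them. The first summand
  bounds the probability of a random edge within their union. Without such an edge, a block can be
  left only towards the remaining vertices, and these events use disjoint sets of pairs, so they are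
  independent; a Hamilton cycle needs all of them.\<close>

lemma clique_blocks_hamiltonian_prob:
  assumes s: "1 \<le> s" and k: "k + 1 \<le> n div s" and p: "0 \<le> p" "p \<le> 1"
  shows "prob_union n (clique_blocks n s) p (hamiltonian n)
     \<le> (real k * real s)\<^sup>2 * p + (1 - (1 - p) ^ (s * n)) ^ k"
proof -
  define U where "U i = {i * s..<(i + 1) * s}" for i
  define T where "T i = cross (U i) {k * s..<n}" for i
  have "(k + 1) * s \<le> (n div s) * s" using k by (intro mult_right_mono) auto
  also have "\<dots> \<le> n" by simp
  finally have ks: "k * s + s \<le> n" by simp
  have Uk: "U i \<subseteq> {..<k * s}" if "i < k" for i
  proof -
    have "(i + 1) * s \<le> k * s" using that by (intro mult_right_mono) auto
    then show ?thesis unfolding U_def by auto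
  qed
  have Udiv: "u \<in> U i \<longleftrightarrow> u div s = i" for u i
    unfolding U_def using s
    using div_nat_eqI[of s i u] dividend_less_times_div[of s u] div_times_less_eq_dividend[of u s]
    by (auto simp: mult.commute)
  have TA: "T i \<subseteq> all_pairs n" if "i < k" for i
    unfolding T_def
  proof (rule cross_subset_all_pairs)
    show "U i \<subseteq> {..<n}" using Uk[OF that] ks by fastforce
    show "U i \<inter> {k * s..<n} = {}" using Uk[OF that] by fastforce
  qed auto
  have cT: "card (T i) \<le> s * n" if "i < k" for i
  proof -
    have "card (T i) = card (U i) * card {k * s..<n}"
    proof -
      have "U i \<inter> {k * s..<n} = {}" using Uk[OF that] by fastforce
      then show ?thesis unfolding T_def by (intro card_cross) (auto simp: U_def)
    qed
    also have "\<dots> \<le> s * n" unfolding U_def by (intro mult_mono) auto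
    finally show ?thesis .
  qed
  have disj: "disjoint_family_on T {..<k}"
    unfolding disjoint_family_on_def
  proof (intro ballI impI)
    fix i j assume ij: "i \<in> {..<k}" "j \<in> {..<k}" "i \<noteq> j"
    show "T i \<inter> T j = {}"
    proof (rule ccontr)
      assume "T i \<inter> T j \<noteq> {}"
      then obtain x y x' y' where "{x, y} = {x', y'}" "x \<in> U i" "y \<in> {k * s..<n}" "x' \<in> U j" "y' \<in> {k * s..<n}"
        unfolding T_def cross_def by auto
      moreover have "x < k * s" "x' < k * s" using Uk ij calculation by blast+
      ultimately have "x = x'" by (auto simp: doubleton_eq_iff)
      then show False using \<open>x \<in> U i\<close> \<open>x' \<in> U j\<close> ij(3) Udiv by simp
    qed
  qed
  have "prob_union n (clique_blocks n s) p (hamiltonian n) \<le>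
     random_prob p (all_pairs n) (\<lambda>R. (\<exists>e\<in>all_pairs (k * s). e \<in> R) \<or> (\<forall>i\<in>{..<k}. R \<inter> T i \<noteq> {}))"
    unfolding prob_union_eq_random_prob
  proof (rule random_prob_mono[OF p])
    fix R assume ham: "hamiltonian n (clique_blocks n s \<union> R)"
    show "(\<exists>e\<in>all_pairs (k * s). e \<in> R) \<or> (\<forall>i\<in>{..<k}. R \<inter> T i \<noteq> {})"
    proof (rule ccontr)
      assume "\<not> ?thesis"
      then obtain i where i: "i < k" "R \<inter> T i = {}" and no: "\<And>e. e \<in> all_pairs (k * s) \<Longrightarrow> e \<notin> R" by blast
      have "\<not> hamiltonian n (clique_blocks n s \<union> R)"
      proof (rule not_hamiltonian_if_cut[of "U i"])
        show "U i \<subseteq> {..<n}" using Uk[OF i(1)] ks by auto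
        show "U i \<noteq> {}" using s unfolding U_def by simp
        have "k * s \<notin> U i" using Uk[OF i(1)] by blast
        moreover have "k * s \<in> {..<n}" using ks s by simp
        ultimately show "U i \<noteq> {..<n}" by blast
        show "{x, y} \<notin> clique_blocks n s \<union> R" if xy: "x \<in> U i" "y \<in> {..<n} - U i" for x y
        proof -
          have xk: "x < k * s" using xy Uk[OF i(1)] by blast
          have "{x, y} \<notin> R"
          proof (cases "y < k * s")
            case True
            then have "{x, y} \<in> all_pairs (k * s)" using xk xy unfolding all_pairs_def by blast
            then show ?thesis by (rule no)
          next
            case False
            then have "{x, y} \<in> T i" using xy unfolding T_def cross_def by force
            then show ?thesis using i(2) by blast
          qed
          moreover have "min (x div s) (n div s - 1) \<noteq> min (y div s) (n div s - 1)"
          proof -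
            have "x div s = i" "y div s \<noteq> i" using xy Udiv by auto
            then show ?thesis using i(1) k by (auto simp: min_def)
          qed
          ultimately show ?thesis unfolding clique_blocks_def by (auto simp: block_graph_iff)
        qed
      qed
      then show False using ham by blast
    qed
  qed
  also have "\<dots> \<le> random_prob p (all_pairs n) (\<lambda>R. \<exists>e\<in>all_pairs (k * s). e \<in> R)
     + random_prob p (all_pairs n) (\<lambda>R. \<forall>i\<in>{..<k}. R \<inter> T i \<noteq> {})"
    by (rule random_prob_disj_le[OF p])
  also have "\<dots> \<le> (real k * real s)\<^sup>2 * p + (1 - (1 - p) ^ (s * n)) ^ k"
  proof (rule add_mono)
    have sub: "all_pairs (k * s) \<subseteq> all_pairs n" using ks unfolding all_pairs_def by force
    have "random_prob p (all_pairs n) (\<lambda>R. \<exists>e\<in>all_pairs (k * s). e \<in> R)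
       \<le> (\<Sum>e\<in>all_pairs (k * s). random_prob p (all_pairs n) (\<lambda>R. e \<in> R))"
      by (rule random_prob_Bex_le[OF p]) simp
    also have "\<dots> = (\<Sum>e\<in>all_pairs (k * s). p)"
      using sub by (intro sum.cong random_prob_mem) auto
    also have "\<dots> = real (card (all_pairs (k * s))) * p" by simp
    also have "\<dots> \<le> real (k * s * (k * s)) * p"
      using card_all_pairs_le[of "k * s"] p by (intro mult_right_mono of_nat_mono) auto
    also have "\<dots> = (real k * real s)\<^sup>2 * p" by (simp add: power2_eq_square)
    finally show "random_prob p (all_pairs n) (\<lambda>R. \<exists>e\<in>all_pairs (k * s). e \<in> R) \<le> (real k * real s)\<^sup>2 * p" .
    have "random_prob p (all_pairs n) (\<lambda>R. \<forall>i\<in>{..<k}. R \<inter> T i \<noteq> {}) = (\<Prod>i<k. 1 - (1 - p) ^ card (T i))"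
      by (rule random_prob_hit_all) (use TA disj in auto)
    also have "\<dots> \<le> (\<Prod>i<k. 1 - (1 - p) ^ (s * n))"
      using p cT by (intro prod_mono) (auto simp: power_decreasing power_le_one)
    finally show "random_prob p (all_pairs n) (\<lambda>R. \<forall>i\<in>{..<k}. R \<inter> T i \<noteq> {}) \<le> (1 - (1 - p) ^ (s * n)) ^ k"
      by simp
  qed
  finally show ?thesis .
qed

text \<open>The absolute value appears because \<Omega> controls only the size of \<delta>; the
  added 1 compensates for degrees being one less than the clique size. The independence number is at
  most n/s \<le> 1/\<bar>\<delta>\<bar>, which is O(\<delta>^2 n) precisely because \<delta> is at
  least of order n^(-1/3).\<close>

theorem clique_blocks_not_hamiltonian:
  fixes \<delta> :: "nat \<Rightarrow> real"
  assumes \<Omega>: "\<delta> \<in> \<Omega>(\<lambda>n. real n powr (-1/3))" and \<delta>0: "\<delta> \<longlonglongrightarrow> 0"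
  defines "s \<equiv> \<lambda>n. nat \<lceil>\<bar>\<delta> n\<bar> * real n\<rceil> + 1"
  defines "H \<equiv> \<lambda>n. clique_blocks n (s n)"
  shows "\<forall>\<^sub>F n in sequentially. real (min_degree n (H n)) \<ge> \<delta> n * real n"
    and "(\<lambda>n. real (independence_number n (H n))) \<in> O(\<lambda>n. \<delta> n ^ 2 * real n)"
    and "\<lbrakk>\<forall>n. 0 \<le> p n \<and> p n \<le> 1;
      \<forall>\<^sub>F n in sequentially. p n \<le> 1 / 24 * ln (1 / \<delta> n) / (\<delta> n * real n ^ 2)\<rbrakk> \<Longrightarrow>
      (\<lambda>n. prob_union n (H n) (p n) (\<lambda>E. \<not> hamiltonian n E)) \<longlonglongrightarrow> 1"
proof -
  define e where "e n = \<bar>\<delta> n\<bar>" for n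
  obtain c where c: "0 < c" and ec: "\<forall>\<^sub>F n in sequentially. c * real n powr (-1/3) \<le> e n"
    using landau_omega.bigE[OF \<Omega>] unfolding e_def by auto
  have e0: "e \<longlonglongrightarrow> 0" using tendsto_rabs_zero[OF \<delta>0] unfolding e_def .
  have epos: "\<forall>\<^sub>F n in sequentially. 0 < e n"
    using ec eventually_gt_at_top[of 0]
  proof eventually_elim
    case (elim n)
    have "0 < c * real n powr (-1/3)" using c elim by simp
    then show ?case using elim by linarith
  qed
  have eright: "filterlim e (at_right 0) sequentially"
    unfolding filterlim_at using e0 epos by (auto elim: eventually_mono)
  have en: "filterlim (\<lambda>n. e n * real n) at_top sequentially"
  proof (rule filterlim_at_top_mono)
    show "filterlim (\<lambda>n. c * real n powr (-1/3) * real n) at_top sequentially" using c by real_asymp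
    show "\<forall>\<^sub>F n in sequentially. c * real n powr (-1/3) * real n \<le> e n * real n"
      using ec by eventually_elim (intro mult_right_mono, auto)
  qed
  have sb: "\<forall>\<^sub>F n in sequentially. e n * real n \<le> real (s n) - 1 \<and> real (s n) \<le> 2 * e n * real n \<and> s n \<le> n"
  proof -
    have "\<forall>\<^sub>F n in sequentially. e n < 1 / 2" using order_tendstoD(2)[OF e0, of "1 / 2"] by simp
    moreover have "\<forall>\<^sub>F n in sequentially. 2 \<le> e n * real n" using en unfolding filterlim_at_top by blast
    ultimately show ?thesis
    proof eventually_elim
      case (elim n)
      have s: "e n * real n \<le> real (s n) - 1" "real (s n) \<le> e n * real n + 2"
        unfolding s_def e_def[symmetric] using elim by linarith+
      have "e n * real n \<le> 1 / 2 * real n" using elim by (intro mult_right_mono) auto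
      then have "real (s n) \<le> real n" using s elim by linarith
      then show ?case using s elim by auto
    qed
  qed
  have s1: "1 \<le> s n" for n unfolding s_def by simp
  show "\<forall>\<^sub>F n in sequentially. real (min_degree n (H n)) \<ge> \<delta> n * real n"
    using sb
  proof eventually_elim
    case (elim n)
    have "\<delta> n * real n \<le> e n * real n" unfolding e_def by (intro mult_right_mono) auto
    also have "\<dots> \<le> real (s n - 1)" using elim s1[of n] by (simp add: of_nat_diff)
    also have "\<dots> \<le> real (min_degree n (H n))"
      unfolding H_def using clique_blocks_min_degree[OF s1] elim by (intro of_nat_mono) blast
    finally show ?case .
  qed
  show "(\<lambda>n. real (independence_number n (H n))) \<in> O(\<lambda>n. \<delta> n ^ 2 * real n)"
  proof (rule landau_o.bigI)
    show "0 < 1 / c ^ 3" using c by simp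
    show "\<forall>\<^sub>F n in sequentially. norm (real (independence_number n (H n))) \<le> 1 / c ^ 3 * norm (\<delta> n ^ 2 * real n)"
      using sb ec epos eventually_gt_at_top[of 0]
    proof eventually_elim
      case (elim n)
      have "(real n powr (-1/3)) ^ 3 = real n powr (-1/3 + (-1/3 + -1/3))"
        unfolding powr_add by (simp add: power3_eq_cube mult.assoc)
      also have "\<dots> = 1 / real n" using elim by (simp add: powr_minus_divide)
      finally have "c ^ 3 / real n = (c * real n powr (-1/3)) ^ 3" unfolding power_mult_distrib by simp
      also have "\<dots> \<le> e n ^ 3" using elim c by (intro power_mono) auto
      finally have c3: "c ^ 3 \<le> e n ^ 3 * real n" using elim by (simp add: field_simps)
      have "real (independence_number n (H n)) \<le> real (n div s n)"
        unfolding H_def using clique_blocks_independence_number[OF s1] elim by (intro of_nat_mono) blast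
      also have "\<dots> \<le> real n / real (s n)" by (rule of_nat_div_le_of_nat)
      also have "\<dots> \<le> real n / (e n * real n)"
        using elim s1[of n] by (intro divide_left_mono) auto
      also have "\<dots> = 1 / e n" using elim by simp
      also have "\<dots> \<le> e n ^ 2 * real n / c ^ 3"
        using c3 c elim by (simp add: field_simps eval_nat_numeral)
      finally show ?case unfolding e_def by simp
    qed
  qed
  show "(\<lambda>n. prob_union n (H n) (p n) (\<lambda>E. \<not> hamiltonian n E)) \<longlonglongrightarrow> 1"
    if p: "\<forall>n. 0 \<le> p n \<and> p n \<le> 1"
      and pb: "\<forall>\<^sub>F n in sequentially. p n \<le> 1 / 24 * ln (1 / \<delta> n) / (\<delta> n * real n ^ 2)"
  proof -
    \<comment> \<open>The exponent -1/3 balances two demands with e = \<bar>\<delta>\<bar>: e^(-1/3)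
      cliques, each isolated with probability at least e^(1/6), give an expected number tending to
      infinity, while random edges among them have expected number of order e^(1/3) ln(1/e), tending
      to 0.\<close>
    define k where "k n = nat \<lfloor>e n powr (-1/3)\<rfloor>" for n
    have small: "\<forall>\<^sub>F x in at_right (0 :: real). x < 1 \<and> x powr (-1/3) \<le> 1 / (2 * x) - 2 \<and> x powr (-1/3) \<ge> 2"
      by (intro eventually_conj; real_asymp)
    define err where "err x = 1 / 6 * x powr (1/3) * ln (1 / x) + exp (- (x powr (-1/6) / 2))" for x :: real
    have "\<forall>\<^sub>F n in sequentially. prob_union n (H n) (p n) (hamiltonian n) \<le> err (e n)"
      using eventually_compose_filterlim[OF small eright] pb sb epos eventually_gt_at_top[of 0]
        filterlim_at_top[THEN iffD1, OF en, rule_format, of 2]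
    proof eventually_elim
      case (elim n)
      define l where "l = ln (1 / e n)"
      have l: "0 < l" "l \<le> 1 / e n"
        unfolding l_def using elim ln_less_self[of "1 / e n"] by (auto simp: ln_div)
      have pn: "p n \<le> 1 / 24 * l / (e n * (real n)\<^sup>2)"
      proof (cases "0 < \<delta> n")
        case True
        then show ?thesis using elim unfolding l_def e_def by simp
      next
        case False
        \<comment> \<open>Since \<open>ln (- x) = ln x\<close>, a negative \<open>\<delta> n\<close> would force \<open>p n < 0\<close>.\<close>
        then have "\<delta> n = - e n" unfolding e_def by simp
        then have "p n \<le> 1 / 24 * ln (- (1 / e n)) / (- e n * (real n)\<^sup>2)" using elim by simp
        also have "\<dots> = - (1 / 24 * l / (e n * (real n)\<^sup>2))" unfolding l_def ln_minus by simp
        also have "\<dots> < 0" using l elim by simp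
        finally show ?thesis using p by (meson not_le)
      qed
      have k: "real (k n) \<le> e n powr (-1/3)" "e n powr (-1/3) / 2 \<le> real (k n)"
        unfolding k_def using elim by linarith+
      have kn: "k n + 1 \<le> n div s n"
      proof -
        have "real n / real (s n) - 1 \<le> real (n div s n)"
          using real_of_int_div3[of "int n" "int (s n)"] by (simp flip: of_nat_div)
        moreover have "1 / (2 * e n) \<le> real n / real (s n)"
          using elim s1[of n] by (simp add: field_simps)
        ultimately have "real (k n) + 1 \<le> real (n div s n)" using k elim by linarith
        then show ?thesis by linarith
      qed
      have "prob_union n (H n) (p n) (hamiltonian n)
         \<le> (real (k n) * real (s n))\<^sup>2 * p n + (1 - (1 - p n) ^ (s n * n)) ^ k n"
        unfolding H_def using p by (intro clique_blocks_hamiltonian_prob s1 kn) auto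
      also have "(real (k n) * real (s n))\<^sup>2 * p n \<le>
         (e n powr (-1/3) * (2 * e n * real n))\<^sup>2 * (1 / 24 * l / (e n * (real n)\<^sup>2))"
        using k(1) elim pn p by (intro mult_mono power_mono) auto
      also have "\<dots> = 1 / 6 * ((e n powr (-1/3))\<^sup>2 * e n) * l"
        using elim by (simp add: power2_eq_square field_simps)
      also have "(e n powr (-1/3))\<^sup>2 * e n = e n powr (1/3)"
      proof -
        have "(e n powr (-1/3))\<^sup>2 * e n powr 1 = e n powr (-1/3 + (-1/3 + 1))"
          unfolding powr_add power2_eq_square by simp
        then show ?thesis using elim by simp
      qed
      also have "(1 - (1 - p n) ^ (s n * n)) ^ k n \<le> exp (- (e n powr (-1/6) / 2))"
      proof -
        have p2: "p n \<le> 1 / 2"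
        proof -
          have "1 / 24 * l / (e n * (real n)\<^sup>2) \<le> 1 / 24 * (1 / e n) / (e n * (real n)\<^sup>2)"
            using l elim by (intro divide_right_mono mult_left_mono) auto
          also have "\<dots> = 1 / 24 / (e n * real n)\<^sup>2" by (simp add: power2_eq_square)
          also have "\<dots> \<le> 1 / 24 / 2\<^sup>2" using elim by (intro divide_left_mono power_mono) auto
          finally show ?thesis using pn by simp
        qed
        \<comment> \<open>The constant 1/24 and s \<le> 2en make this at most ln(1/e)/6, which turns
          into the isolation probability e^(1/6).\<close>
        have "2 * p n * real (s n * n) \<le> 2 * (1 / 24 * l / (e n * (real n)\<^sup>2)) * (2 * e n * real n * real n)"
          using pn p elim l by (intro mult_mono) auto
        also have "\<dots> = l / 6" using elim by (simp add: power2_eq_square field_simps)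
        finally have "exp (- (l / 6)) \<le> exp (- (2 * p n * real (s n * n)))" by simp
        also have "\<dots> \<le> (1 - p n) ^ (s n * n)" using p p2 by (intro exp_le_one_minus) auto
        finally have "exp (- (l / 6)) \<le> (1 - p n) ^ (s n * n)" .
        moreover have "exp (- (l / 6)) = e n powr (1/6)"
          unfolding l_def powr_def using elim by (simp add: ln_div)
        ultimately have "1 - (1 - p n) ^ (s n * n) \<le> 1 - e n powr (1/6)" by simp
        also have "\<dots> \<le> exp (- (e n powr (1/6)))" using exp_ge_add_one_self[of "- (e n powr (1/6))"] by simp
        finally have "(1 - (1 - p n) ^ (s n * n)) ^ k n \<le> exp (- (e n powr (1/6))) ^ k n"
          using p by (intro power_mono) (auto simp: power_le_one)
        also have "\<dots> = exp (- (real (k n) * e n powr (1/6)))" by (simp add: exp_of_nat_mult[symmetric])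
        also have "\<dots> \<le> exp (- (e n powr (-1/3) / 2 * e n powr (1/6)))"
          unfolding exp_le_cancel_iff neg_le_iff_le using k(2) by (rule mult_right_mono) simp
        also have "e n powr (-1/3) / 2 * e n powr (1/6) = e n powr (-1/3 + 1/6) / 2"
          unfolding powr_add by simp
        finally show ?thesis by simp
      qed
      finally show ?case unfolding err_def l_def by simp
    qed
    then have lower: "\<forall>\<^sub>F n in sequentially. 1 - err (e n) \<le> prob_union n (H n) (p n) (\<lambda>E. \<not> hamiltonian n E)"
      unfolding prob_union_eq_random_prob by eventually_elim (simp add: random_prob_compl)
    have "(err \<longlongrightarrow> 0) (at_right 0)" unfolding err_def by real_asymp
    then have "(\<lambda>n. err (e n)) \<longlonglongrightarrow> 0" using eright by (rule filterlim_compose)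
    then have lim: "(\<lambda>n. 1 - err (e n)) \<longlonglongrightarrow> 1" using tendsto_diff[OF tendsto_const, of _ 0 _ 1] by fastforce
    show ?thesis
    proof (rule tendsto_sandwich[OF lower _ lim tendsto_const])
      show "\<forall>\<^sub>F n in sequentially. prob_union n (H n) (p n) (\<lambda>E. \<not> hamiltonian n E) \<le> 1"
        using p by (auto simp: prob_union_eq_random_prob intro!: always_eventually random_prob_le_1)
    qed
  qed
qed

theorem theorem1p2:
  shows "\<exists>c1 c2 c3 c4 :: real. c1 > 0 \<and> c2 > 0 \<and> c3 > 0 \<and> c4 > 0 \<and>
    \<comment> \<open>(a)\<close>
    (\<forall>(G :: nat \<Rightarrow> nat set set) (\<delta> :: nat \<Rightarrow> real) (p :: nat \<Rightarrow> real).
       (\<forall>n. is_graph n (G n)) \<longrightarrow>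
       (\<forall>n. 0 \<le> p n \<and> p n \<le> 1) \<longrightarrow>
       (\<forall>\<^sub>F n in sequentially. real (min_degree n (G n)) \<ge> \<delta> n * real n) \<longrightarrow>
       (\<forall>\<^sub>F n in sequentially. \<delta> n \<ge> c1 * real n powr (-1/3)) \<longrightarrow>
       (\<forall>\<^sub>F n in sequentially. real (independence_number n (G n)) \<le> c2 * \<delta> n ^ 2 * real n) \<longrightarrow>
       p \<in> \<omega>(\<lambda>n. real n powr (-2)) \<longrightarrow>
       (\<forall>\<^sub>F n in sequentially. p n \<ge> c3 * ln (1 / \<delta> n) / (\<delta> n * real n ^ 2)) \<longrightarrow>
       ((\<lambda>n. prob_union n (G n) (p n) (pancyclic n)) \<longlonglongrightarrow> 1)) \<and>
    \<comment> \<open>(b)\<close>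
    (\<exists>H :: nat \<Rightarrow> nat set set.
       (\<forall>n. is_graph n (H n)) \<and>
       (\<forall>n\<ge>2. min_degree n (H n) = n div 2 - 1 \<and> independence_number n (H n) = 2) \<and>
       (\<forall>p :: nat \<Rightarrow> real. (\<forall>n. 0 \<le> p n \<and> p n \<le> 1) \<longrightarrow>
          ((\<lambda>n. prob_union n (H n) (p n) (hamiltonian n)) \<longlonglongrightarrow> 1) \<longrightarrow>
          p \<in> \<omega>(\<lambda>n. real n powr (-2)))) \<and>
    \<comment> \<open>(c)\<close>
    (\<forall>\<delta> :: nat \<Rightarrow> real.
       \<delta> \<in> \<Omega>(\<lambda>n. real n powr (-1/3)) \<longrightarrow> \<delta> \<longlonglongrightarrow> 0 \<longrightarrow>
       (\<exists>H :: nat \<Rightarrow> nat set set.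
          (\<forall>n. is_graph n (H n)) \<and>
          (\<forall>\<^sub>F n in sequentially. real (min_degree n (H n)) \<ge> \<delta> n * real n) \<and>
          (\<lambda>n. real (independence_number n (H n))) \<in> O(\<lambda>n. \<delta> n ^ 2 * real n) \<and>
          (\<forall>p :: nat \<Rightarrow> real. (\<forall>n. 0 \<le> p n \<and> p n \<le> 1) \<longrightarrow>
             (\<forall>\<^sub>F n in sequentially. p n \<le> c4 * ln (1 / \<delta> n) / (\<delta> n * real n ^ 2)) \<longrightarrow>
             ((\<lambda>n. prob_union n (H n) (p n) (\<lambda>E. \<not> hamiltonian n E)) \<longlonglongrightarrow> 1))))"
proof (rule exI[of _ 200], rule exI[of _ "1 / 4000"], rule exI[of _ 286720], rule exI[of _ "1 / 24"], intro conjI)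
  show "\<forall>G \<delta> p. (\<forall>n. is_graph n (G n)) \<longrightarrow>
       (\<forall>n. 0 \<le> p n \<and> p n \<le> 1) \<longrightarrow>
       (\<forall>\<^sub>F n in sequentially. real (min_degree n (G n)) \<ge> \<delta> n * real n) \<longrightarrow>
       (\<forall>\<^sub>F n in sequentially. \<delta> n \<ge> 200 * real n powr (-1/3)) \<longrightarrow>
       (\<forall>\<^sub>F n in sequentially. real (independence_number n (G n)) \<le> 1 / 4000 * \<delta> n ^ 2 * real n) \<longrightarrow>
       p \<in> \<omega>(\<lambda>n. real n powr (-2)) \<longrightarrow>
       (\<forall>\<^sub>F n in sequentially. p n \<ge> 286720 * ln (1 / \<delta> n) / (\<delta> n * real n ^ 2)) \<longrightarrow>
       ((\<lambda>n. prob_union n (G n) (p n) (pancyclic n)) \<longlonglongrightarrow> 1)"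
    by (intro allI impI) (rule aas_pancyclic)
  show "\<exists>H. (\<forall>n. is_graph n (H n)) \<and>
       (\<forall>n\<ge>2. min_degree n (H n) = n div 2 - 1 \<and> independence_number n (H n) = 2) \<and>
       (\<forall>p :: nat \<Rightarrow> real. (\<forall>n. 0 \<le> p n \<and> p n \<le> 1) \<longrightarrow>
          ((\<lambda>n. prob_union n (H n) (p n) (hamiltonian n)) \<longlonglongrightarrow> 1) \<longrightarrow>
          p \<in> \<omega>(\<lambda>n. real n powr (-2)))"
  proof (intro exI[of _ two_cliques] conjI allI impI)
    show "is_graph n (two_cliques n)" for n
      unfolding two_cliques_def by (rule is_graph_block_graph)
  qed (simp_all add: two_cliques_min_degree two_cliques_independence_number two_cliques_threshold)
  show "\<forall>\<delta> :: nat \<Rightarrow> real.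
       \<delta> \<in> \<Omega>(\<lambda>n. real n powr (-1/3)) \<longrightarrow> \<delta> \<longlonglongrightarrow> 0 \<longrightarrow>
       (\<exists>H :: nat \<Rightarrow> nat set set.
          (\<forall>n. is_graph n (H n)) \<and>
          (\<forall>\<^sub>F n in sequentially. real (min_degree n (H n)) \<ge> \<delta> n * real n) \<and>
          (\<lambda>n. real (independence_number n (H n))) \<in> O(\<lambda>n. \<delta> n ^ 2 * real n) \<and>
          (\<forall>p :: nat \<Rightarrow> real. (\<forall>n. 0 \<le> p n \<and> p n \<le> 1) \<longrightarrow>
             (\<forall>\<^sub>F n in sequentially. p n \<le> 1 / 24 * ln (1 / \<delta> n) / (\<delta> n * real n ^ 2)) \<longrightarrow>
             ((\<lambda>n. prob_union n (H n) (p n) (\<lambda>E. \<not> hamiltonian n E)) \<longlonglongrightarrow> 1)))"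
  proof (intro allI impI)
    fix \<delta> :: "nat \<Rightarrow> real"
    assume \<delta>: "\<delta> \<in> \<Omega>(\<lambda>n. real n powr (-1/3))" "\<delta> \<longlonglongrightarrow> 0"
    define H where "H n = clique_blocks n (nat \<lceil>\<bar>\<delta> n\<bar> * real n\<rceil> + 1)" for n
    note props = clique_blocks_not_hamiltonian[OF \<delta>, folded H_def]
    show "\<exists>H :: nat \<Rightarrow> nat set set.
          (\<forall>n. is_graph n (H n)) \<and>
          (\<forall>\<^sub>F n in sequentially. real (min_degree n (H n)) \<ge> \<delta> n * real n) \<and>
          (\<lambda>n. real (independence_number n (H n))) \<in> O(\<lambda>n. \<delta> n ^ 2 * real n) \<and>
          (\<forall>p :: nat \<Rightarrow> real. (\<forall>n. 0 \<le> p n \<and> p n \<le> 1) \<longrightarrow>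
             (\<forall>\<^sub>F n in sequentially. p n \<le> 1 / 24 * ln (1 / \<delta> n) / (\<delta> n * real n ^ 2)) \<longrightarrow>
             ((\<lambda>n. prob_union n (H n) (p n) (\<lambda>E. \<not> hamiltonian n E)) \<longlonglongrightarrow> 1))"
    proof (intro exI[of _ H] conjI allI impI)
      show "is_graph n (H n)" for n
        unfolding H_def clique_blocks_def by (rule is_graph_block_graph)
    qed (fact props)+
  qed
qed simp_all

end
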